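(* Let $F$ satisfy (A0), (A1), (A2) with constants $\kappa_1,\kappa_2$, and let $\theta^*\in\mathbb{R}^n$ satisfy $\mathbf 1^\top\theta^*=0$ and $\|\theta^*\|_\infty\le 1$. For every absolute constant $c_0>0$ there exist absolute constants $c_1,c_2>0$ such that the following holds. If $\gamma=c_0\sqrt{np\log n}$, $p\ge c_1\frac{\log n}{n\varepsilon}$, $\lambda=8\kappa_1/\varepsilon$ and $c_2(\log n)^{-1/2}<\varepsilon<1$, then the estimator $\widetilde\theta$ is $(\varepsilon,0)$ edge differentially private, and with probability at least $1-O(n^{-5})$, $$\|\widetilde\theta-\theta^*\|_\infty\lesssim \sqrt{\frac{\log n}{np}}+\frac{\log n}{np\varepsilon}.$$ (The implied constants depend only on $c_0,c_1,c_2,\kappa_1,\kappa_2$.)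
   Context: Model. There are $n$ items indexed by $[n]=\{1,\dots,n\}$. Each pair $(i,j)$, $1\le i<j\le n$, is compared independently with known probability $p\in(0,1]$; the compared pairs form the edge set of a random graph $\mathcal G$. Given $\mathcal G$, the outcomes $y_{ij}\in\{0,1\}$, $(i,j)\in\mathcal G$, $i<j$, are independent with $\Pr(y_{ij}=1)=F(\theta^*_i-\theta^*_j)$, and $y_{ji}=1-y_{ij}$. Here $\theta^*\in\mathbb R^n$ is the unknown parameter and $F$ is a known link function. Regularity conditions on $F$ ($F$ is twice differentiable): (A0) $F:\mathbb R\to[0,1]$ is strictly increasing and $F(x)=1-F(-x)$ for all $x\in\mathbb R$. (A1) There is an absolute constant $\kappa_1>0$ with $\sup_{x\in\mathbb R}\frac{F'(x)}{F(x)(1-F(x))}<\kappa_1$. (A2) $\frac{\partial^2}{\partial x^2}(-\log F(x))>0$ for all $x$, and there is an absolute constant $\kappa_2>0$ with $\frac{\partial^2}{\partial x^2}(-\log F(x))<\kappa_2$ for all $x$ and $\min_{|x|\le 4}\frac{\partial^2}{\partial x^2}(-\log F(x))>1/\kappa_2$. Estimator. With $F_{ij}(\theta)=F(\theta_i-\theta_j)$ and $\mathcal L(\theta;y)=\sum_{(i,j)\in\mathcal G}\left[-y_{ij}\log F_{ij}(\theta)-y_{ji}\log(1-F_{ij}(\theta))\right]$ (each edge counted once), $$\widetilde\theta=\arg\min_{\theta\in\mathbb R^n}\ \mathcal L(\theta;y)+\frac{\gamma}{2}\|\theta\|_2^2+w^\top\theta,$$ where $w=(w_1,\dots,w_n)$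 has i.i.d. Laplace entries with scale $\lambda$ (density $\frac{1}{2\lambda}e^{-|x|/\lambda}$), independent of the data. Edge differential privacy. Two comparison data sets $(\mathcal G,(y_{ij})_{(i,j)\in\mathcal G})$ and $(\mathcal G',(y'_{ij})_{(i,j)\in\mathcal G'})$ are adjacent if either $\mathcal G=\mathcal G'$ and the outcomes differ on exactly one edge, or $\mathcal G$ is obtained from $\mathcal G\cap\mathcal G'$ by adding one edge and $\mathcal G'$ by adding one different edge, with all outcomes on $\mathcal G\cap\mathcal G'$ equal. A randomized algorithm $M$ is $(\varepsilon,\delta)$ edge differentially private if $\Pr(M(X)\in A)\le e^{\varepsilon}\Pr(M(X')\in A)+\delta$ for all adjacent $X,X'$ and all measurable $A$. *)

theory Defs
  imports "HOL-Probability.Probability"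
begin

subsection \<open>Link functions\<close>

definition twice_differentiable :: "(real \<Rightarrow> real) \<Rightarrow> bool" where
  "twice_differentiable F \<longleftrightarrow>
     (\<forall>x. F differentiable (at x)) \<and> (\<forall>x. deriv F differentiable (at x))"

definition link_A0 :: "(real \<Rightarrow> real) \<Rightarrow> bool" where
  "link_A0 F \<longleftrightarrow>
     (\<forall>x. F x \<in> {0..1}) \<and> strict_mono F \<and> (\<forall>x. F x = 1 - F (- x))"

text \<open>The real-valued supremum is only meaningful on bounded sets, hence \<^const>\<open>bdd_above\<close>.\<close>

definition link_A1 :: "real \<Rightarrow> (real \<Rightarrow> real) \<Rightarrow> bool" where
  "link_A1 \<kappa>1 F \<longleftrightarrow>
     bdd_above (range (\<lambda>x. deriv F x / (F x * (1 - F x)))) \<and>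
     (SUP x. deriv F x / (F x * (1 - F x))) < \<kappa>1"

definition neg_log_deriv2 :: "(real \<Rightarrow> real) \<Rightarrow> real \<Rightarrow> real" where
  "neg_log_deriv2 F = (deriv ^^ 2) (\<lambda>x. - ln (F x))"

text \<open>The condition on the minimum over \<open>\<bar>x\<bar> \<le> 4\<close> is stated pointwise, because no continuity
  of the second derivative is assumed that would make the minimum exist.\<close>

definition link_A2 :: "real \<Rightarrow> (real \<Rightarrow> real) \<Rightarrow> bool" where
  "link_A2 \<kappa>2 F \<longleftrightarrow>
     (\<forall>x. 0 < neg_log_deriv2 F x) \<and>
     (\<forall>x. neg_log_deriv2 F x < \<kappa>2) \<and>
     (\<forall>x. \<bar>x\<bar> \<le> 4 \<longrightarrow> 1 / \<kappa>2 < neg_log_deriv2 F x)"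


subsection \<open>Comparison data\<close>

text \<open>A data set \<open>(G, y)\<close> consists of the set \<open>G\<close> of compared pairs \<open>(i, j)\<close>, \<open>i < j\<close>, and
  their outcomes.  Only the values of \<open>y\<close> on \<open>G\<close> carry meaning; \<open>y\<^sub>j\<^sub>i = 1 - y\<^sub>i\<^sub>j\<close> is not stored.\<close>

type_synonym comparison_data = "(nat \<times> nat) set \<times> (nat \<times> nat \<Rightarrow> bool)"

definition item_pairs :: "nat \<Rightarrow> (nat \<times> nat) set" where
  "item_pairs n = {(i, j). 1 \<le> i \<and> i < j \<and> j \<le> n}"

definition data_sets :: "nat \<Rightarrow> comparison_data set" where
  "data_sets n = {(G, y). G \<subseteq> item_pairs n}"

definition graph_pmf :: "nat \<Rightarrow> real \<Rightarrow> (nat \<times> nat) set pmf" where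
  "graph_pmf n p = map_pmf Collect (Pi_pmf (item_pairs n) False (\<lambda>_. bernoulli_pmf p))"

definition data_pmf ::
    "(real \<Rightarrow> real) \<Rightarrow> nat \<Rightarrow> real \<Rightarrow> (nat \<Rightarrow> real) \<Rightarrow> comparison_data pmf" where
  "data_pmf F n p \<theta> =
     bind_pmf (graph_pmf n p) (\<lambda>G.
       map_pmf (\<lambda>y. (G, y)) (Pi_pmf G False (\<lambda>(i, j). bernoulli_pmf (F (\<theta> i - \<theta> j)))))"


subsection \<open>The estimator\<close>

text \<open>Vectors in \<open>\<real>\<^sup>n\<close> are functions in \<open>{1..n} \<rightarrow>\<^sub>E UNIV\<close>, with the \<open>\<sigma>\<close>-algebra \<open>euclid n\<close>.\<close>

abbreviation euclid :: "nat \<Rightarrow> (nat \<Rightarrow> real) measure" where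
  "euclid n \<equiv> PiM {1..n} (\<lambda>_. borel)"

definition neg_log_lik :: "(real \<Rightarrow> real) \<Rightarrow> comparison_data \<Rightarrow> (nat \<Rightarrow> real) \<Rightarrow> real" where
  "neg_log_lik F X \<theta> = (case X of (G, y) \<Rightarrow>
     (\<Sum>(i, j)\<in>G. - of_bool (y (i, j)) * ln (F (\<theta> i - \<theta> j))
                 - (1 - of_bool (y (i, j))) * ln (1 - F (\<theta> i - \<theta> j))))"

definition objective ::
    "(real \<Rightarrow> real) \<Rightarrow> nat \<Rightarrow> real \<Rightarrow> comparison_data \<Rightarrow> (nat \<Rightarrow> real) \<Rightarrow> (nat \<Rightarrow> real) \<Rightarrow> real" where
  "objective F n \<gamma> X w \<theta> =
     neg_log_lik F X \<theta> + \<gamma> / 2 * (\<Sum>i\<in>{1..n}. (\<theta> i)\<^sup>2) + (\<Sum>i\<in>{1..n}. w i * \<theta> i)"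

definition estimator ::
    "(real \<Rightarrow> real) \<Rightarrow> nat \<Rightarrow> real \<Rightarrow> comparison_data \<Rightarrow> (nat \<Rightarrow> real) \<Rightarrow> (nat \<Rightarrow> real)" where
  "estimator F n \<gamma> X w = arg_min (objective F n \<gamma> X w) (\<lambda>\<theta>. \<theta> \<in> {1..n} \<rightarrow>\<^sub>E UNIV)"

definition laplace :: "real \<Rightarrow> real measure" where
  "laplace b = density lborel (\<lambda>x. ennreal (1 / (2 * b) * exp (- \<bar>x\<bar> / b)))"

definition laplace_noise :: "nat \<Rightarrow> real \<Rightarrow> (nat \<Rightarrow> real) measure" where
  "laplace_noise n b = PiM {1..n} (\<lambda>_. laplace b)"

text \<open>The law of the estimator for a fixed data set, the noise being the only randomness.\<close>

definition estimator_mechanism ::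
    "(real \<Rightarrow> real) \<Rightarrow> nat \<Rightarrow> real \<Rightarrow> real \<Rightarrow> comparison_data \<Rightarrow> (nat \<Rightarrow> real) measure" where
  "estimator_mechanism F n \<gamma> b X =
     distr (laplace_noise n b) (euclid n) (estimator F n \<gamma> X)"

definition max_norm :: "nat \<Rightarrow> (nat \<Rightarrow> real) \<Rightarrow> real" where
  "max_norm n v = Max ((\<lambda>i. \<bar>v i\<bar>) ` {1..n})"


subsection \<open>Edge differential privacy\<close>

definition adjacent :: "comparison_data \<Rightarrow> comparison_data \<Rightarrow> bool" where
  "adjacent X X' \<longleftrightarrow> (case (X, X') of ((G, y), (G', y')) \<Rightarrow>
     (G = G' \<and> (\<exists>!e. e \<in> G \<and> y e \<noteq> y' e)) \<or>
     ((\<exists>e e'. e \<noteq> e' \<and> e \<notin> G \<inter> G' \<and> e' \<notin> G \<inter> G' \<and>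
         G = insert e (G \<inter> G') \<and> G' = insert e' (G \<inter> G')) \<and>
      (\<forall>e\<in>G \<inter> G'. y e = y' e)))"

text \<open>A randomized algorithm with outputs in \<open>N\<close> assigns to every data set a probability measure
  on \<open>N\<close>.  This is part of the definition, so that the null measure, which \<^const>\<open>distr\<close> yields
  for a non-measurable map, does not count as private.\<close>

definition edge_diff_private ::
    "nat \<Rightarrow> 'a measure \<Rightarrow> real \<Rightarrow> real \<Rightarrow> (comparison_data \<Rightarrow> 'a measure) \<Rightarrow> bool" where
  "edge_diff_private n N \<epsilon> \<delta> M \<longleftrightarrow>
     (\<forall>X\<in>data_sets n. M X \<in> space (prob_algebra N)) \<and>
     (\<forall>X\<in>data_sets n. \<forall>X'\<in>data_sets n. adjacent X X' \<longrightarrow>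
       (\<forall>A\<in>sets N. measure (M X) A \<le> exp \<epsilon> * measure (M X') A + \<delta>))"

end

theory Submission
  imports Defs
begin

text \<open>
  Privacy: the noise that produces a given estimate is minus the gradient of the penalised
  likelihood, so adding one comparison \<open>(i, j)\<close> moves it by a bounded amount in the direction
  \<open>e\<^sub>i - e\<^sub>j\<close> only.  On each line in that direction the two estimators agree after a bi-Lipschitz
  change of the noise with constants \<open>1\<close> and \<open>1 + 2\<kappa>\<^sub>2/\<gamma>\<close>, which costs a factor \<open>e\<^sup>\<epsilon>\<^sup>/\<^sup>2\<close> together
  with the Laplace densities.  Replacing a comparison removes one and adds one.

  Error: replace the derivative of the loss by a globally strongly increasing function that agrees
  with it on \<open>[-4, 4]\<close>.  Compare the solution with the one obtained without the comparisons of a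
  vertex \<open>m\<close>, which is independent of the neighbourhood of \<open>m\<close>.  Both the error of the latter (in
  \<open>\<ell>\<^sub>1\<close>) and its distance to the full solution (in \<open>\<ell>\<^sub>\<infinity>\<close>) solve weighted Laplace equations on the
  comparison graph; as all cuts of the graph are large, the level sets of such solutions grow
  geometrically, which gives the two bounds.  Inserting them into the first order condition at the
  vertex \<open>m\<close> with the largest error closes the argument.  Once the error is at most \<open>1\<close>, all
  differences lie in \<open>[-4, 4]\<close> and the solution is the estimator.
\<close>


subsection \<open>Ridge-regularised convex minimisation\<close>

text \<open>The error bound cannot start from the curvature in (A2), which holds on
  \<open>[-4, 4]\<close> only: that the differences of the estimator stay in this range is part of
  what has to be proved.

  The graph estimates come in two strengths. For a right side of size \<open>U\<close> and expected
  degree \<open>d\<close> they give, apart from the mean, an average error of order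
  \<open>U / d\<close> but a maximal error of order \<open>U * ln n / d\<close>. The average bound
  is spent where the right side is as large as \<open>d\<close> times the target rate, the maximal
  bound where it is merely bounded, since \<open>ln n / d\<close> is within the target rate.

  A graph Laplacian does not see constants, so the mean of a solution is held by the ridge term
  alone, whose weight is small; hence the separate control of the sum of the noise.

  All probabilities of events of the data are estimated for fixed noise, because the leave-one-out
  solutions depend on it.

  The privacy budget is split into four quarters: the ratio of densities and the change of
  variables, each once for removing and once for adding a comparison.\<close>

definition ridge ::
    "((nat \<Rightarrow> real) \<Rightarrow> real) \<Rightarrow> nat set \<Rightarrow> real \<Rightarrow> (nat \<Rightarrow> real) \<Rightarrow> (nat \<Rightarrow> real) \<Rightarrow> real" where
  "ridge \<Phi> V \<gamma> w \<theta> = \<Phi> \<theta> + \<gamma> / 2 * (\<Sum>i\<in>V. (\<theta> i)\<^sup>2) + (\<Sum>i\<in>V. w i * \<theta> i)"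

definition ridge_min ::
    "((nat \<Rightarrow> real) \<Rightarrow> real) \<Rightarrow> nat set \<Rightarrow> real \<Rightarrow> (nat \<Rightarrow> real) \<Rightarrow> (nat \<Rightarrow> real)" where
  "ridge_min \<Phi> V \<gamma> w = arg_min (ridge \<Phi> V \<gamma> w) (\<lambda>\<theta>. \<theta> \<in> V \<rightarrow>\<^sub>E UNIV)"

locale convex_loss =
  fixes \<Phi> :: "(nat \<Rightarrow> real) \<Rightarrow> real" and V :: "nat set" and \<gamma> :: real
  assumes finV: "finite V" and \<gamma>: "0 < \<gamma>"
    and cont: "continuous_on UNIV \<Phi>"
    and nonneg: "\<And>\<theta>. 0 \<le> \<Phi> \<theta>"
    and conv: "\<And>\<theta> \<theta>' t. 0 \<le> t \<Longrightarrow> t \<le> 1 \<Longrightarrow>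
      \<Phi> (\<lambda>i. (1 - t) * \<theta> i + t * \<theta>' i) \<le> (1 - t) * \<Phi> \<theta> + t * \<Phi> \<theta>'"
begin

lemma ex_minimizer:
  "\<exists>\<theta>\<in>V \<rightarrow>\<^sub>E UNIV. \<forall>\<theta>'\<in>V \<rightarrow>\<^sub>E UNIV. ridge \<Phi> V \<gamma> w \<theta> \<le> ridge \<Phi> V \<gamma> w \<theta>'"
proof -
  define z :: "nat \<Rightarrow> real" where "z = (\<lambda>i\<in>V. 0)"
  define B where "B = \<Phi> z + (\<Sum>i\<in>V. (w i)\<^sup>2 / \<gamma>)"
  have B0: "0 \<le> B" unfolding B_def using \<gamma> by (intro add_nonneg_nonneg nonneg sum_nonneg) auto
  \<comment> \<open>Half of the ridge term absorbs the linear term by completing the square, at the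
    cost of the sum of \<open>(w i)\<^sup>2 / \<gamma>\<close>. Outside the box of radius
    \<open>R\<close> the other half is at least \<open>B\<close>, so the objective there is at least
    its value at \<open>z\<close>.\<close>
  define R where "R = sqrt (4 * B / \<gamma>)"
  \<comment> \<open>Coordinates outside \<open>V\<close> are pinned to \<open>undefined\<close>;
    this makes the box compact in the full function space and its members extensional.\<close>
  define K where "K = (\<Pi>\<^sub>E i\<in>UNIV. if i \<in> V then {-R..R} else {undefined :: real})"
  have "compactin (product_topology (\<lambda>i. euclidean) UNIV) K"
    unfolding K_def compactin_PiE by simp
  then have K: "compact K"
    by (simp add: euclidean_product_topology)
  have R0: "0 \<le> R" unfolding R_def using B0 \<gamma> by simp
  have zK: "z \<in> K" using R0 by (auto simp: K_def z_def PiE_def)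
  have Kiff: "\<theta> \<in> K \<longleftrightarrow> \<theta> \<in> V \<rightarrow>\<^sub>E UNIV \<and> (\<forall>i\<in>V. \<bar>\<theta> i\<bar> \<le> R)" for \<theta>
    by (auto simp: K_def PiE_def Pi_def extensional_def abs_le_iff split: if_splits)
  have "continuous_on K (ridge \<Phi> V \<gamma> w)"
    unfolding ridge_def
    by (intro continuous_intros continuous_on_subset[OF cont]
        continuous_on_subset[OF continuous_on_product_coordinates]) auto
  then obtain \<theta> where \<theta>: "\<theta> \<in> K" "\<And>\<theta>'. \<theta>' \<in> K \<Longrightarrow> ridge \<Phi> V \<gamma> w \<theta> \<le> ridge \<Phi> V \<gamma> w \<theta>'"
    using continuous_attains_inf[OF K] zK by blast
  have out: "ridge \<Phi> V \<gamma> w z \<le> ridge \<Phi> V \<gamma> w \<theta>'" if h: "\<theta>' \<in> V \<rightarrow>\<^sub>E UNIV" "\<theta>' \<notin> K" for \<theta>'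
  proof -
    obtain k where k: "k \<in> V" "R < \<bar>\<theta>' k\<bar>" using h Kiff by force
    have "4 * B / \<gamma> = R\<^sup>2" unfolding R_def using B0 \<gamma> by simp
    also have "R\<^sup>2 \<le> (\<theta>' k)\<^sup>2"
      using k(2) R0 abs_le_square_iff by fastforce
    also have "\<dots> \<le> (\<Sum>i\<in>V. (\<theta>' i)\<^sup>2)"
      using finV k by (intro member_le_sum) auto
    finally have s: "B \<le> \<gamma> / 4 * (\<Sum>i\<in>V. (\<theta>' i)\<^sup>2)" using \<gamma> by (simp add: field_simps)
    have "- ((w i)\<^sup>2 / \<gamma>) - \<gamma> / 4 * (\<theta>' i)\<^sup>2 \<le> w i * \<theta>' i" for i
    proof -
      have "0 \<le> (w i + \<gamma> / 2 * \<theta>' i)\<^sup>2 / \<gamma>" using \<gamma> by simp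
      also have "\<dots> = (w i)\<^sup>2 / \<gamma> + \<gamma> / 4 * (\<theta>' i)\<^sup>2 + w i * \<theta>' i"
        using \<gamma> by (simp add: field_simps power2_eq_square)
      finally show ?thesis by simp
    qed
    then have "(\<Sum>i\<in>V. - ((w i)\<^sup>2 / \<gamma>) - \<gamma> / 4 * (\<theta>' i)\<^sup>2) \<le> (\<Sum>i\<in>V. w i * \<theta>' i)"
      by (intro sum_mono)
    then have "- (\<Sum>i\<in>V. (w i)\<^sup>2 / \<gamma>) - \<gamma> / 4 * (\<Sum>i\<in>V. (\<theta>' i)\<^sup>2) \<le> (\<Sum>i\<in>V. w i * \<theta>' i)"
      by (simp add: sum_subtractf sum_distrib_left sum_negf)
    moreover have "\<gamma> / 2 * (\<Sum>i\<in>V. (\<theta>' i)\<^sup>2) = 2 * (\<gamma> / 4 * (\<Sum>i\<in>V. (\<theta>' i)\<^sup>2))" by simp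
    ultimately have "ridge \<Phi> V \<gamma> w \<theta>' \<ge> \<Phi> z"
      unfolding ridge_def using s nonneg[of \<theta>'] unfolding B_def by linarith
    moreover have "ridge \<Phi> V \<gamma> w z = \<Phi> z" by (simp add: ridge_def z_def)
    ultimately show ?thesis by simp
  qed
  show ?thesis
    using \<theta> out zK Kiff by (metis order_trans)
qed

lemma is_arg_min_ridge:
  "is_arg_min (ridge \<Phi> V \<gamma> w) (\<lambda>\<theta>. \<theta> \<in> V \<rightarrow>\<^sub>E UNIV) (ridge_min \<Phi> V \<gamma> w)"
proof -
  from ex_minimizer[of w] have "\<exists>\<theta>. is_arg_min (ridge \<Phi> V \<gamma> w) (\<lambda>\<theta>. \<theta> \<in> V \<rightarrow>\<^sub>E UNIV) \<theta>"
    by (auto simp: is_arg_min_linorder)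
  then show ?thesis unfolding ridge_min_def arg_min_def by (rule someI_ex)
qed

lemma ridge_min_in: "ridge_min \<Phi> V \<gamma> w \<in> V \<rightarrow>\<^sub>E UNIV"
  and ridge_min_le: "\<theta> \<in> V \<rightarrow>\<^sub>E UNIV \<Longrightarrow> ridge \<Phi> V \<gamma> w (ridge_min \<Phi> V \<gamma> w) \<le> ridge \<Phi> V \<gamma> w \<theta>"
  using is_arg_min_ridge[of w] by (auto simp: is_arg_min_linorder)

text \<open>Strong convexity at the minimiser: comparing with the point at parameter
  \<open>t\<close> on the segment towards \<open>\<theta>\<close> and dividing by \<open>t\<close>
  leaves a factor \<open>1 - t\<close>, which disappears as \<open>t\<close> tends to 0.\<close>

lemma ridge_min_strong:
  assumes "\<theta> \<in> V \<rightarrow>\<^sub>E UNIV"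
  shows "ridge \<Phi> V \<gamma> w (ridge_min \<Phi> V \<gamma> w) + \<gamma> / 2 * (\<Sum>i\<in>V. (\<theta> i - ridge_min \<Phi> V \<gamma> w i)\<^sup>2)
           \<le> ridge \<Phi> V \<gamma> w \<theta>"
proof -
  let ?m = "ridge_min \<Phi> V \<gamma> w"
  let ?D = "\<Sum>i\<in>V. (\<theta> i - ?m i)\<^sup>2"
  have "z * (\<gamma> / 2 * ?D) \<le> ridge \<Phi> V \<gamma> w \<theta> - ridge \<Phi> V \<gamma> w ?m" if z: "0 < z" "z < 1" for z
  proof -
    define t where "t = 1 - z"
    have t: "0 < t" "t < 1" using z by (auto simp: t_def)
    define \<eta> where "\<eta> = (\<lambda>i. (1 - t) * ?m i + t * \<theta> i)"
    have ext: "\<theta> i = undefined" "?m i = undefined" if "i \<notin> V" for i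
      using assms ridge_min_in[of w] that by (auto simp: PiE_def extensional_def)
    have "\<eta> \<in> V \<rightarrow>\<^sub>E UNIV"
      unfolding \<eta>_def by (auto simp: PiE_def extensional_def ext algebra_simps)
    then have "ridge \<Phi> V \<gamma> w ?m \<le> ridge \<Phi> V \<gamma> w \<eta>" by (rule ridge_min_le)
    also have "\<dots> \<le> (1 - t) * ridge \<Phi> V \<gamma> w ?m + t * ridge \<Phi> V \<gamma> w \<theta> - \<gamma> / 2 * t * (1 - t) * ?D"
    proof -
      define g where "g = \<gamma> / 2"
      have 1: "\<Phi> \<eta> \<le> (1 - t) * \<Phi> ?m + t * \<Phi> \<theta>"
        unfolding \<eta>_def using t by (intro conv) auto
      have sq: "(\<eta> i)\<^sup>2 = (1 - t) * (?m i)\<^sup>2 + t * (\<theta> i)\<^sup>2 - t * (1 - t) * (\<theta> i - ?m i)\<^sup>2" for i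
        unfolding \<eta>_def by (simp add: power2_eq_square algebra_simps)
      have 2: "(\<Sum>i\<in>V. (\<eta> i)\<^sup>2) = (1 - t) * (\<Sum>i\<in>V. (?m i)\<^sup>2) + t * (\<Sum>i\<in>V. (\<theta> i)\<^sup>2) - t * (1 - t) * ?D"
        unfolding sq by (simp add: sum.distrib sum_subtractf sum_distrib_left)
      have 3: "(\<Sum>i\<in>V. w i * \<eta> i) = (1 - t) * (\<Sum>i\<in>V. w i * ?m i) + t * (\<Sum>i\<in>V. w i * \<theta> i)"
      proof -
        have "w i * \<eta> i = (1 - t) * (w i * ?m i) + t * (w i * \<theta> i)" for i
          unfolding \<eta>_def by (simp add: algebra_simps)
        then show ?thesis by (simp add: sum.distrib sum_distrib_left)
      qed
      show ?thesis
        unfolding ridge_def 2 3 g_def[symmetric] using 1 by (simp add: algebra_simps)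
    qed
    finally have "t * (\<gamma> / 2 * (1 - t) * ?D) \<le> t * (ridge \<Phi> V \<gamma> w \<theta> - ridge \<Phi> V \<gamma> w ?m)"
      by (simp add: algebra_simps)
    then show ?thesis using t by (simp add: t_def mult_ac)
  qed
  then have "\<gamma> / 2 * ?D \<le> ridge \<Phi> V \<gamma> w \<theta> - ridge \<Phi> V \<gamma> w ?m"
    by (rule field_le_mult_one_interval)
  then show ?thesis by linarith
qed

text \<open>Adding the quadratic growth inequalities of the two minimisers cancels the loss, so the
  bound does not involve \<open>\<Phi>\<close>. It provides continuity, and through it
  measurability, of the estimator in the noise.\<close>

lemma ridge_min_lipschitz:
  "(\<Sum>i\<in>V. (ridge_min \<Phi> V \<gamma> w' i - ridge_min \<Phi> V \<gamma> w i)\<^sup>2) \<le> (\<Sum>i\<in>V. (w' i - w i)\<^sup>2) / \<gamma>\<^sup>2"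
proof -
  let ?m = "ridge_min \<Phi> V \<gamma> w" and ?m' = "ridge_min \<Phi> V \<gamma> w'"
  let ?D = "\<Sum>i\<in>V. (?m' i - ?m i)\<^sup>2"
  have D': "(\<Sum>i\<in>V. (?m i - ?m' i)\<^sup>2) = ?D"
    by (intro sum.cong refl power2_commute)
  have "\<gamma> * ?D \<le> (\<Sum>i\<in>V. w i * ?m' i) - (\<Sum>i\<in>V. w i * ?m i) + (\<Sum>i\<in>V. w' i * ?m i) - (\<Sum>i\<in>V. w' i * ?m' i)"
    using ridge_min_strong[OF ridge_min_in, of w w'] ridge_min_strong[OF ridge_min_in, of w' w]
    unfolding D' ridge_def by (simp add: algebra_simps)
  also have "\<dots> = (\<Sum>i\<in>V. (w' i - w i) * (?m i - ?m' i))"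
    by (simp add: sum_subtractf sum.distrib algebra_simps)
  also have "\<dots> \<le> (\<Sum>i\<in>V. \<gamma> / 2 * (?m' i - ?m i)\<^sup>2 + (w' i - w i)\<^sup>2 / (2 * \<gamma>))"
  proof (intro sum_mono)
    fix i
    have "0 \<le> ((w' i - w i) + \<gamma> * (?m' i - ?m i))\<^sup>2 / (2 * \<gamma>)" using \<gamma> by simp
    also have "\<dots> = \<gamma> / 2 * (?m' i - ?m i)\<^sup>2 + (w' i - w i)\<^sup>2 / (2 * \<gamma>) - (w' i - w i) * (?m i - ?m' i)"
      using \<gamma> by (simp add: field_simps power2_eq_square)
    finally show "(w' i - w i) * (?m i - ?m' i) \<le> \<gamma> / 2 * (?m' i - ?m i)\<^sup>2 + (w' i - w i)\<^sup>2 / (2 * \<gamma>)"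
      by simp
  qed
  also have "\<dots> = \<gamma> / 2 * ?D + (\<Sum>i\<in>V. (w' i - w i)\<^sup>2) / (2 * \<gamma>)"
    by (simp add: sum.distrib sum_distrib_left sum_divide_distrib)
  finally have "\<gamma> / 2 * ?D \<le> (\<Sum>i\<in>V. (w' i - w i)\<^sup>2) / (2 * \<gamma>)" by simp
  then show ?thesis using \<gamma> by (simp add: field_simps power2_eq_square)
qed

lemma continuous_ridge_min: "continuous_on UNIV (\<lambda>w. ridge_min \<Phi> V \<gamma> w i)"
proof (cases "i \<in> V")
  case False
  then show ?thesis
    using ridge_min_in by (auto simp: PiE_def extensional_def)
next
  case True
  have "((\<lambda>w'. ridge_min \<Phi> V \<gamma> w' i) \<longlongrightarrow> ridge_min \<Phi> V \<gamma> w i) (at w)" for w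
  proof -
    let ?b = "\<lambda>w'. sqrt ((\<Sum>i\<in>V. (w' i - w i)\<^sup>2) / \<gamma>\<^sup>2)"
    have "continuous_on UNIV ?b"
      using \<gamma> by (intro continuous_intros continuous_on_product_coordinates) auto
    from this[unfolded continuous_on_def, THEN bspec, OF UNIV_I]
    have "(?b \<longlongrightarrow> ?b w) (at w)" .
    then have lim: "(?b \<longlongrightarrow> 0) (at w)" by simp
    have "\<bar>ridge_min \<Phi> V \<gamma> w' i - ridge_min \<Phi> V \<gamma> w i\<bar> \<le> ?b w'" for w'
    proof -
      have "(ridge_min \<Phi> V \<gamma> w' i - ridge_min \<Phi> V \<gamma> w i)\<^sup>2
          \<le> (\<Sum>i\<in>V. (ridge_min \<Phi> V \<gamma> w' i - ridge_min \<Phi> V \<gamma> w i)\<^sup>2)"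
        using finV True by (intro member_le_sum) auto
      also have "\<dots> \<le> (\<Sum>i\<in>V. (w' i - w i)\<^sup>2) / \<gamma>\<^sup>2" by (rule ridge_min_lipschitz)
      finally show ?thesis by (rule real_le_rsqrt[of "\<bar>_\<bar>", simplified])
    qed
    then have "((\<lambda>w'. ridge_min \<Phi> V \<gamma> w' i - ridge_min \<Phi> V \<gamma> w i) \<longlongrightarrow> 0) (at w)"
      by (intro Lim_null_comparison[OF _ lim]) simp
    then show ?thesis by (simp add: LIM_zero_iff)
  qed
  then show ?thesis by (simp add: continuous_on)
qed

lemma measurable_ridge_min:
  "ridge_min \<Phi> V \<gamma> \<in> PiM V (\<lambda>_. borel) \<rightarrow>\<^sub>M PiM V (\<lambda>_. borel)"
proof (rule measurable_PiM_single')
  show "(\<lambda>w. ridge_min \<Phi> V \<gamma> w i) \<in> PiM V (\<lambda>_. borel) \<rightarrow>\<^sub>M borel" if "i \<in> V" for i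
  proof -
    have 1: "(\<lambda>w. ridge_min \<Phi> V \<gamma> w i) \<in> borel_measurable (PiM UNIV (\<lambda>_. borel))"
      using borel_measurable_continuous_onI[OF continuous_ridge_min]
      by (simp cong: measurable_cong_sets add: measurable_cong_sets[OF sets_PiM_equal_borel refl])
    \<comment> \<open>Points of the product over \<open>V\<close> equal \<open>undefined\<close> off
      \<open>V\<close>, so they embed measurably into the product over all indices. There the
      product and Borel sigma-algebras agree, and continuity gives measurability.\<close>
    have 2: "(\<lambda>w::nat\<Rightarrow>real. w) \<in> PiM V (\<lambda>_. borel) \<rightarrow>\<^sub>M PiM UNIV (\<lambda>_. borel)"
    proof (rule measurable_PiM_single')
      show "(\<lambda>w::nat\<Rightarrow>real. w j) \<in> PiM V (\<lambda>_. borel) \<rightarrow>\<^sub>M borel" for j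
      proof (cases "j \<in> V")
        case False
        then have "(\<lambda>w::nat\<Rightarrow>real. w j) \<in> PiM V (\<lambda>_. borel) \<rightarrow>\<^sub>M borel \<longleftrightarrow>
           (\<lambda>w::nat\<Rightarrow>real. undefined::real) \<in> PiM V (\<lambda>_. borel) \<rightarrow>\<^sub>M borel"
          by (intro measurable_cong) (auto simp: space_PiM PiE_def extensional_def)
        then show ?thesis by simp
      qed auto
    qed (auto simp: space_PiM)
    show ?thesis using measurable_compose[OF 2 1] .
  qed
  show "ridge_min \<Phi> V \<gamma> \<in> space (PiM V (\<lambda>_. borel)) \<rightarrow> V \<rightarrow>\<^sub>E space borel"
    using ridge_min_in by auto
qed

end

section \<open>First order conditions for sums of pairwise losses\<close>

definition score :: "(real \<Rightarrow> real) \<Rightarrow> nat set \<Rightarrow> (nat \<times> nat) set \<Rightarrow> (nat \<Rightarrow> real) \<Rightarrow> nat \<Rightarrow> real" where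
  "score \<psi> V W \<theta> k =
     (\<Sum>j\<in>V. (if (k, j) \<in> W then \<psi> (\<theta> k - \<theta> j) else 0) - (if (j, k) \<in> W then \<psi> (\<theta> j - \<theta> k) else 0))"

text \<open>Summation by parts on the comparison graph. If \<open>\<psi>\<close> is the derivative
  of the loss, the left side is the directional derivative of the pair loss along \<open>x\<close>,
  so \<open>score\<close> is its gradient.\<close>

lemma sum_pairs_as_score:
  assumes V: "finite V" and W: "W \<subseteq> V \<times> V"
  shows "(\<Sum>(i, j)\<in>W. \<psi> (\<theta> i - \<theta> j) * (x i - x j)) = (\<Sum>k\<in>V. score \<psi> V W \<theta> k * x k)"
proof -
  let ?f = "\<lambda>i j. if (i, j) \<in> W then \<psi> (\<theta> i - \<theta> j) else 0"
  have "(\<Sum>k\<in>V. score \<psi> V W \<theta> k * x k)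
      = (\<Sum>k\<in>V. \<Sum>j\<in>V. ?f k j * x k) - (\<Sum>k\<in>V. \<Sum>j\<in>V. ?f j k * x k)"
    unfolding score_def by (simp only: sum_distrib_right left_diff_distrib sum_subtractf)
  also have "(\<Sum>k\<in>V. \<Sum>j\<in>V. ?f j k * x k) = (\<Sum>k\<in>V. \<Sum>j\<in>V. ?f k j * x j)"
    by (rule sum.swap)
  also have "(\<Sum>k\<in>V. \<Sum>j\<in>V. ?f k j * x k) - (\<Sum>k\<in>V. \<Sum>j\<in>V. ?f k j * x j)
      = (\<Sum>(i, j)\<in>V \<times> V. ?f i j * (x i - x j))"
    by (simp add: sum.cartesian_product[symmetric] right_diff_distrib sum_subtractf)
  also have "\<dots> = (\<Sum>(i, j)\<in>W. \<psi> (\<theta> i - \<theta> j) * (x i - x j))"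
    using V W by (intro sum.mono_neutral_cong_right) auto
  finally show ?thesis ..
qed

definition foc ::
    "(real \<Rightarrow> real) \<Rightarrow> nat set \<Rightarrow> (nat \<times> nat) set \<Rightarrow> real \<Rightarrow> (nat \<Rightarrow> real) \<Rightarrow> (nat \<Rightarrow> real) \<Rightarrow> bool" where
  "foc \<psi> V W \<gamma> w \<theta> \<longleftrightarrow> (\<forall>k\<in>V. score \<psi> V W \<theta> k + \<gamma> * \<theta> k + w k = 0)"

text \<open>Subtract the two conditions and test with the difference of the solutions. For monotone
  \<open>\<psi>\<close> the pair sum is nonnegative, which yields uniqueness as well as the
  one-dimensional monotonicity behind the privacy bound.\<close>

lemma foc_diff:
  assumes V: "finite V" and W: "W \<subseteq> V \<times> V"
    and "foc \<psi> V W \<gamma> w \<theta>" "foc \<psi> V W \<gamma> w' \<theta>'"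
  shows "(\<Sum>(i, j)\<in>W. (\<psi> (\<theta> i - \<theta> j) - \<psi> (\<theta>' i - \<theta>' j)) * ((\<theta> i - \<theta> j) - (\<theta>' i - \<theta>' j)))
      + \<gamma> * (\<Sum>k\<in>V. (\<theta> k - \<theta>' k)\<^sup>2) = - (\<Sum>k\<in>V. (w k - w' k) * (\<theta> k - \<theta>' k))"
proof -
  have s: "score \<psi> V W \<theta> k = - \<gamma> * \<theta> k - w k" "score \<psi> V W \<theta>' k = - \<gamma> * \<theta>' k - w' k" if "k \<in> V" for k
    using assms(3,4) that by (auto simp: foc_def algebra_simps add_eq_0_iff)
  have "(\<Sum>(i, j)\<in>W. (\<psi> (\<theta> i - \<theta> j) - \<psi> (\<theta>' i - \<theta>' j)) * ((\<theta> i - \<theta> j) - (\<theta>' i - \<theta>' j)))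
      = (\<Sum>(i, j)\<in>W. \<psi> (\<theta> i - \<theta> j) * ((\<theta> i - \<theta>' i) - (\<theta> j - \<theta>' j)))
        - (\<Sum>(i, j)\<in>W. \<psi> (\<theta>' i - \<theta>' j) * ((\<theta> i - \<theta>' i) - (\<theta> j - \<theta>' j)))"
    by (simp add: sum_subtractf[symmetric] algebra_simps case_prod_beta)
  also have "\<dots> = (\<Sum>k\<in>V. score \<psi> V W \<theta> k * (\<theta> k - \<theta>' k)) - (\<Sum>k\<in>V. score \<psi> V W \<theta>' k * (\<theta> k - \<theta>' k))"
    using sum_pairs_as_score[OF V W, of \<psi> \<theta> "\<lambda>k. \<theta> k - \<theta>' k"] sum_pairs_as_score[OF V W, of \<psi> \<theta>' "\<lambda>k. \<theta> k - \<theta>' k"]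
    by simp
  also have "\<dots> = (\<Sum>k\<in>V. - \<gamma> * (\<theta> k - \<theta>' k)\<^sup>2 - (w k - w' k) * (\<theta> k - \<theta>' k))"
    unfolding sum_subtractf[symmetric] by (intro sum.cong refl) (simp add: s power2_eq_square algebra_simps)
  finally show ?thesis by (simp add: sum_subtractf sum_distrib_left sum_negf)
qed

text \<open>Identifies the estimator without minimising again: any vector shown to satisfy the
  condition, for shifted noise or by way of a modified loss, agrees with it on
  \<open>V\<close>.\<close>

lemma foc_unique:
  assumes V: "finite V" and W: "W \<subseteq> V \<times> V" and "mono \<psi>" and "0 < \<gamma>"
    and "foc \<psi> V W \<gamma> w \<theta>" "foc \<psi> V W \<gamma> w \<theta>'" and k: "k \<in> V"
  shows "\<theta> k = \<theta>' k"
proof -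
  have "0 \<le> (\<psi> x - \<psi> y) * (x - y)" for x y
    using \<open>mono \<psi>\<close> by (cases x y rule: linorder_cases) (auto simp: mono_def mult_nonpos_nonpos)
  then have "0 \<le> (\<Sum>(i, j)\<in>W. (\<psi> (\<theta> i - \<theta> j) - \<psi> (\<theta>' i - \<theta>' j)) * ((\<theta> i - \<theta> j) - (\<theta>' i - \<theta>' j)))"
    by (intro sum_nonneg) auto
  with foc_diff[OF V W assms(5,6)] have "\<gamma> * (\<Sum>k\<in>V. (\<theta> k - \<theta>' k)\<^sup>2) \<le> 0" by simp
  then have "(\<Sum>k\<in>V. (\<theta> k - \<theta>' k)\<^sup>2) \<le> 0"
    using \<open>0 < \<gamma>\<close> by (simp add: mult_le_0_iff)
  moreover have "(\<theta> k - \<theta>' k)\<^sup>2 \<le> (\<Sum>k\<in>V. (\<theta> k - \<theta>' k)\<^sup>2)"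
    using V k by (intro member_le_sum) auto
  ultimately have "(\<theta> k - \<theta>' k)\<^sup>2 \<le> 0" by (rule order_trans[rotated])
  then show ?thesis by simp
qed

definition pair_loss :: "(real \<Rightarrow> real) \<Rightarrow> (nat \<times> nat) set \<Rightarrow> (nat \<Rightarrow> real) \<Rightarrow> real" where
  "pair_loss l W \<theta> = (\<Sum>(i, j)\<in>W. l (\<theta> i - \<theta> j))"

lemma convex_loss_pair_loss:
  assumes "finite V" "0 < \<gamma>" "\<And>x. 0 \<le> l x" "\<And>x. (l has_real_derivative \<psi> x) (at x)" "mono \<psi>"
  shows "convex_loss (pair_loss l W) V \<gamma>"
proof
  have "continuous_on UNIV l"
    using assms(4) by (intro continuous_at_imp_continuous_on) (auto intro: DERIV_isCont)
  then have c: "continuous_on A f \<Longrightarrow> continuous_on A (\<lambda>x. l (f x))" for A and f :: "(nat \<Rightarrow> real) \<Rightarrow> real"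
    by (rule continuous_on_compose2) auto
  show "continuous_on UNIV (pair_loss l W)"
    unfolding pair_loss_def case_prod_beta
    by (intro continuous_on_sum c continuous_on_diff continuous_on_product_coordinates)
  show "0 \<le> pair_loss l W \<theta>" for \<theta>
    unfolding pair_loss_def using assms(3) by (intro sum_nonneg) auto
  have "convex_on UNIV l"
    using assms(4,5) by (intro convex_on_realI[where f' = \<psi>]) (auto simp: mono_def)
  then have cv: "l ((1 - t) * x + t * y) \<le> (1 - t) * l x + t * l y" if "0 \<le> t" "t \<le> 1" for t x y
    using convex_onD[of UNIV l t x y] that by simp
  fix \<theta> \<theta>' :: "nat \<Rightarrow> real" and t :: real
  assume t: "0 \<le> t" "t \<le> 1"
  have "pair_loss l W (\<lambda>i. (1 - t) * \<theta> i + t * \<theta>' i)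
      \<le> (\<Sum>(i, j)\<in>W. (1 - t) * l (\<theta> i - \<theta> j) + t * l (\<theta>' i - \<theta>' j))"
    unfolding pair_loss_def case_prod_beta
  proof (intro sum_mono)
    fix e
    show "l ((1 - t) * \<theta> (fst e) + t * \<theta>' (fst e) - ((1 - t) * \<theta> (snd e) + t * \<theta>' (snd e)))
      \<le> (1 - t) * l (\<theta> (fst e) - \<theta> (snd e)) + t * l (\<theta>' (fst e) - \<theta>' (snd e))"
      using cv[OF t, of "\<theta> (fst e) - \<theta> (snd e)" "\<theta>' (fst e) - \<theta>' (snd e)"]
      by (simp add: algebra_simps)
  qed
  also have "\<dots> = (1 - t) * pair_loss l W \<theta> + t * pair_loss l W \<theta>'"
    unfolding pair_loss_def by (simp add: sum.distrib sum_distrib_left case_prod_beta)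
  finally show "pair_loss l W (\<lambda>i. (1 - t) * \<theta> i + t * \<theta>' i) \<le> \<dots>" .
qed (use assms in auto)

lemma foc_ridge_min:
  assumes V: "finite V" and W: "W \<subseteq> V \<times> V" and \<gamma>: "0 < \<gamma>" and nn: "\<And>x. 0 \<le> l x"
    and D: "\<And>x. (l has_real_derivative \<psi> x) (at x)" and m: "mono \<psi>"
  shows "foc \<psi> V W \<gamma> w (ridge_min (pair_loss l W) V \<gamma> w)"
  unfolding foc_def
proof
  fix k assume k: "k \<in> V"
  interpret convex_loss "pair_loss l W" V \<gamma>
    using assms by (intro convex_loss_pair_loss) auto
  define m where "m = ridge_min (pair_loss l W) V \<gamma> w"
  let ?g = "\<lambda>t. ridge (pair_loss l W) V \<gamma> w (m(k := t))"
  let ?x = "\<lambda>i. if i = k then 1 else 0 :: real"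
  have c: "((\<lambda>t. (m(k := t)) i) has_real_derivative ?x i) (at t)" for i t
    by (cases "i = k") auto
  have l: "((\<lambda>t. l ((m(k := t)) i - (m(k := t)) j)) has_real_derivative
        \<psi> ((m(k := t)) i - (m(k := t)) j) * (?x i - ?x j)) (at t)" for i j t
    by (rule DERIV_chain2[OF D]) (rule DERIV_diff[OF c c])
  have "(?g has_real_derivative
      (\<Sum>(i, j)\<in>W. \<psi> ((m(k := m k)) i - (m(k := m k)) j) * (?x i - ?x j))
      + \<gamma> / 2 * (\<Sum>i\<in>V. 2 * (m(k := m k)) i * ?x i) + (\<Sum>i\<in>V. w i * ?x i)) (at (m k))"
  proof -
    have 1: "((\<lambda>t. pair_loss l W (m(k := t))) has_real_derivative
        (\<Sum>(i, j)\<in>W. \<psi> ((m(k := t)) i - (m(k := t)) j) * (?x i - ?x j))) (at t)" for t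
      unfolding pair_loss_def case_prod_beta by (rule DERIV_sum) (rule l)
    have 2: "((\<lambda>t. ((m(k := t)) i)\<^sup>2) has_real_derivative 2 * (m(k := t)) i * ?x i) (at t)" for i t
      using DERIV_power[OF c[of i t], where n = 2] by (simp add: mult_ac)
    show ?thesis
      unfolding ridge_def by (intro DERIV_add DERIV_sum DERIV_cmult 1 2 c)
  qed
  moreover have "\<gamma> / 2 * (\<Sum>i\<in>V. 2 * (m(k := m k)) i * ?x i) = \<gamma> * m k"
    using V k by (simp add: sum.delta if_distrib[of "\<lambda>x. _ * x"] cong: if_cong)
  moreover have "(\<Sum>i\<in>V. w i * ?x i) = w k"
    using V k by (simp add: sum.delta if_distrib[of "\<lambda>x. _ * x"] cong: if_cong)
  moreover have "(\<Sum>(i, j)\<in>W. \<psi> ((m(k := m k)) i - (m(k := m k)) j) * (?x i - ?x j)) = score \<psi> V W m k"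
  proof -
    have "(\<Sum>i\<in>V. score \<psi> V W m i * ?x i) = score \<psi> V W m k"
      using V k by (simp add: sum.delta if_distrib[of "\<lambda>x. _ * x"] cong: if_cong)
    then show ?thesis using sum_pairs_as_score[OF V W, of \<psi> m ?x] by simp
  qed
  ultimately have "(?g has_real_derivative score \<psi> V W m k + \<gamma> * m k + w k) (at (m k))"
    by (simp only:)
  moreover have "?g (m k) \<le> ?g t" for t
  proof -
    have "m(k := t) \<in> V \<rightarrow>\<^sub>E UNIV"
      using ridge_min_in[of w] k by (auto simp: m_def PiE_def extensional_def)
    then show ?thesis using ridge_min_le[of _ w] by (simp add: m_def)
  qed
  ultimately show "score \<psi> V W (ridge_min (pair_loss l W) V \<gamma> w) k + \<gamma> * ridge_min (pair_loss l W) V \<gamma> w k + w k = 0"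
    unfolding m_def[symmetric] by (intro DERIV_local_min[of ?g _ "m k" 1]) auto
qed

subsection \<open>Link functions and the likelihood\<close>

text \<open>A strongly increasing function has a zero by the intermediate value theorem, and an
  antiderivative attains its minimum there; subtracting the minimum gives the nonnegativity that
  \<open>convex_loss\<close> demands.\<close>

lemma ex_nonneg_antiderivative:
  fixes \<psi> :: "real \<Rightarrow> real"
  assumes \<alpha>: "0 < \<alpha>" and lo: "\<And>x y. x \<le> y \<Longrightarrow> \<alpha> * (y - x) \<le> \<psi> y - \<psi> x"
    and c: "\<And>x. isCont \<psi> x"
  shows "\<exists>l. (\<forall>x. 0 \<le> l x) \<and> (\<forall>x. (l has_real_derivative \<psi> x) (at x))"
proof -
  obtain L where L: "(L has_real_derivative \<psi> x) (at x)" for x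
    using einterval_antiderivative[of "-\<infinity>" "\<infinity>" \<psi>] c
    by (auto simp: has_real_derivative_iff_has_vector_derivative)
  define B where "B = \<bar>\<psi> 0\<bar> / \<alpha>"
  have B: "0 \<le> B" using \<alpha> by (simp add: B_def)
  have aB: "\<alpha> * B = \<bar>\<psi> 0\<bar>" using \<alpha> by (simp add: B_def)
  have "\<psi> (- B) \<le> 0" "0 \<le> \<psi> B"
    using lo[of "-B" 0] lo[of 0 B] B by (simp_all add: aB)
  then obtain z where z: "\<psi> z = 0"
    using IVT[of \<psi> "-B" 0 B] B c by auto
  have "L z \<le> L x" for x
  proof (cases "z \<le> x")
    case True
    show ?thesis
      using lo[of z] \<alpha> z L
      by (intro DERIV_nonneg_imp_nondecreasing[OF True])
         (metis diff_ge_0_iff_ge mult_nonneg_nonneg less_imp_le order_trans diff_zero)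
  next
    case False
    then have xz: "x \<le> z" by simp
    show ?thesis
    proof (rule DERIV_nonpos_imp_nonincreasing[OF xz])
      fix u assume u: "x \<le> u" "u \<le> z"
      have "0 \<le> \<alpha> * (z - u)" using \<alpha> u by simp
      then have "\<psi> u \<le> 0" using lo[OF u(2)] z by linarith
      then show "\<exists>y. (L has_real_derivative y) (at u) \<and> y \<le> 0" using L by blast
    qed
  qed
  then have "\<forall>x. 0 \<le> L x - L z" by simp
  moreover have "((\<lambda>x. L x - L z) has_real_derivative \<psi> x) (at x)" for x
    using DERIV_diff[OF L DERIV_const[of "L z"]] by simp
  ultimately show ?thesis by (intro exI[of _ "\<lambda>x. L x - L z"]) auto
qed

lemma (in convex_loss) convex_loss_add:
  assumes "convex_loss \<Phi>' V \<gamma>"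
  shows "convex_loss (\<lambda>\<theta>. \<Phi> \<theta> + \<Phi>' \<theta>) V \<gamma>"
proof -
  interpret o: convex_loss \<Phi>' V \<gamma> by fact
  show ?thesis
  proof
    show "continuous_on UNIV (\<lambda>\<theta>. \<Phi> \<theta> + \<Phi>' \<theta>)"
      by (intro continuous_on_add cont o.cont)
    show "\<Phi> (\<lambda>i. (1 - t) * \<theta> i + t * \<theta>' i) + \<Phi>' (\<lambda>i. (1 - t) * \<theta> i + t * \<theta>' i)
        \<le> (1 - t) * (\<Phi> \<theta> + \<Phi>' \<theta>) + t * (\<Phi> \<theta>' + \<Phi>' \<theta>')" if "0 \<le> t" "t \<le> 1" for \<theta> \<theta>' t
      using conv[OF that, of \<theta> \<theta>'] o.conv[OF that, of \<theta> \<theta>'] by (simp add: algebra_simps)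
  qed (auto simp: finV \<gamma> nonneg o.nonneg)
qed

locale link =
  fixes F :: "real \<Rightarrow> real" and \<kappa>1 \<kappa>2 :: real
  assumes diff2: "twice_differentiable F" and A0: "link_A0 F"
    and A1: "link_A1 \<kappa>1 F" and A2: "link_A2 \<kappa>2 F"
    and \<kappa>1: "0 < \<kappa>1" and \<kappa>2: "0 < \<kappa>2"
begin

definition loss :: "real \<Rightarrow> real" where "loss x = - ln (F x)"

definition dloss :: "real \<Rightarrow> real" where "dloss = deriv loss"

lemma strict_mono_F: "strict_mono F" and F_range: "0 \<le> F x" "F x \<le> 1"
proof -
  show "strict_mono F" using A0 unfolding link_A0_def by blast
  have "F x \<in> {0..1}" using A0 unfolding link_A0_def by blast
  then show "0 \<le> F x" "F x \<le> 1" by simp_all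
qed

lemma F_minus: "F (- x) = 1 - F x"
  using A0 unfolding link_A0_def by (metis minus_minus)

lemma F_pos: "0 < F x" and F_less_1: "F x < 1"
proof -
  have "F (x - 1) < F x" "F x < F (x + 1)"
    using strict_mono_F by (auto simp: strict_mono_def)
  then show "0 < F x" "F x < 1" using F_range[of "x - 1"] F_range[of "x + 1"] by linarith+
qed

lemma DERIV_F: "(F has_real_derivative deriv F x) (at x)"
  using diff2 by (auto simp: twice_differentiable_def DERIV_deriv_iff_real_differentiable)

lemma DERIV_dF: "(deriv F has_real_derivative deriv (deriv F) x) (at x)"
  using diff2 by (auto simp: twice_differentiable_def DERIV_deriv_iff_real_differentiable)

lemma deriv_F_nonneg: "0 \<le> deriv F x"
proof (rule ccontr)
  assume "\<not> 0 \<le> deriv F x"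
  then obtain d where "0 < d" "\<And>h. 0 < h \<Longrightarrow> h < d \<Longrightarrow> F x > F (x + h)"
    using DERIV_neg_dec_right[OF DERIV_F] by (meson not_le)
  then have "F (x + d / 2) < F x" by simp
  moreover have "F x < F (x + d / 2)"
    using \<open>0 < d\<close> by (intro strict_monoD[OF strict_mono_F]) simp
  ultimately show False by simp
qed

lemma deriv_F_minus: "deriv F (- x) = deriv F x"
proof -
  have "((\<lambda>x. F (- x)) has_real_derivative deriv F (- x) * (- 1)) (at x)"
    by (rule DERIV_chain2[OF DERIV_F]) (auto intro!: derivative_eq_intros)
  moreover have "((\<lambda>x. F (- x)) has_real_derivative - deriv F x) (at x)"
    unfolding F_minus by (auto intro!: derivative_eq_intros DERIV_F)
  ultimately have "deriv F (- x) * (- 1) = - deriv F x" by (rule DERIV_unique)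
  then show ?thesis by simp
qed

lemma loss_nonneg: "0 \<le> loss x"
  using F_pos[of x] F_less_1[of x] by (simp add: loss_def)

lemma dloss_eq: "dloss x = - deriv F x / F x"
  and DERIV_loss: "(loss has_real_derivative dloss x) (at x)"
proof -
  have 1: "(loss has_real_derivative - deriv F x / F x) (at x)" for x
    unfolding loss_def using F_pos[of x]
    by (auto intro!: derivative_eq_intros DERIV_F)
  then show e: "dloss x = - deriv F x / F x" for x
    unfolding dloss_def by (rule DERIV_imp_deriv)
  show "(loss has_real_derivative dloss x) (at x)" using 1 e by simp
qed

lemma DERIV_dloss: "(dloss has_real_derivative neg_log_deriv2 F x) (at x)"
proof -
  have "((\<lambda>x. - deriv F x / F x) has_real_derivative
      ((- deriv (deriv F) x) * F x - (- deriv F x) * deriv F x) / (F x * F x)) (at x)"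
    using F_pos[of x] by (intro DERIV_divide DERIV_minus DERIV_dF DERIV_F) auto
  then have "(dloss has_real_derivative
      ((- deriv (deriv F) x) * F x - (- deriv F x) * deriv F x) / (F x * F x)) (at x)"
    by (simp add: dloss_eq[abs_def])
  moreover have "neg_log_deriv2 F = deriv dloss"
    by (simp add: neg_log_deriv2_def dloss_def loss_def[abs_def] numeral_2_eq_2)
  ultimately show ?thesis by (metis DERIV_imp_deriv)
qed

lemma dloss_nonpos: "dloss x \<le> 0"
  using deriv_F_nonneg[of x] F_pos[of x] by (simp add: dloss_eq)

text \<open>(A1) bounds \<open>deriv F x\<close> by \<open>\<kappa>1 * (F x * (1 - F x))\<close>,
  and \<open>1 - F x\<close> is at most 1. This is the sensitivity of the gradient to a single
  comparison, and so the origin of \<open>\<kappa>1\<close> in the noise scale.\<close>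

lemma abs_dloss_le: "\<bar>dloss x\<bar> \<le> \<kappa>1"
proof -
  have "deriv F x / (F x * (1 - F x)) \<le> (SUP x. deriv F x / (F x * (1 - F x)))"
    using A1 by (intro cSUP_upper) (auto simp: link_A1_def)
  also have "\<dots> \<le> \<kappa>1" using A1 by (auto simp: link_A1_def)
  finally have "deriv F x \<le> \<kappa>1 * (F x * (1 - F x))"
    using F_pos[of x] F_less_1[of x] by (simp add: divide_le_eq)
  also have "\<dots> \<le> \<kappa>1 * (F x * 1)"
    using F_pos[of x] \<kappa>1 by (intro mult_left_mono) auto
  finally have "deriv F x / F x \<le> \<kappa>1"
    using F_pos[of x] by (simp add: divide_le_eq)
  then show ?thesis using dloss_nonpos[of x] by (simp add: dloss_eq)
qed

lemma dloss_slope: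
  assumes "x \<le> y"
  shows dloss_mono: "dloss x \<le> dloss y"
    and dloss_lipschitz: "dloss y - dloss x \<le> \<kappa>2 * (y - x)"
    and dloss_strong: "- 4 \<le> x \<Longrightarrow> y \<le> 4 \<Longrightarrow> 1 / \<kappa>2 * (y - x) \<le> dloss y - dloss x"
proof -
  have *: "dloss x \<le> dloss y \<and> dloss y - dloss x \<le> \<kappa>2 * (y - x) \<and>
     (- 4 \<le> x \<longrightarrow> y \<le> 4 \<longrightarrow> 1 / \<kappa>2 * (y - x) \<le> dloss y - dloss x)"
  proof (cases "x = y")
    case False
    then have "x < y" using assms by simp
    then obtain z where z: "x < z" "z < y" "dloss y - dloss x = (y - x) * neg_log_deriv2 F z"
      using MVT2[of x y dloss "neg_log_deriv2 F"] DERIV_dloss by blast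
    have c: "0 < neg_log_deriv2 F z" "neg_log_deriv2 F z < \<kappa>2" "\<bar>z\<bar> \<le> 4 \<Longrightarrow> 1 / \<kappa>2 < neg_log_deriv2 F z"
      using A2 by (auto simp: link_A2_def)
    have "0 \<le> (y - x) * neg_log_deriv2 F z"
      using z c by simp
    moreover have "(y - x) * neg_log_deriv2 F z \<le> (y - x) * \<kappa>2"
      using z c by (intro mult_left_mono) auto
    moreover have "(y - x) * (1 / \<kappa>2) \<le> (y - x) * neg_log_deriv2 F z" if "\<bar>z\<bar> \<le> 4"
      using z c(3)[OF that] by (intro mult_left_mono) auto
    ultimately show ?thesis using z by (simp add: mult.commute abs_le_iff)
  qed auto
  then show "dloss x \<le> dloss y" "dloss y - dloss x \<le> \<kappa>2 * (y - x)"
    "- 4 \<le> x \<Longrightarrow> y \<le> 4 \<Longrightarrow> 1 / \<kappa>2 * (y - x) \<le> dloss y - dloss x" by auto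
qed

lemma mono_dloss: "mono dloss"
  by (simp add: mono_def dloss_mono)

text \<open>Both sides equal \<open>- deriv F x\<close>, because \<open>F\<close> is symmetric. It
  expresses that each comparison contributes a centred term to the score at the true
  parameter.\<close>

lemma expected_dloss: "F x * dloss x = (1 - F x) * dloss (- x)"
  using F_pos[of x] F_pos[of "- x"] by (simp add: dloss_eq deriv_F_minus F_minus)

text \<open>Compare the two bounds of (A2) at 0. It ensures that the linear pieces of
  \<open>xdloss\<close>, of slope \<open>1 / \<kappa>2\<close>, also obey the upper slope bound
  \<open>\<kappa>2\<close>.\<close>

lemma inverse_\<kappa>2_le: "1 / \<kappa>2 \<le> \<kappa>2"
  using A2 by (auto simp: link_A2_def dest!: spec[of _ 0])

text \<open>\<^const>\<open>dloss\<close> is only known to be strongly increasing on \<open>[-4, 4]\<close>; extending it linearly makes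
  the curvature bound global without changing the first order condition near the truth.\<close>

definition xdloss :: "real \<Rightarrow> real" where
  "xdloss x = dloss (max (- 4) (min 4 x)) + 1 / \<kappa>2 * (x - max (- 4) (min 4 x))"

lemma xdloss_eq: "\<bar>x\<bar> \<le> 4 \<Longrightarrow> xdloss x = dloss x"
proof -
  assume "\<bar>x\<bar> \<le> 4"
  then have "max (- 4) (min 4 x) = x" by (simp add: abs_le_iff)
  then show ?thesis by (simp add: xdloss_def)
qed

lemma xdloss_slope:
  assumes "x \<le> y"
  shows "1 / \<kappa>2 * (y - x) \<le> xdloss y - xdloss x" "xdloss y - xdloss x \<le> \<kappa>2 * (y - x)"
proof -
  define cx cy where "cx = max (- 4) (min 4 x)" and "cy = max (- 4) (min 4 y)"
  have c: "cx \<le> cy" "cy - cx \<le> y - x" "- 4 \<le> cx" "cy \<le> 4"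
    using assms by (auto simp: cx_def cy_def)
  note d = dloss_lipschitz[OF c(1)] dloss_strong[OF c(1,3,4)]
  have e: "xdloss y - xdloss x = dloss cy - dloss cx + 1 / \<kappa>2 * ((y - x) - (cy - cx))"
    unfolding xdloss_def cx_def[symmetric] cy_def[symmetric]
    by (simp add: algebra_simps diff_divide_distrib add_divide_distrib)
  show "1 / \<kappa>2 * (y - x) \<le> xdloss y - xdloss x"
    unfolding e using d(2) by (simp add: right_diff_distrib del: times_divide_eq_left)
  have "1 / \<kappa>2 * ((y - x) - (cy - cx)) \<le> \<kappa>2 * ((y - x) - (cy - cx))"
    using c inverse_\<kappa>2_le by (intro mult_right_mono) auto
  then show "xdloss y - xdloss x \<le> \<kappa>2 * (y - x)"
    unfolding e using d(1) by (simp add: right_diff_distrib del: times_divide_eq_left)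
qed

lemma mono_xdloss: "mono xdloss"
proof (rule monoI)
  fix x y :: real assume "x \<le> y"
  then have "0 \<le> 1 / \<kappa>2 * (y - x)" using \<kappa>2 by simp
  then show "xdloss x \<le> xdloss y" using xdloss_slope(1)[OF \<open>x \<le> y\<close>] by linarith
qed

lemma isCont_xdloss: "isCont xdloss x"
proof -
  have "continuous_on UNIV dloss"
    using DERIV_dloss by (intro continuous_at_imp_continuous_on) (auto intro: DERIV_isCont)
  then have "continuous_on UNIV (\<lambda>x. dloss (max (- 4) (min 4 x)))"
    by (rule continuous_on_compose2) (auto intro!: continuous_intros)
  then have "continuous_on UNIV xdloss"
    unfolding xdloss_def by (intro continuous_intros)
  then show ?thesis by (simp add: continuous_on_eq_continuous_at)
qed

lemma ex_foc_xdloss: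
  assumes "finite V" "W \<subseteq> V \<times> V" "0 < \<gamma>"
  shows "\<exists>\<theta>. foc xdloss V W \<gamma> w \<theta>"
proof -
  obtain l where "\<And>x. 0 \<le> l x" "\<And>x. (l has_real_derivative xdloss x) (at x)"
    using ex_nonneg_antiderivative[of "1 / \<kappa>2" xdloss] xdloss_slope \<kappa>2 isCont_xdloss by auto
  from foc_ridge_min[OF assms this mono_xdloss] show ?thesis by blast
qed

lemma convex_loss_pairs:
  "finite V \<Longrightarrow> 0 < \<gamma> \<Longrightarrow> convex_loss (pair_loss loss W) V \<gamma>"
  by (rule convex_loss_pair_loss[OF _ _ loss_nonneg DERIV_loss mono_dloss])

end

text \<open>Each comparison becomes the ordered pair of its winner and its loser. By the symmetry of
  \<open>F\<close> the likelihood is then a sum of one function over these pairs, and flipping an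
  outcome replaces a pair by its reverse.\<close>

definition wins :: "comparison_data \<Rightarrow> (nat \<times> nat) set" where
  "wins X = {e\<in>fst X. snd X e} \<union> prod.swap ` {e\<in>fst X. \<not> snd X e}"

lemma estimator_eq_ridge_min: "estimator F n \<gamma> X = ridge_min (neg_log_lik F X) {1..n} \<gamma>"
  by (intro ext) (simp add: estimator_def ridge_min_def objective_def[abs_def] ridge_def[abs_def])

lemma wins_subset: "X \<in> data_sets n \<Longrightarrow> wins X \<subseteq> {1..n} \<times> {1..n}"
  by (auto simp: data_sets_def wins_def item_pairs_def)

lemma finite_item_pairs: "finite (item_pairs n)"
  by (rule finite_subset[of _ "{1..n} \<times> {1..n}"]) (auto simp: item_pairs_def)

context link
begin

lemma neg_log_lik_eq:
  assumes "finite G"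
  shows "neg_log_lik F (G, y) \<theta>
     = pair_loss loss {e\<in>G. y e} \<theta> + pair_loss loss (prod.swap ` {e\<in>G. \<not> y e}) \<theta>"
proof -
  have "pair_loss loss (prod.swap ` {e\<in>G. \<not> y e}) \<theta> = (\<Sum>(i, j)\<in>{e\<in>G. \<not> y e}. loss (\<theta> j - \<theta> i))"
    unfolding pair_loss_def by (subst sum.reindex) (auto simp: case_prod_beta inj_on_def)
  moreover have "neg_log_lik F (G, y) \<theta> = (\<Sum>e\<in>G. if y e then loss (\<theta> (fst e) - \<theta> (snd e))
      else loss (\<theta> (snd e) - \<theta> (fst e)))"
    unfolding neg_log_lik_def
    by (auto intro!: sum.cong simp: loss_def F_minus[of "_ - _", symmetric] simp del: One_nat_def)
  ultimately show ?thesis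
    using assms by (simp add: sum.If_cases pair_loss_def case_prod_beta Int_def)
qed

lemma neg_log_lik_wins:
  assumes "X \<in> data_sets n"
  shows "neg_log_lik F X = pair_loss loss (wins X)"
proof -
  obtain G y where X: "X = (G, y)" by (cases X)
  have G: "G \<subseteq> item_pairs n" using assms by (simp add: data_sets_def X)
  then have fin: "finite G" using finite_item_pairs finite_subset by blast
  have "(b, a) \<notin> G" if "(a, b) \<in> G" for a b
    using subsetD[OF G, of "(a, b)"] subsetD[OF G, of "(b, a)"] that by (auto simp: item_pairs_def)
  then have "{e\<in>G. y e} \<inter> prod.swap ` {e\<in>G. \<not> y e} = {}" by auto
  then have "pair_loss loss (wins X) \<theta> =
     pair_loss loss {e\<in>G. y e} \<theta> + pair_loss loss (prod.swap ` {e\<in>G. \<not> y e}) \<theta>" for \<theta>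
    unfolding pair_loss_def wins_def X using fin by (simp add: sum.union_disjoint)
  then show ?thesis using neg_log_lik_eq[OF fin] by (auto simp: X)
qed

text \<open>Stated for every \<open>X\<close> of the data type and not just for members of
  \<open>data_sets n\<close>, because joint measurability with the noise concerns all of them. For
  infinite \<open>G\<close> the sum is 0 by convention, as for the empty graph.\<close>

lemma convex_loss_neg_log_lik:
  assumes "0 < \<gamma>"
  shows "convex_loss (neg_log_lik F X) {1..n} \<gamma>"
proof -
  obtain G y where X: "X = (G, y)" by (cases X)
  show ?thesis
  proof (cases "finite G")
    case True
    have "neg_log_lik F X = (\<lambda>\<theta>. pair_loss loss {e\<in>G. y e} \<theta> + pair_loss loss (prod.swap ` {e\<in>G. \<not> y e}) \<theta>)"
      by (intro ext) (simp add: X neg_log_lik_eq[OF True])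
    then show ?thesis
      using assms by (auto intro!: convex_loss.convex_loss_add convex_loss_pairs)
  next
    case False
    then have "neg_log_lik F X = pair_loss loss {}"
      by (intro ext) (simp add: X neg_log_lik_def pair_loss_def)
    then show ?thesis using assms by (auto intro!: convex_loss_pairs)
  qed
qed

lemma measurable_estimator:
  "0 < \<gamma> \<Longrightarrow> estimator F n \<gamma> X \<in> euclid n \<rightarrow>\<^sub>M euclid n"
  unfolding estimator_eq_ridge_min by (intro convex_loss.measurable_ridge_min convex_loss_neg_log_lik)

lemma foc_estimator:
  assumes "0 < \<gamma>" "X \<in> data_sets n"
  shows "foc dloss {1..n} (wins X) \<gamma> w (estimator F n \<gamma> X w)"
  unfolding estimator_eq_ridge_min neg_log_lik_wins[OF assms(2)]
  by (intro foc_ridge_min[OF _ wins_subset[OF assms(2)] assms(1) loss_nonneg DERIV_loss mono_dloss]) auto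

end

subsection \<open>Weighted equations on expanding graphs\<close>

text \<open>\<open>c\<close> is a system of conductances and \<open>h\<close> an edge expansion
  constant of the unweighted graph \<open>adj\<close>; \<open>\<alpha>\<close> is the link between
  the two. In the application the conductances are secant slopes, and \<open>h\<close> and
  \<open>D\<close> are both proportional to the expected degree, so \<open>growth\<close> is an
  absolute constant.\<close>

locale expander =
  fixes V :: "nat set" and adj :: "nat \<Rightarrow> nat \<Rightarrow> bool" and c :: "nat \<Rightarrow> nat \<Rightarrow> real"
    and \<alpha> \<gamma> h D :: real
  assumes finV: "finite V" and Vne: "V \<noteq> {}"
    and adj_sym: "adj i j \<Longrightarrow> adj j i"
    and c_sym: "c i j = c j i" and c_nonneg: "0 \<le> c i j"
    and c_adj: "adj i j \<Longrightarrow> \<alpha> \<le> c i j"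
    and \<alpha>: "0 < \<alpha>" and \<gamma>: "0 \<le> \<gamma>" and h: "0 < h" and D: "0 < D"
    and deg: "i \<in> V \<Longrightarrow> real (card {j\<in>V. adj i j}) \<le> D"
    and cut: "S \<subseteq> V \<Longrightarrow> S \<noteq> {} \<Longrightarrow> 2 * card S \<le> card V \<Longrightarrow>
      h * real (card S) \<le> real (card {(i, j)\<in>S \<times> (V - S). adj i j})"
begin

definition growth :: real where "growth = h / (2 * D)"

lemma growth_pos: "0 < growth"
  using h D by (simp add: growth_def)

text \<open>Level sets of a solution grow geometrically: testing the equation with the indicator of
  \<open>{\<xi> > t}\<close> bounds the mean jump across the cut, so half of the cut edges end just below \<open>t\<close>.\<close>

lemma level_set_growth:
  assumes eq: "\<And>i. i \<in> V \<Longrightarrow> (\<Sum>j\<in>V. c i j * (\<xi> i - \<xi> j)) + \<gamma> * \<xi> i = u i"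
    and U: "\<And>i. i \<in> V \<Longrightarrow> u i \<le> U" and U0: "0 < U"
    and \<rho>: "\<rho> = 2 * U / (\<alpha> * h)" and t: "0 \<le> t" and half: "2 * card {i\<in>V. t < \<xi> i} \<le> card V"
  shows "(1 + growth) * real (card {i\<in>V. t + \<rho> < \<xi> i}) \<le> real (card {i\<in>V. t < \<xi> i})"
proof -
  define A where "A = {i\<in>V. t + \<rho> < \<xi> i}"
  define A0 where "A0 = {i\<in>V. t < \<xi> i}"
  have \<rho>0: "0 < \<rho>" unfolding \<rho> using U0 \<alpha> h by simp
  have AA: "A \<subseteq> A0" "A0 \<subseteq> V" "A \<subseteq> V" and fin: "finite A" "finite A0" "finite (V - A)"
    using finV \<rho>0 by (auto simp: A_def A0_def)
  show ?thesis
  proof (cases "A = {}")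
    case True
    then show ?thesis unfolding A_def[symmetric] by simp
  next
    case False
    define B where "B = {(i, j)\<in>A \<times> (V - A). adj i j}"
    define B1 where "B1 = {(i, j)\<in>B. \<xi> j \<le> t}"
    have finB: "finite B" 
      by (rule finite_subset[of _ "A \<times> (V - A)"]) (use fin in \<open>auto simp: B_def\<close>)
    have "2 * card A \<le> card V"
      using card_mono[OF fin(2) AA(1)] half unfolding A0_def by linarith
    then have cutA: "h * real (card A) \<le> real (card B)"
      unfolding B_def using cut AA False by blast
    \<comment> \<open>The weights are symmetric, so the terms inside \<open>A\<close> cancel and
      only the flow out of \<open>A\<close> remains.\<close>
    have inner: "(\<Sum>i\<in>A. \<Sum>j\<in>A. c i j * (\<xi> i - \<xi> j)) = 0"
    proof -
      have "(\<Sum>i\<in>A. \<Sum>j\<in>A. c i j * (\<xi> i - \<xi> j)) = (\<Sum>i\<in>A. \<Sum>j\<in>A. c i j * \<xi> i) - (\<Sum>i\<in>A. \<Sum>j\<in>A. c j i * \<xi> j)"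
        by (simp add: right_diff_distrib sum_subtractf c_sym)
      also have "(\<Sum>i\<in>A. \<Sum>j\<in>A. c j i * \<xi> j) = (\<Sum>i\<in>A. \<Sum>j\<in>A. c i j * \<xi> i)"
        by (rule sum.swap)
      finally show ?thesis by simp
    qed
    have "(\<Sum>i\<in>A. \<Sum>j\<in>V - A. c i j * (\<xi> i - \<xi> j)) = (\<Sum>i\<in>A. \<Sum>j\<in>V. c i j * (\<xi> i - \<xi> j))"
      using inner by (simp add: sum.subset_diff[OF AA(3) finV] sum.distrib)
    also have "\<dots> = (\<Sum>i\<in>A. u i - \<gamma> * \<xi> i)"
      using eq AA(3) by (intro sum.cong refl) (force simp: algebra_simps)
    also have "\<dots> \<le> (\<Sum>i\<in>A. U)"
    proof (intro sum_mono)
      fix i assume i: "i \<in> A"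
      then have "0 \<le> \<gamma> * \<xi> i" using \<gamma> t \<rho>0 by (auto simp: A_def)
      then show "u i - \<gamma> * \<xi> i \<le> U" using U[of i] i AA(3) by auto
    qed
    finally have flux: "(\<Sum>(i, j)\<in>A \<times> (V - A). c i j * (\<xi> i - \<xi> j)) \<le> U * real (card A)"
      by (simp add: sum.cartesian_product mult.commute)
    have pos: "\<xi> j \<le> \<xi> i" if "i \<in> A" "j \<in> V - A" for i j
      using that by (auto simp: A_def)
    \<comment> \<open>Along an edge of \<open>B1\<close> the solution drops by at least
      \<open>\<rho>\<close>. The choice of \<open>\<rho>\<close> turns the bound on the flow into
      the statement that \<open>B1\<close> has at most half of the \<open>h * card A\<close> edges
      guaranteed for the cut.\<close>
    have "\<alpha> * \<rho> * real (card B1) = (\<Sum>(i, j)\<in>B1. \<alpha> * \<rho>)"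
      by simp
    also have "\<dots> \<le> (\<Sum>(i, j)\<in>B1. c i j * (\<xi> i - \<xi> j))"
    proof (intro sum_mono, clarify)
      fix i j assume "(i, j) \<in> B1"
      then have "\<alpha> \<le> c i j" "\<rho> \<le> \<xi> i - \<xi> j"
        using c_adj by (auto simp: B1_def B_def A_def)
      then show "\<alpha> * \<rho> \<le> c i j * (\<xi> i - \<xi> j)"
        using \<alpha> \<rho>0 by (intro mult_mono) auto
    qed
    also have "\<dots> \<le> (\<Sum>(i, j)\<in>A \<times> (V - A). c i j * (\<xi> i - \<xi> j))"
      using fin pos c_nonneg by (intro sum_mono2) (auto simp: B1_def B_def intro!: mult_nonneg_nonneg)
    also note flux
    finally have "2 * real (card B1) \<le> h * real (card A)"
      unfolding \<rho> using U0 \<alpha> h by (simp add: field_simps)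
    moreover have "real (card B) = real (card B1) + real (card (B - B1))"
    proof -
      have "B1 \<subseteq> B" by (auto simp: B1_def)
      then show ?thesis
        using finB finite_subset[of B1 B] by (simp add: card_Diff_subset card_mono of_nat_diff)
    qed
    \<comment> \<open>The other cut edges end in \<open>A0 - A\<close>, and each vertex there takes
      at most \<open>D\<close> of them, so this layer cannot be thin.\<close>
    moreover have "real (card (B - B1)) \<le> D * real (card (A0 - A))"
    proof -
      have "B - B1 \<subseteq> (\<Union>j\<in>A0 - A. (\<lambda>i. (i, j)) ` {i\<in>V. adj j i})"
      proof (rule subrelI)
        fix i j assume ij: "(i, j) \<in> B - B1"
        then have "i \<in> V" "adj j i" "j \<in> A0 - A"
          using AA adj_sym by (auto simp: B1_def B_def A0_def)
        then show "(i, j) \<in> (\<Union>j\<in>A0 - A. (\<lambda>i. (i, j)) ` {i\<in>V. adj j i})" by blast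
      qed
      then have "card (B - B1) \<le> card (\<Union>j\<in>A0 - A. (\<lambda>i. (i, j)) ` {i\<in>V. adj j i})"
        using fin finV by (intro card_mono) auto
      also have "\<dots> \<le> (\<Sum>j\<in>A0 - A. card ((\<lambda>i. (i, j)) ` {i\<in>V. adj j i}))"
        using fin by (intro card_UN_le) auto
      also have "\<dots> = (\<Sum>j\<in>A0 - A. card {i\<in>V. adj j i})"
        by (intro sum.cong refl card_image) (auto simp: inj_on_def)
      finally have "real (card (B - B1)) \<le> (\<Sum>j\<in>A0 - A. real (card {i\<in>V. adj j i}))"
        by (simp flip: of_nat_sum)
      also have "\<dots> \<le> (\<Sum>j\<in>A0 - A. D)"
        using deg AA by (intro sum_mono) auto
      finally show ?thesis by (simp add: mult.commute)
    qed
    moreover have "real (card (A0 - A)) = real (card A0) - real (card A)"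
      using AA fin by (simp add: card_Diff_subset card_mono of_nat_diff)
    ultimately have "h * real (card A) \<le> 2 * D * (real (card A0) - real (card A))"
      using cutA by simp
    then have "growth * real (card A) \<le> real (card A0) - real (card A)"
      unfolding growth_def using D by (simp add: field_simps)
    then show ?thesis unfolding A_def A0_def by (simp add: algebra_simps)
  qed
qed

text \<open>Climb from \<open>t\<close> in steps of \<open>\<rho>\<close>. The level sets shrink
  geometrically, so summing the layers costs the constant \<open>1 + 1 / growth\<close>, while the
  number of layers, which bounds the maximum, costs a logarithm.\<close>

lemma upper_tail:
  assumes eq: "\<And>i. i \<in> V \<Longrightarrow> (\<Sum>j\<in>V. c i j * (\<xi> i - \<xi> j)) + \<gamma> * \<xi> i = u i"
    and U: "\<And>i. i \<in> V \<Longrightarrow> u i \<le> U" and U0: "0 < U"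
    and \<rho>: "\<rho> = 2 * U / (\<alpha> * h)" and t: "0 \<le> t" and half: "2 * card {i\<in>V. t < \<xi> i} \<le> card V"
  shows "(\<Sum>i\<in>{i\<in>V. t < \<xi> i}. \<xi> i - t) \<le> \<rho> * (1 + 1 / growth) * real (card {i\<in>V. t < \<xi> i}) \<and>
     (\<forall>i\<in>V. t < \<xi> i \<longrightarrow> \<xi> i \<le> t + \<rho> * (1 + ln (real (card {i\<in>V. t < \<xi> i})) / ln (1 + growth)))"
  using t half
proof (induction "card {i\<in>V. t < \<xi> i}" arbitrary: t rule: less_induct)
  case less
  define A where "A = {i\<in>V. t + \<rho> < \<xi> i}"
  define A0 where "A0 = {i\<in>V. t < \<xi> i}"
  have \<rho>0: "0 < \<rho>" unfolding \<rho> using U0 \<alpha> h by simp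
  have AA: "A \<subseteq> A0" "A0 \<subseteq> V" "A \<subseteq> V" and fin: "finite A" "finite A0"
    using finV \<rho>0 by (auto simp: A_def A0_def)
  have g: "(1 + growth) * real (card A) \<le> real (card A0)"
    using level_set_growth[OF eq U U0 \<rho> less.prems] unfolding A_def A0_def by simp
  have lg: "0 < ln (1 + growth)" using growth_pos by simp
  show ?case
  proof (cases "A0 = {}")
    case True
    then have "\<not> t < \<xi> i" if "i \<in> V" for i using that by (auto simp: A0_def)
    then show ?thesis unfolding A0_def[symmetric] True by simp
  next
    case False
    have c0: "0 < card A0" using False fin by (simp add: card_gt_0_iff)
    have lt: "card A < card A0"
    proof (cases "card A = 0")
      case False
      then have "0 < growth * real (card A)" using growth_pos by simp
      then have "real (card A) < real (card A0)" using g by (simp add: algebra_simps)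
      then show ?thesis by simp
    qed (use c0 in simp)
    have IH: "(\<Sum>i\<in>A. \<xi> i - (t + \<rho>)) \<le> \<rho> * (1 + 1 / growth) * real (card A)"
      "\<And>i. i \<in> A \<Longrightarrow> \<xi> i \<le> t + \<rho> + \<rho> * (1 + ln (real (card A)) / ln (1 + growth))"
      using less.hyps[of "t + \<rho>"] lt less.prems \<rho>0 unfolding A_def A0_def by auto
    have "(\<Sum>i\<in>A0. \<xi> i - t) = (\<Sum>i\<in>A0 - A. \<xi> i - t) + (\<Sum>i\<in>A. \<xi> i - t)"
      by (rule sum.subset_diff[OF AA(1) fin(2)])
    also have "(\<Sum>i\<in>A0 - A. \<xi> i - t) \<le> (\<Sum>i\<in>A0 - A. \<rho>)"
      by (intro sum_mono) (auto simp: A_def A0_def)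
    also have "(\<Sum>i\<in>A0 - A. \<rho>) + (\<Sum>i\<in>A. \<xi> i - t) = \<rho> * real (card A0) + (\<Sum>i\<in>A. \<xi> i - (t + \<rho>))"
      using AA fin by (simp add: card_Diff_subset card_mono of_nat_diff sum_subtractf sum.distrib algebra_simps)
    also have "\<dots> \<le> \<rho> * real (card A0) + \<rho> * (1 + 1 / growth) * real (card A)"
      using IH(1) by simp
    \<comment> \<open>The constant reproduces itself: in units of \<open>\<rho>\<close> the bottom
      layer contributes \<open>card A0\<close>, and all layers above it at most
      \<open>card A0 / growth\<close> by the growth bound.\<close>
    also have "(1 + 1 / growth) * real (card A) = (1 + growth) * real (card A) / growth"
      using growth_pos by (simp add: field_simps)
    then have "\<rho> * (1 + 1 / growth) * real (card A) = \<rho> * ((1 + growth) * real (card A) / growth)"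
      by (simp only: mult.assoc)
    also have "\<dots> \<le> \<rho> * (real (card A0) / growth)"
      using g growth_pos \<rho>0 by (intro mult_left_mono divide_right_mono) auto
    finally have 1: "(\<Sum>i\<in>A0. \<xi> i - t) \<le> \<rho> * (1 + 1 / growth) * real (card A0)"
      by (simp add: algebra_simps)
    have "\<xi> i \<le> t + \<rho> * (1 + ln (real (card A0)) / ln (1 + growth))" if i: "i \<in> A0" for i
    proof (cases "i \<in> A")
      case False
      have "0 \<le> \<rho> * (ln (real (card A0)) / ln (1 + growth))"
        using \<rho>0 lg c0 growth_pos by (intro mult_nonneg_nonneg divide_nonneg_nonneg ln_ge_zero) auto
      then show ?thesis using False i by (auto simp: A_def A0_def algebra_simps)
    next
      case True
      then have cA: "0 < card A" using fin by (auto simp: card_gt_0_iff)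
      have "ln (1 + growth) + ln (real (card A)) = ln ((1 + growth) * real (card A))"
        using growth_pos cA by (simp add: ln_mult)
      also have "\<dots> \<le> ln (real (card A0))"
        using g growth_pos cA c0 by (subst ln_le_cancel_iff) auto
      finally have "(ln (1 + growth) + ln (real (card A))) / ln (1 + growth) \<le> ln (real (card A0)) / ln (1 + growth)"
        using lg by (intro divide_right_mono) auto
      then have "1 + ln (real (card A)) / ln (1 + growth) \<le> ln (real (card A0)) / ln (1 + growth)"
        using lg by (simp add: add_divide_distrib)
      then have "\<rho> * (1 + ln (real (card A)) / ln (1 + growth)) \<le> \<rho> * (ln (real (card A0)) / ln (1 + growth))"
        using \<rho>0 by (intro mult_left_mono) auto
      then show ?thesis using IH(2)[OF True] by (simp add: algebra_simps)
    qed
    then show ?thesis using 1 unfolding A0_def by auto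
  qed
qed

text \<open>\<open>upper_tail\<close> requires a level set with at most half of the vertices. The
  positive side qualifies by assumption and, the mean being zero, it controls the whole l1 norm.
  Markov's inequality then shows that \<open>- \<xi>\<close> exceeds twice the average bound on at
  most half of the vertices, and from that level on \<open>upper_tail\<close> handles the negative
  side.\<close>

lemma two_sided_aux:
  assumes eq: "\<And>i. i \<in> V \<Longrightarrow> (\<Sum>j\<in>V. c i j * (\<xi> i - \<xi> j)) + \<gamma> * \<xi> i = u i"
    and U: "\<And>i. i \<in> V \<Longrightarrow> \<bar>u i\<bar> \<le> U" and U0: "0 < U"
    and \<rho>: "\<rho> = 2 * U / (\<alpha> * h)" and mean: "(\<Sum>i\<in>V. \<xi> i) = 0"
    and half: "2 * card {i\<in>V. 0 < \<xi> i} \<le> card V"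
  shows "(\<Sum>i\<in>V. \<bar>\<xi> i\<bar>) \<le> \<rho> * (1 + 1 / growth) * real (card V) \<and>
     (\<forall>i\<in>V. \<bar>\<xi> i\<bar> \<le> \<rho> * (2 * (1 + 1 / growth) + 1 + ln (real (card V)) / ln (1 + growth)))"
proof -
  have \<rho>0: "0 < \<rho>" unfolding \<rho> using U0 \<alpha> h by simp
  have lg: "0 < ln (1 + growth)" using growth_pos by simp
  have N: "0 < card V" using finV Vne by (simp add: card_gt_0_iff)
  define g where "g = 1 + 1 / growth"
  have g0: "0 < g" using growth_pos by (simp add: g_def add_pos_pos)
  have lnmono: "ln (real (card {i\<in>V. P i})) / ln (1 + growth) \<le> ln (real (card V)) / ln (1 + growth)"
    if "i \<in> V" "P i" for P i
  proof -
    have "0 < card {i\<in>V. P i}" "card {i\<in>V. P i} \<le> card V"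
      using that finV by (auto simp: card_gt_0_iff intro!: card_mono)
    then show ?thesis using lg by (intro divide_right_mono) auto
  qed
  note up = upper_tail[OF eq _ U0 \<rho> order_refl half, folded g_def]
  have up': "(\<Sum>i\<in>{i\<in>V. 0 < \<xi> i}. \<xi> i) \<le> \<rho> * g * real (card {i\<in>V. 0 < \<xi> i})"
     "\<And>i. i \<in> V \<Longrightarrow> 0 < \<xi> i \<Longrightarrow> \<xi> i \<le> \<rho> * (1 + ln (real (card {i\<in>V. 0 < \<xi> i})) / ln (1 + growth))"
    using up U by (auto simp: abs_le_iff)
  have "(\<Sum>i\<in>V. \<bar>\<xi> i\<bar>) = (\<Sum>i\<in>V. 2 * (if 0 < \<xi> i then \<xi> i else 0) - \<xi> i)"
    by (intro sum.cong) auto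
  also have "\<dots> = 2 * (\<Sum>i\<in>{i\<in>V. 0 < \<xi> i}. \<xi> i)"
    using finV mean by (simp add: sum_subtractf sum.If_cases sum_distrib_left[symmetric] Int_def)
  also have "\<dots> \<le> 2 * (\<rho> * g * real (card {i\<in>V. 0 < \<xi> i}))" using up'(1) by simp
  also have "\<dots> = \<rho> * g * real (2 * card {i\<in>V. 0 < \<xi> i})" by simp
  also have "\<dots> \<le> \<rho> * g * real (card V)"
    using half \<rho>0 g0 by (intro mult_left_mono) (auto simp del: of_nat_mult)
  finally have l1: "(\<Sum>i\<in>V. \<bar>\<xi> i\<bar>) \<le> \<rho> * g * real (card V)" .
  define t where "t = 2 * (\<rho> * g)"
  have t0: "0 < t" using \<rho>0 g0 by (simp add: t_def)
  have "t * real (card {i\<in>V. t < - \<xi> i}) = (\<Sum>i\<in>{i\<in>V. t < - \<xi> i}. t)" by simp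
  also have "\<dots> \<le> (\<Sum>i\<in>{i\<in>V. t < - \<xi> i}. \<bar>\<xi> i\<bar>)"
    by (intro sum_mono) auto
  also have "\<dots> \<le> (\<Sum>i\<in>V. \<bar>\<xi> i\<bar>)"
    using finV by (intro sum_mono2) auto
  also note l1
  finally have "(\<rho> * g) * real (2 * card {i\<in>V. t < - \<xi> i}) \<le> (\<rho> * g) * real (card V)"
    by (simp add: t_def mult_ac)
  then have "real (2 * card {i\<in>V. t < - \<xi> i}) \<le> real (card V)"
    using \<rho>0 g0 by (subst (asm) mult_le_cancel_left_pos) auto
  then have half': "2 * card {i\<in>V. t < - \<xi> i} \<le> card V"
    by (simp only: of_nat_le_iff)
  have eq': "(\<Sum>j\<in>V. c i j * (- \<xi> i - - \<xi> j)) + \<gamma> * - \<xi> i = - u i" if "i \<in> V" for i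
    using eq[OF that] by (simp add: algebra_simps sum_subtractf)
  have lo: "- \<xi> i \<le> t + \<rho> * (1 + ln (real (card {i\<in>V. t < - \<xi> i})) / ln (1 + growth))"
    if "i \<in> V" "t < - \<xi> i" for i
    using upper_tail[of "\<lambda>i. - \<xi> i" "\<lambda>i. - u i" U \<rho> t, OF eq' _ U0 \<rho> _ half'] U t0 that
    by (auto simp: abs_le_iff)
  define l where "l = ln (real (card V)) / ln (1 + growth)"
  have l0: "0 \<le> l" using lg N by (auto simp: l_def)
  have "\<bar>\<xi> i\<bar> \<le> t + \<rho> * (1 + l)" if i: "i \<in> V" for i
  proof -
    have p: "0 \<le> \<rho> * (1 + l)" using \<rho>0 l0 by simp
    have "\<xi> i \<le> \<rho> * (1 + l)"
    proof (cases "0 < \<xi> i")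
      case True
      have "\<rho> * (1 + ln (real (card {i\<in>V. 0 < \<xi> i})) / ln (1 + growth)) \<le> \<rho> * (1 + l)"
        using lnmono[of i "\<lambda>i. 0 < \<xi> i"] i True \<rho>0 by (simp add: l_def)
      then show ?thesis using up'(2)[OF i True] by linarith
    qed (use p in linarith)
    moreover have "- \<xi> i \<le> t + \<rho> * (1 + l)"
    proof (cases "t < - \<xi> i")
      case True
      have "\<rho> * (1 + ln (real (card {i\<in>V. t < - \<xi> i})) / ln (1 + growth)) \<le> \<rho> * (1 + l)"
        using lnmono[of i "\<lambda>i. t < - \<xi> i"] i True \<rho>0 by (simp add: l_def)
      then show ?thesis using lo[OF i True] by linarith
    qed (use p in linarith)
    ultimately show ?thesis using t0 by linarith
  qed
  then have "\<forall>i\<in>V. \<bar>\<xi> i\<bar> \<le> \<rho> * (2 * g + 1 + l)"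
    by (simp add: t_def algebra_simps)
  then show ?thesis using l1 by (simp add: g_def l_def)
qed

proposition two_sided:
  assumes eq: "\<And>i. i \<in> V \<Longrightarrow> (\<Sum>j\<in>V. c i j * (\<xi> i - \<xi> j)) + \<gamma> * \<xi> i = u i"
    and U: "\<And>i. i \<in> V \<Longrightarrow> \<bar>u i\<bar> \<le> U" and U0: "0 < U"
    and mean: "(\<Sum>i\<in>V. \<xi> i) = 0"
  shows "(\<Sum>i\<in>V. \<bar>\<xi> i\<bar>) \<le> 2 * U / (\<alpha> * h) * (1 + 1 / growth) * real (card V)"
    and "i \<in> V \<Longrightarrow> \<bar>\<xi> i\<bar> \<le> 2 * U / (\<alpha> * h) *
      (2 * (1 + 1 / growth) + 1 + ln (real (card V)) / ln (1 + growth))"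
proof -
  have eq': "(\<Sum>j\<in>V. c i j * (- \<xi> i - - \<xi> j)) + \<gamma> * - \<xi> i = - u i" if "i \<in> V" for i
    using eq[OF that] by (simp add: algebra_simps sum_subtractf)
  have "card {i\<in>V. 0 < \<xi> i} + card {i\<in>V. 0 < - \<xi> i} = card ({i\<in>V. 0 < \<xi> i} \<union> {i\<in>V. 0 < - \<xi> i})"
    using finV by (intro card_Un_disjoint[symmetric]) auto
  also have "\<dots> \<le> card V" using finV by (intro card_mono) auto
  finally consider "2 * card {i\<in>V. 0 < \<xi> i} \<le> card V" | "2 * card {i\<in>V. 0 < - \<xi> i} \<le> card V"
    by linarith
  then have "(\<Sum>i\<in>V. \<bar>\<xi> i\<bar>) \<le> 2 * U / (\<alpha> * h) * (1 + 1 / growth) * real (card V) \<and>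
     (\<forall>i\<in>V. \<bar>\<xi> i\<bar> \<le> 2 * U / (\<alpha> * h) * (2 * (1 + 1 / growth) + 1 + ln (real (card V)) / ln (1 + growth)))"
  proof cases
    case 1
    then show ?thesis using two_sided_aux[OF eq U U0 refl mean] by blast
  next
    case 2
    then show ?thesis
      using two_sided_aux[of "\<lambda>i. - \<xi> i" "\<lambda>i. - u i", OF eq' _ U0 refl] U mean
      by (auto simp: sum_negf)
  qed
  then show "(\<Sum>i\<in>V. \<bar>\<xi> i\<bar>) \<le> 2 * U / (\<alpha> * h) * (1 + 1 / growth) * real (card V)"
    "i \<in> V \<Longrightarrow> \<bar>\<xi> i\<bar> \<le> 2 * U / (\<alpha> * h) *
      (2 * (1 + 1 / growth) + 1 + ln (real (card V)) / ln (1 + growth))" by blast+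
qed

end

subsection \<open>The leave-one-out argument\<close>

lemma sum_score_eq_0: "(\<Sum>i\<in>U. score \<psi> U W \<theta> i) = 0"
proof -
  have "(\<Sum>i\<in>U. score \<psi> U W \<theta> i)
    = (\<Sum>i\<in>U. \<Sum>j\<in>U. if (i, j) \<in> W then \<psi> (\<theta> i - \<theta> j) else 0)
      - (\<Sum>i\<in>U. \<Sum>j\<in>U. if (j, i) \<in> W then \<psi> (\<theta> j - \<theta> i) else 0)"
    by (simp add: score_def sum_subtractf)
  also have "(\<Sum>i\<in>U. \<Sum>j\<in>U. if (j, i) \<in> W then \<psi> (\<theta> j - \<theta> i) else 0)
      = (\<Sum>i\<in>U. \<Sum>j\<in>U. if (i, j) \<in> W then \<psi> (\<theta> i - \<theta> j) else 0)"
    by (rule sum.swap)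
  finally show ?thesis by simp
qed

lemma score_remove:
  assumes "finite V" "m \<in> V"
  shows "score \<psi> V W \<theta> i = score \<psi> (V - {m}) W \<theta> i +
    ((if (i, m) \<in> W then \<psi> (\<theta> i - \<theta> m) else 0) - (if (m, i) \<in> W then \<psi> (\<theta> m - \<theta> i) else 0))"
  unfolding score_def by (subst sum.remove[OF assms]) simp

definition linked :: "(nat \<times> nat) set \<Rightarrow> nat \<Rightarrow> nat \<Rightarrow> bool" where
  "linked W i j \<longleftrightarrow> (i, j) \<in> W \<or> (j, i) \<in> W"

text \<open>The deterministic core; the data enter through inequalities that are later shown to hold
  with high probability. In the application \<open>d\<close> is \<open>n * p\<close>,
  \<open>L\<close> is \<open>ln n\<close>, \<open>r\<close> the target rate and \<open>c1\<close>
  the density constant; \<open>B1\<close> measures the gradient at the truth and \<open>B2\<close>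
  what feeds the mean. The last assumption is the trace of independence: over the neighbours of
  \<open>m\<close> the leave-one-out errors behave like a random sample of all errors.\<close>

locale leave_one_out =
  fixes \<psi> :: "real \<Rightarrow> real" and \<alpha> \<beta> \<kappa> :: real and n :: nat and W :: "(nat \<times> nat) set" and \<gamma> :: real
    and w \<theta>0 :: "nat \<Rightarrow> real" and d L r B1 B2 c1 :: real
  assumes \<alpha>: "0 < \<alpha>"
    and slope_ge: "\<And>x y. x \<le> y \<Longrightarrow> \<alpha> * (y - x) \<le> \<psi> y - \<psi> x"
    and slope_le: "\<And>x y. x \<le> y \<Longrightarrow> \<psi> y - \<psi> x \<le> \<beta> * (y - x)"
    and \<kappa>: "\<And>i j. i \<in> {1..n} \<Longrightarrow> j \<in> {1..n} \<Longrightarrow> \<bar>\<psi> (\<theta>0 i - \<theta>0 j)\<bar> \<le> \<kappa>" "0 < \<kappa>"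
    and n: "3 \<le> n" and \<gamma>: "0 < \<gamma>" and d: "0 < d" "d \<le> real n" and r: "0 < r" "0 < B1" "0 < B2"
    and score0: "\<And>i. i \<in> {1..n} \<Longrightarrow> \<bar>score \<psi> {1..n} W \<theta>0 i\<bar> \<le> B1 * (d * r)"
    and ridge0: "\<And>i. i \<in> {1..n} \<Longrightarrow> \<bar>\<gamma> * \<theta>0 i\<bar> \<le> B1 * (d * r)"
    and noise0: "\<And>i. i \<in> {1..n} \<Longrightarrow> \<bar>w i\<bar> \<le> B1 * (d * r)"
    and bdd: "\<And>i. i \<in> {1..n} \<Longrightarrow> \<bar>\<theta>0 i\<bar> \<le> 1" and sum0: "(\<Sum>i\<in>{1..n}. \<theta>0 i) = 0"
    and noise_sum: "\<bar>\<Sum>i\<in>{1..n}. w i\<bar> \<le> \<gamma> * ((real n - 1) * (B2 * r))"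
    and noise1: "\<And>i. i \<in> {1..n} \<Longrightarrow> \<bar>w i\<bar> \<le> \<gamma> * ((real n - 1) * (B2 * r))"
    and n_rate: "1 \<le> (real n - 1) * (B2 * r)"
    and deg: "\<And>i. i \<in> {1..n} \<Longrightarrow> real (card {j\<in>{1..n}. linked W i j}) \<le> 3 * d"
    and cut: "\<And>m S. m \<in> {1..n} \<Longrightarrow> S \<subseteq> {1..n} - {m} \<Longrightarrow> S \<noteq> {} \<Longrightarrow> 2 * card S \<le> n - 1 \<Longrightarrow>
        d / 16 * real (card S) \<le> real (card {(i, j)\<in>S \<times> ({1..n} - {m} - S). linked W i j})"
    and L: "1 \<le> L" "ln (real n) \<le> L" "L \<le> d * r" "c1 * L \<le> d" "1 \<le> d * r" and c1: "1 \<le> c1"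
    and loo: "\<And>m. m \<in> {1..n} \<Longrightarrow> \<exists>\<theta>'. foc \<psi> ({1..n} - {m}) W \<gamma> w \<theta>' \<and>
        (\<forall>X. (\<forall>j\<in>{1..n} - {m}. \<bar>\<theta>' j - \<theta>0 j\<bar> \<le> X) \<longrightarrow>
          (\<Sum>j\<in>{j\<in>{1..n} - {m}. linked W m j}. \<bar>\<theta>' j - \<theta>0 j\<bar>)
            \<le> 2 * (d / real n) * (\<Sum>j\<in>{1..n} - {m}. \<bar>\<theta>' j - \<theta>0 j\<bar>) + 7 * L * X)"
begin

text \<open>Difference quotients turn differences of scores into exactly linear expressions without
  derivatives; \<open>xdloss\<close> can have kinks at \<open>4\<close> and \<open>- 4\<close>. The
  value on the diagonal merely has to respect the slope bounds.\<close>

definition secant :: "real \<Rightarrow> real \<Rightarrow> real" where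
  "secant x y = (if x = y then \<alpha> else (\<psi> x - \<psi> y) / (x - y))"

lemma secant: "\<psi> x - \<psi> y = secant x y * (x - y)" "\<alpha> \<le> secant x y" "secant x y \<le> \<beta>"
proof -
  have "\<alpha> \<le> \<beta>" using slope_ge[of 0 1] slope_le[of 0 1] by simp
  then show "\<psi> x - \<psi> y = secant x y * (x - y)" "\<alpha> \<le> secant x y" "secant x y \<le> \<beta>"
    using slope_ge[of x y] slope_le[of x y] slope_ge[of y x] slope_le[of y x]
    by (cases x y rule: linorder_cases; simp add: secant_def field_simps)+
qed

lemma \<beta>: "0 < \<beta>" using secant(2,3)[of 0 0] \<alpha> by linarith

lemma \<psi>_lipschitz: "\<bar>\<psi> x - \<psi> y\<bar> \<le> \<beta> * \<bar>x - y\<bar>"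
proof -
  have "\<bar>secant x y\<bar> \<le> \<beta>" using secant(2,3)[of x y] \<alpha> by linarith
  then show ?thesis unfolding secant(1) abs_mult by (intro mult_right_mono) auto
qed

definition coef :: "(nat \<Rightarrow> real) \<Rightarrow> (nat \<Rightarrow> real) \<Rightarrow> nat \<Rightarrow> nat \<Rightarrow> real" where
  "coef \<theta> \<theta>' i j = (if (i, j) \<in> W then secant (\<theta> i - \<theta> j) (\<theta>' i - \<theta>' j) else 0)
     + (if (j, i) \<in> W then secant (\<theta> j - \<theta> i) (\<theta>' j - \<theta>' i) else 0)"

lemma coef_bounds:
  shows coef_nonneg: "0 \<le> coef \<theta> \<theta>' i j"
    and coef_le: "coef \<theta> \<theta>' i j \<le> (if linked W i j then 2 * \<beta> else 0)"
    and coef_ge: "linked W i j \<Longrightarrow> \<alpha> \<le> coef \<theta> \<theta>' i j"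
proof -
  note s = secant(2,3)[of "\<theta> i - \<theta> j" "\<theta>' i - \<theta>' j"] secant(2,3)[of "\<theta> j - \<theta> i" "\<theta>' j - \<theta>' i"]
  show "0 \<le> coef \<theta> \<theta>' i j" "coef \<theta> \<theta>' i j \<le> (if linked W i j then 2 * \<beta> else 0)"
    "linked W i j \<Longrightarrow> \<alpha> \<le> coef \<theta> \<theta>' i j"
    using s \<alpha> unfolding coef_def linked_def by auto
qed

lemma coef_sym: "coef \<theta> \<theta>' i j = coef \<theta> \<theta>' j i"
  by (simp add: coef_def)

text \<open>Makes nonlinear first order conditions accessible to \<open>expander\<close>:
  subtracting two of them leaves a weighted graph Laplacian applied to
  \<open>\<theta> - \<theta>'\<close>.\<close>

lemma score_diff:
  "score \<psi> U W \<theta> i - score \<psi> U W \<theta>' i = (\<Sum>j\<in>U. coef \<theta> \<theta>' i j * ((\<theta> i - \<theta>' i) - (\<theta> j - \<theta>' j)))"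
  unfolding score_def sum_subtractf[symmetric]
proof (intro sum.cong refl)
  fix j
  have "\<psi> (\<theta> i - \<theta> j) = \<psi> (\<theta>' i - \<theta>' j) + secant (\<theta> i - \<theta> j) (\<theta>' i - \<theta>' j) * ((\<theta> i - \<theta> j) - (\<theta>' i - \<theta>' j))"
    "\<psi> (\<theta> j - \<theta> i) = \<psi> (\<theta>' j - \<theta>' i) + secant (\<theta> j - \<theta> i) (\<theta>' j - \<theta>' i) * ((\<theta> j - \<theta> i) - (\<theta>' j - \<theta>' i))"
    using secant(1)[of "\<theta> i - \<theta> j" "\<theta>' i - \<theta>' j"] secant(1)[of "\<theta> j - \<theta> i" "\<theta>' j - \<theta>' i"]
    by linarith+
  then show "(if (i, j) \<in> W then \<psi> (\<theta> i - \<theta> j) else 0) - (if (j, i) \<in> W then \<psi> (\<theta> j - \<theta> i) else 0)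
    - ((if (i, j) \<in> W then \<psi> (\<theta>' i - \<theta>' j) else 0) - (if (j, i) \<in> W then \<psi> (\<theta>' j - \<theta>' i) else 0))
    = coef \<theta> \<theta>' i j * ((\<theta> i - \<theta>' i) - (\<theta> j - \<theta>' j))"
    by (cases "(i, j) \<in> W"; cases "(j, i) \<in> W"; simp add: coef_def; simp add: algebra_simps)
qed

lemma expander_remove:
  assumes "m \<in> {1..n}"
  shows "expander ({1..n} - {m}) (linked W) (coef \<theta> \<theta>') \<alpha> \<gamma> (d / 16) (3 * d)"
proof
  have card: "card ({1..n} - {m}) = n - 1" using assms by simp
  show "{1..n} - {m} \<noteq> {}" using n card by (metis card.empty diff_is_0_eq not_less_eq_eq numeral_3_eq_3 One_nat_def Suc_leD)
  show "real (card {j \<in> {1..n} - {m}. linked W i j}) \<le> 3 * d" if "i \<in> {1..n} - {m}" for i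
  proof -
    have "card {j \<in> {1..n} - {m}. linked W i j} \<le> card {j \<in> {1..n}. linked W i j}"
      by (intro card_mono) auto
    then show ?thesis using deg[of i] that by auto
  qed
  show "d / 16 * real (card S) \<le> real (card {(i, j)\<in>S \<times> ({1..n} - {m} - S). linked W i j})"
    if "S \<subseteq> {1..n} - {m}" "S \<noteq> {}" "2 * card S \<le> card ({1..n} - {m})" for S
    using cut[OF assms that(1,2)] that(3) card by simp
qed (use \<alpha> \<gamma> d coef_bounds coef_sym in \<open>auto simp: linked_def\<close>)

text \<open>Summing the equation over all vertices removes the Laplacian, so the mean
  \<open>\<mu>\<close> is determined by the ridge term and is split off before
  \<open>two_sided\<close> applies. This changes the right side by at most \<open>U\<close>, hence
  the \<open>2 * U\<close>. With \<open>growth = 1 / 96\<close> the constants are 6208 = 64 * 97 and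
  18688 = 64 * 292, where 292 = 2 * 97 + 1 + 97.\<close>

lemma expander_bounds:
  assumes m: "m \<in> {1..n}"
    and eq: "\<And>i. i \<in> {1..n} - {m} \<Longrightarrow>
      (\<Sum>j\<in>{1..n} - {m}. coef \<theta> \<theta>' i j * (\<eta> i - \<eta> j)) + \<gamma> * \<eta> i = v i"
    and v: "\<And>i. i \<in> {1..n} - {m} \<Longrightarrow> \<bar>v i\<bar> \<le> U" and U: "0 < U"
  defines "\<mu> \<equiv> (\<Sum>i\<in>{1..n} - {m}. v i) / (\<gamma> * (real n - 1))"
  shows "(\<Sum>i\<in>{1..n} - {m}. \<bar>\<eta> i\<bar>) \<le> (6208 * U / (\<alpha> * d) + \<bar>\<mu>\<bar>) * (real n - 1)"
    and "i \<in> {1..n} - {m} \<Longrightarrow> \<bar>\<eta> i\<bar> \<le> 18688 * U * L / (\<alpha> * d) + \<bar>\<mu>\<bar>"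
proof -
  interpret E: expander "{1..n} - {m}" "linked W" "coef \<theta> \<theta>'" \<alpha> \<gamma> "d / 16" "3 * d"
    by (rule expander_remove[OF m])
  have card: "real (card ({1..n} - {m})) = real n - 1" using m n by simp
  have n1: "0 < real n - 1" using n by simp
  have growth: "E.growth = 1 / 96" using d by (simp add: E.growth_def)
  have sym: "(\<Sum>i\<in>{1..n} - {m}. \<Sum>j\<in>{1..n} - {m}. coef \<theta> \<theta>' i j * (\<eta> i - \<eta> j)) = 0"
  proof -
    have "(\<Sum>i\<in>{1..n} - {m}. \<Sum>j\<in>{1..n} - {m}. coef \<theta> \<theta>' i j * (\<eta> i - \<eta> j))
      = (\<Sum>i\<in>{1..n} - {m}. \<Sum>j\<in>{1..n} - {m}. coef \<theta> \<theta>' i j * \<eta> i)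
        - (\<Sum>i\<in>{1..n} - {m}. \<Sum>j\<in>{1..n} - {m}. coef \<theta> \<theta>' i j * \<eta> j)"
      by (simp add: right_diff_distrib sum_subtractf)
    also have "(\<Sum>i\<in>{1..n} - {m}. \<Sum>j\<in>{1..n} - {m}. coef \<theta> \<theta>' i j * \<eta> j)
      = (\<Sum>i\<in>{1..n} - {m}. \<Sum>j\<in>{1..n} - {m}. coef \<theta> \<theta>' i j * \<eta> i)"
      by (subst sum.swap) (simp only: coef_sym)
    finally show ?thesis by simp
  qed
  have "(\<Sum>i\<in>{1..n} - {m}. v i) = \<gamma> * (\<Sum>i\<in>{1..n} - {m}. \<eta> i)"
    using sym by (simp add: eq[symmetric] sum.distrib sum_distrib_left)
  then have s\<eta>: "(\<Sum>i\<in>{1..n} - {m}. \<eta> i) = (real n - 1) * \<mu>"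
    unfolding \<mu>_def using \<gamma> n1 by (simp add: field_simps)
  have "\<bar>\<Sum>i\<in>{1..n} - {m}. v i\<bar> \<le> (\<Sum>i\<in>{1..n} - {m}. U)"
    using v by (intro order_trans[OF sum_abs] sum_mono) auto
  also have "\<dots> = U * (real n - 1)" by (simp only: sum_constant card mult.commute)
  finally have "\<bar>\<Sum>i\<in>{1..n} - {m}. v i\<bar> / (real n - 1) \<le> U"
    using n1 by (simp only: pos_divide_le_eq)
  moreover have "\<bar>\<gamma> * \<mu>\<bar> = \<bar>\<Sum>i\<in>{1..n} - {m}. v i\<bar> / (real n - 1)"
    unfolding \<mu>_def using \<gamma> n1 by (simp add: abs_mult)
  ultimately have g\<mu>: "\<bar>\<gamma> * \<mu>\<bar> \<le> U" by simp
  define \<xi> where "\<xi> i = \<eta> i - \<mu>" for i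
  have eq': "(\<Sum>j\<in>{1..n} - {m}. coef \<theta> \<theta>' i j * (\<xi> i - \<xi> j)) + \<gamma> * \<xi> i = v i - \<gamma> * \<mu>"
    if "i \<in> {1..n} - {m}" for i
    using eq[OF that] by (simp add: \<xi>_def algebra_simps)
  have v': "\<bar>v i - \<gamma> * \<mu>\<bar> \<le> 2 * U" if "i \<in> {1..n} - {m}" for i
    using v[OF that] g\<mu> by linarith
  have mean: "(\<Sum>i\<in>{1..n} - {m}. \<xi> i) = 0"
    using s\<eta> card by (simp add: \<xi>_def sum_subtractf)
  have U2: "0 < 2 * U" using U by simp
  have T1: "(\<Sum>i\<in>{1..n} - {m}. \<bar>\<xi> i\<bar>) \<le> 2 * (2 * U) / (\<alpha> * (d / 16)) * (1 + 1 / (1 / 96)) * (real n - 1)"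
    by (rule E.two_sided(1)[OF eq' v' U2 mean, unfolded growth card])
  have T2: "\<bar>\<xi> i\<bar> \<le> 2 * (2 * U) / (\<alpha> * (d / 16)) *
      (2 * (1 + 1 / (1 / 96)) + 1 + ln (real n - 1) / ln (1 + 1 / 96))" if "i \<in> {1..n} - {m}" for i
    by (rule E.two_sided(2)[OF eq' v' U2 mean that, unfolded growth card])
  have f: "2 * (2 * U) / (\<alpha> * (d / 16)) = 64 * U / (\<alpha> * d)" by simp
  have "(\<Sum>i\<in>{1..n} - {m}. \<bar>\<eta> i\<bar>) \<le> (\<Sum>i\<in>{1..n} - {m}. \<bar>\<xi> i\<bar> + \<bar>\<mu>\<bar>)"
    unfolding \<xi>_def by (intro sum_mono) linarith
  also have "\<dots> = (\<Sum>i\<in>{1..n} - {m}. \<bar>\<xi> i\<bar>) + (real n - 1) * \<bar>\<mu>\<bar>"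
    using card by (simp add: sum.distrib)
  also have "\<dots> \<le> 64 * U / (\<alpha> * d) * 97 * (real n - 1) + (real n - 1) * \<bar>\<mu>\<bar>"
    using T1 unfolding f by simp
  finally show "(\<Sum>i\<in>{1..n} - {m}. \<bar>\<eta> i\<bar>) \<le> (6208 * U / (\<alpha> * d) + \<bar>\<mu>\<bar>) * (real n - 1)"
    by (simp add: algebra_simps)
  assume i: "i \<in> {1..n} - {m}"
  have "ln (real n - 1) / ln (1 + 1 / 96) \<le> L * 97"
  proof -
    have "ln (inverse (1 + 1 / 96) :: real) \<le> inverse (1 + 1 / 96) - 1"
      by (rule ln_le_minus_one) simp
    then have 1: "1 / 97 \<le> ln (1 + 1 / 96 :: real)" by (subst (asm) ln_inverse) auto
    have "ln (real n - 1) \<le> ln (real n)" using n1 by simp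
    also have "\<dots> \<le> L" by (rule L)
    also have "\<dots> = L * 97 * (1 / 97)" by simp
    also have "\<dots> \<le> L * 97 * ln (1 + 1 / 96)"
      using 1 L(1) by (intro mult_left_mono) auto
    finally show ?thesis by (subst pos_divide_le_eq) auto
  qed
  then have "2 * (1 + 1 / (1 / 96)) + 1 + ln (real n - 1) / ln (1 + 1 / 96) \<le> 292 * L"
    using L(1) by simp
  then have "64 * U / (\<alpha> * d) * (2 * (1 + 1 / (1 / 96)) + 1 + ln (real n - 1) / ln (1 + 1 / 96))
      \<le> 64 * U / (\<alpha> * d) * (292 * L)"
    using U \<alpha> d by (intro mult_left_mono) auto
  then have "\<bar>\<xi> i\<bar> \<le> 64 * U / (\<alpha> * d) * (292 * L)"
    using T2[OF i] unfolding f by linarith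
  then show "\<bar>\<eta> i\<bar> \<le> 18688 * U * L / (\<alpha> * d) + \<bar>\<mu>\<bar>"
    unfolding \<xi>_def by (simp add: algebra_simps)
qed

definition Cl1 :: real where "Cl1 = 6208 * (3 * B1 + 2 * \<kappa>) / \<alpha> + 3 * B2"

text \<open>The residual of \<open>\<theta>0\<close> in the leave-one-out equation has the full
  order \<open>d * r\<close>, so the sup bound would lose a factor \<open>L\<close> here and the l1
  bound is used. As scores sum to zero, the mean is governed by the noise sum, \<open>w m\<close>
  and \<open>\<theta>0 m\<close>.\<close>

lemma loo_l1:
  assumes m: "m \<in> {1..n}" and f: "foc \<psi> ({1..n} - {m}) W \<gamma> w \<theta>'"
  shows "(\<Sum>i\<in>{1..n} - {m}. \<bar>\<theta>' i - \<theta>0 i\<bar>) \<le> Cl1 * r * real n"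
proof -
  let ?U = "{1..n} - {m}"
  define b where "b i = score \<psi> ?U W \<theta>0 i + \<gamma> * \<theta>0 i + w i" for i
  have eq: "(\<Sum>j\<in>?U. coef \<theta>' \<theta>0 i j * ((\<theta>' i - \<theta>0 i) - (\<theta>' j - \<theta>0 j))) + \<gamma> * (\<theta>' i - \<theta>0 i) = - b i"
    if "i \<in> ?U" for i
  proof -
    have "score \<psi> ?U W \<theta>' i + \<gamma> * \<theta>' i + w i = 0" using f that unfolding foc_def by blast
    then show ?thesis unfolding score_diff[symmetric] b_def by (simp add: algebra_simps)
  qed
  have bU: "\<bar>- b i\<bar> \<le> (3 * B1 + 2 * \<kappa>) * (d * r)" if i: "i \<in> ?U" for i
  proof -
    define e where "e = (if (i, m) \<in> W then \<psi> (\<theta>0 i - \<theta>0 m) else 0) - (if (m, i) \<in> W then \<psi> (\<theta>0 m - \<theta>0 i) else 0)"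
    have "\<bar>e\<bar> \<le> 2 * \<kappa>"
      using \<kappa>(1)[of i m] \<kappa>(1)[of m i] \<kappa>(2) i m unfolding e_def by auto
    moreover have "score \<psi> {1..n} W \<theta>0 i = score \<psi> ?U W \<theta>0 i + e"
      unfolding e_def by (rule score_remove) (use m in auto)
    moreover have "2 * \<kappa> * 1 \<le> 2 * \<kappa> * (d * r)"
      using L(5) \<kappa>(2) by (intro mult_left_mono) auto
    moreover have "\<bar>score \<psi> {1..n} W \<theta>0 i\<bar> \<le> B1 * (d * r)" "\<bar>\<gamma> * \<theta>0 i\<bar> \<le> B1 * (d * r)" "\<bar>w i\<bar> \<le> B1 * (d * r)"
      using score0 ridge0 noise0 i by auto
    ultimately show ?thesis unfolding b_def by (simp add: distrib_right)
  qed
  have Upos: "0 < (3 * B1 + 2 * \<kappa>) * (d * r)"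
    using r \<kappa>(2) d by (intro mult_pos_pos add_pos_pos) auto
  define \<mu> where "\<mu> = (\<Sum>i\<in>?U. - b i) / (\<gamma> * (real n - 1))"
  have T: "(\<Sum>i\<in>?U. \<bar>\<theta>' i - \<theta>0 i\<bar>) \<le> (6208 * ((3 * B1 + 2 * \<kappa>) * (d * r)) / (\<alpha> * d) + \<bar>\<mu>\<bar>) * (real n - 1)"
    by (rule expander_bounds(1)[OF m eq bU Upos, folded \<mu>_def])
  have n1: "0 < real n - 1" using n by simp
  have gn: "0 < \<gamma> * (real n - 1)" using \<gamma> n1 by simp
  have "(\<Sum>i\<in>?U. b i) = \<gamma> * (\<Sum>i\<in>?U. \<theta>0 i) + (\<Sum>i\<in>?U. w i)"
    by (simp add: b_def sum.distrib sum_score_eq_0 sum_distrib_left)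
  also have "(\<Sum>i\<in>?U. \<theta>0 i) = - \<theta>0 m" using sum0 m by (simp add: sum_diff1)
  also have "(\<Sum>i\<in>?U. w i) = (\<Sum>i\<in>{1..n}. w i) - w m" using m by (simp add: sum_diff1)
  finally have "\<bar>\<Sum>i\<in>?U. b i\<bar> \<le> \<bar>\<gamma> * \<theta>0 m\<bar> + \<bar>\<Sum>i\<in>{1..n}. w i\<bar> + \<bar>w m\<bar>" by (simp add: algebra_simps)
  also have "\<bar>\<gamma> * \<theta>0 m\<bar> \<le> \<gamma> * 1"
    unfolding abs_mult using \<gamma> bdd[OF m] by (intro mult_mono) auto
  also have "\<gamma> * 1 \<le> \<gamma> * ((real n - 1) * (B2 * r))"
    using \<gamma> n_rate by (intro mult_left_mono) auto
  finally have "\<bar>\<Sum>i\<in>?U. b i\<bar> \<le> \<gamma> * ((real n - 1) * (B2 * r)) + \<bar>\<Sum>i\<in>{1..n}. w i\<bar> + \<bar>w m\<bar>" by simp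
  then have "\<bar>\<Sum>i\<in>?U. b i\<bar> \<le> 3 * (B2 * r) * (\<gamma> * (real n - 1))"
  proof -
    have "3 * (B2 * r) * (\<gamma> * (real n - 1)) = 3 * (\<gamma> * ((real n - 1) * (B2 * r)))" by simp
    then show ?thesis using noise_sum noise1[OF m] \<open>\<bar>\<Sum>i\<in>?U. b i\<bar> \<le> \<gamma> * _ + _ + _\<close> by linarith
  qed
  then have "\<bar>\<mu>\<bar> \<le> 3 * (B2 * r)"
    unfolding \<mu>_def sum_negf abs_divide abs_minus_cancel abs_of_pos[OF gn]
    by (simp only: pos_divide_le_eq[OF gn])
  then have "6208 * ((3 * B1 + 2 * \<kappa>) * (d * r)) / (\<alpha> * d) + \<bar>\<mu>\<bar> \<le> Cl1 * r"
  proof -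
    have e: "6208 * (K * (d * r)) / (\<alpha> * d) = 6208 * K / \<alpha> * r" for K using d(1) by simp
    then show ?thesis
      using \<open>\<bar>\<mu>\<bar> \<le> _\<close>
      unfolding Cl1_def distrib_right[of "6208 * (3 * B1 + 2 * \<kappa>) / \<alpha>" "3 * B2" r] e[of "3 * B1 + 2 * \<kappa>"]
      by linarith
  qed
  then have "(6208 * ((3 * B1 + 2 * \<kappa>) * (d * r)) / (\<alpha> * d) + \<bar>\<mu>\<bar>) * (real n - 1) \<le> Cl1 * r * (real n - 1)"
    using n1 by (intro mult_right_mono) auto
  moreover have "Cl1 * r * (real n - 1) \<le> Cl1 * r * real n"
    using r \<kappa>(2) \<alpha> unfolding Cl1_def by (intro mult_left_mono mult_nonneg_nonneg add_nonneg_nonneg) auto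
  ultimately show ?thesis using T by linarith
qed

definition E1 :: real where "E1 = 37376 * \<kappa> / \<alpha> + 2 * B2"
definition E2 :: real where "E2 = 74752 * \<beta> / \<alpha> + 2"

text \<open>The residual now consists of the comparisons with \<open>m\<close> alone and is of order
  \<open>\<kappa> + \<beta> * M\<close> instead of \<open>d * r\<close>. The logarithm in the sup
  bound is then harmless, since \<open>L / d\<close> is at most \<open>r\<close> and at most
  \<open>1 / c1\<close>.\<close>

lemma loo_linf:
  assumes m: "m \<in> {1..n}" and f: "foc \<psi> ({1..n} - {m}) W \<gamma> w \<theta>'"
    and g: "foc \<psi> {1..n} W \<gamma> w \<theta>" and M: "\<And>i. i \<in> {1..n} \<Longrightarrow> \<bar>\<theta> i - \<theta>0 i\<bar> \<le> M"
    and i: "i \<in> {1..n} - {m}"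
  shows "\<bar>\<theta> i - \<theta>' i\<bar> \<le> E1 * r + E2 * M / c1"
proof -
  let ?U = "{1..n} - {m}"
  have M0: "0 \<le> M" using M[OF m] by linarith
  define e where "e i = (if (i, m) \<in> W then \<psi> (\<theta> i - \<theta> m) else 0) - (if (m, i) \<in> W then \<psi> (\<theta> m - \<theta> i) else 0)" for i
  have s: "score \<psi> {1..n} W \<theta> i = score \<psi> ?U W \<theta> i + e i" for i
    unfolding e_def by (rule score_remove) (use m in auto)
  have eq: "(\<Sum>j\<in>?U. coef \<theta> \<theta>' i j * ((\<theta> i - \<theta>' i) - (\<theta> j - \<theta>' j))) + \<gamma> * (\<theta> i - \<theta>' i) = - e i"
    if "i \<in> ?U" for i
  proof -
    have "score \<psi> ?U W \<theta> i + e i + \<gamma> * \<theta> i + w i = 0" "score \<psi> ?U W \<theta>' i + \<gamma> * \<theta>' i + w i = 0"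
      using f g that unfolding foc_def s by auto
    then show ?thesis unfolding score_diff[symmetric] by (simp add: algebra_simps)
  qed
  have p: "\<bar>\<psi> (\<theta> i - \<theta> j)\<bar> \<le> \<kappa> + 2 * \<beta> * M" if "i \<in> {1..n}" "j \<in> {1..n}" for i j
  proof -
    have "\<bar>(\<theta> i - \<theta> j) - (\<theta>0 i - \<theta>0 j)\<bar> \<le> 2 * M" using M[OF that(1)] M[OF that(2)] by linarith
    then have "\<beta> * \<bar>(\<theta> i - \<theta> j) - (\<theta>0 i - \<theta>0 j)\<bar> \<le> \<beta> * (2 * M)" using \<beta> by (intro mult_left_mono) auto
    then show ?thesis using \<psi>_lipschitz[of "\<theta> i - \<theta> j" "\<theta>0 i - \<theta>0 j"] \<kappa>(1)[OF that] by linarith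
  qed
  have kM: "0 < \<kappa> + 2 * \<beta> * M" using \<kappa>(2) \<beta> M0 by (simp add: add_pos_nonneg)
  have eU: "\<bar>- e i\<bar> \<le> 2 * (\<kappa> + 2 * \<beta> * M)" if i: "i \<in> ?U" for i
  proof -
    have "\<bar>\<psi> (\<theta> i - \<theta> m)\<bar> \<le> \<kappa> + 2 * \<beta> * M" "\<bar>\<psi> (\<theta> m - \<theta> i)\<bar> \<le> \<kappa> + 2 * \<beta> * M"
      using p i m by auto
    moreover have "\<bar>- e i\<bar> \<le> \<bar>\<psi> (\<theta> i - \<theta> m)\<bar> + \<bar>\<psi> (\<theta> m - \<theta> i)\<bar>"
      unfolding e_def by auto
    moreover have "x \<le> 2 * K" if "a \<le> K" "b \<le> K" "x \<le> a + b" for a b x K :: real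
      using that by simp
    ultimately show ?thesis by blast
  qed
  define \<mu> where "\<mu> = (\<Sum>i\<in>?U. - e i) / (\<gamma> * (real n - 1))"
  have n1: "0 < real n - 1" using n by simp
  have gn: "0 < \<gamma> * (real n - 1)" using \<gamma> n1 by simp
  \<comment> \<open>Scores over all of \<open>{1..n}\<close> cancel, so the total residual is minus
    the score at \<open>m\<close>, which the first order condition at \<open>m\<close>
    evaluates.\<close>
  have "(\<Sum>i\<in>?U. e i) = (\<Sum>i\<in>?U. score \<psi> {1..n} W \<theta> i)"
    unfolding s by (simp add: sum.distrib sum_score_eq_0)
  also have "\<dots> = - score \<psi> {1..n} W \<theta> m"
    using m sum_score_eq_0[of \<psi> "{1..n}" W \<theta>] by (simp add: sum_diff1)
  also have "\<dots> = \<gamma> * \<theta> m + w m"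
  proof -
    have "score \<psi> {1..n} W \<theta> m + \<gamma> * \<theta> m + w m = 0" using g m unfolding foc_def by blast
    then show ?thesis by linarith
  qed
  finally have "\<bar>\<Sum>i\<in>?U. e i\<bar> \<le> \<gamma> * \<bar>\<theta> m\<bar> + \<bar>w m\<bar>" using \<gamma> abs_triangle_ineq[of "\<gamma> * \<theta> m" "w m"] by (simp add: abs_mult)
  also have "\<gamma> * \<bar>\<theta> m\<bar> \<le> \<gamma> * (1 + M)"
    using \<gamma> M[OF m] bdd[OF m] by (intro mult_left_mono) auto
  also have "\<dots> \<le> \<gamma> * ((real n - 1) * (B2 * r) + (real n - 1) * (2 * M / c1))"
  proof (intro mult_left_mono add_mono n_rate)
    have "c1 * 1 \<le> c1 * L" using L(1) c1 by (intro mult_left_mono) auto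
    also have "\<dots> \<le> d" by (rule L(4))
    also have "\<dots> \<le> real n" by (rule d(2))
    also have "\<dots> \<le> 2 * (real n - 1)" using n by simp
    finally have "c1 \<le> 2 * (real n - 1)" by simp
    then have "M * c1 \<le> M * (2 * (real n - 1))" using M0 by (intro mult_left_mono) auto
    then show "M \<le> (real n - 1) * (2 * M / c1)" using c1 by (simp add: field_simps)
  qed (use \<gamma> in auto)
  finally have "\<bar>\<Sum>i\<in>?U. e i\<bar> \<le> (2 * (B2 * r) + 2 * M / c1) * (\<gamma> * (real n - 1))"
    using noise1[OF m] by (simp add: algebra_simps)
  then have \<mu>: "\<bar>\<mu>\<bar> \<le> 2 * (B2 * r) + 2 * M / c1"
    unfolding \<mu>_def sum_negf abs_divide abs_minus_cancel abs_of_pos[OF gn]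
    by (simp only: pos_divide_le_eq[OF gn])
  have U: "0 < 2 * (\<kappa> + 2 * \<beta> * M)" using kM by simp
  have "\<bar>\<theta> i - \<theta>' i\<bar> \<le> 18688 * (2 * (\<kappa> + 2 * \<beta> * M)) * L / (\<alpha> * d) + \<bar>\<mu>\<bar>"
    by (rule expander_bounds(2)[OF m eq eU U i, folded \<mu>_def])
  also have "18688 * (2 * (\<kappa> + 2 * \<beta> * M)) * L / (\<alpha> * d)
      = 37376 * \<kappa> / \<alpha> * (L / d) + 74752 * \<beta> / \<alpha> * M * (L / d)"
    using \<alpha> d by (simp add: field_simps)
  also have "\<dots> \<le> 37376 * \<kappa> / \<alpha> * r + 74752 * \<beta> / \<alpha> * M * (1 / c1)"
    using L(3,4) d c1 \<alpha> \<beta> \<kappa>(2) M0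
    by (intro add_mono mult_left_mono) (auto simp: field_simps)
  finally show ?thesis using \<mu> unfolding E1_def E2_def by (simp add: algebra_simps add_divide_distrib)
qed

text \<open>The cut bound for the singleton \<open>{m}\<close> in the graph without some other
  vertex \<open>m'\<close>; \<open>3 \<le> n\<close> makes the singleton at most half of that
  graph.\<close>

lemma degree_ge:
  assumes m: "m \<in> {1..n}"
  shows "d / 16 \<le> real (card {j\<in>{1..n} - {m}. linked W m j})"
proof -
  have "\<exists>m'\<in>{1..n}. m' \<noteq> m"
    by (rule bexI[of _ "if m = 1 then 2 else 1"]) (use n in auto)
  then obtain m' where m': "m' \<in> {1..n}" "m' \<noteq> m" by blast
  have "d / 16 * real (card {m}) \<le> real (card {(i, j)\<in>{m} \<times> ({1..n} - {m'} - {m}). linked W i j})"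
    using m m' n by (intro cut) auto
  also have "card {(i, j)\<in>{m} \<times> ({1..n} - {m'} - {m}). linked W i j} \<le> card (Pair m ` {j\<in>{1..n} - {m}. linked W m j})"
    by (intro card_mono) auto
  also have "\<dots> = card {j\<in>{1..n} - {m}. linked W m j}"
    by (intro card_image) (auto simp: inj_on_def)
  finally show ?thesis by simp
qed

text \<open>At the vertex of maximal error \<open>M\<close>, the weighted degree times
  \<open>M\<close> is at most the residual plus the weighted errors of the neighbours. Bounding each
  neighbour by \<open>M\<close> would be circular. Through the leave-one-out solution their sum is
  of order \<open>d * r\<close> plus \<open>M * d / c1\<close>, and a large \<open>c1\<close> lets
  the left side absorb the second term.\<close>

theorem sup_norm_bound:
  assumes g: "foc \<psi> {1..n} W \<gamma> w \<theta>" and i: "i \<in> {1..n}"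
    and c1_large: "32 * (14 * \<beta> + 20 * \<beta> * E2) / \<alpha> \<le> c1"
  shows "\<bar>\<theta> i - \<theta>0 i\<bar> \<le> 32 * (3 * B1 + 4 * \<beta> * Cl1 + 20 * \<beta> * E1) / \<alpha> * r"
proof -
  define \<delta> where "\<delta> i = \<theta> i - \<theta>0 i" for i
  define M where "M = Max ((\<lambda>i. \<bar>\<delta> i\<bar>) ` {1..n})"
  have ne: "{1..n} \<noteq> {}" using i by auto
  have M: "\<bar>\<delta> i\<bar> \<le> M" if "i \<in> {1..n}" for i
    unfolding M_def using that by (intro Max_ge) auto
  have "M \<in> (\<lambda>i. \<bar>\<delta> i\<bar>) ` {1..n}" unfolding M_def using ne by (intro Max_in) auto
  then obtain m where m: "m \<in> {1..n}" and mM: "\<bar>\<delta> m\<bar> = M" by auto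
  have M0: "0 \<le> M" using mM by linarith
  let ?U = "{1..n} - {m}"
  from loo[OF m] obtain \<theta>' where f: "foc \<psi> ?U W \<gamma> w \<theta>'"
    and mix: "\<And>X. (\<forall>j\<in>?U. \<bar>\<theta>' j - \<theta>0 j\<bar> \<le> X) \<Longrightarrow>
          (\<Sum>j\<in>{j\<in>?U. linked W m j}. \<bar>\<theta>' j - \<theta>0 j\<bar>)
            \<le> 2 * (d / real n) * (\<Sum>j\<in>?U. \<bar>\<theta>' j - \<theta>0 j\<bar>) + 7 * L * X" by blast
  define X where "X = E1 * r + E2 * M / c1"
  have \<eta>: "\<bar>\<theta> j - \<theta>' j\<bar> \<le> X" if "j \<in> ?U" for j
    unfolding X_def by (rule loo_linf[OF m f g _ that]) (use M in \<open>simp add: \<delta>_def\<close>)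
  have X0: "0 \<le> X"
    unfolding X_def E1_def E2_def using r \<kappa>(2) \<alpha> \<beta> M0 c1 by (auto intro!: add_nonneg_nonneg mult_nonneg_nonneg divide_nonneg_nonneg)
  have Ld: "L \<le> d" "L \<le> d / c1"
  proof -
    have "1 * L \<le> c1 * L" using c1 L(1) by (intro mult_right_mono) auto
    then show "L \<le> d" using L(4) by simp
    show "L \<le> d / c1" using L(4) c1 by (simp add: field_simps)
  qed
  \<comment> \<open>The sampling bound is applied with \<open>M + X\<close> as sup bound for the
    leave-one-out errors. Of the 10 in \<open>10 * d * X\<close>, 7 come from its fluctuation term
    and 3 from the degree bound times the distance to the full solution.\<close>
  have nb: "(\<Sum>j\<in>{j\<in>?U. linked W m j}. \<bar>\<delta> j\<bar>) \<le> 2 * Cl1 * (d * r) + 7 * (d / c1) * M + 10 * d * X"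
  proof -
    have "\<forall>j\<in>?U. \<bar>\<theta>' j - \<theta>0 j\<bar> \<le> M + X"
      using \<eta> M unfolding \<delta>_def by (smt (verit) DiffD1)
    from mix[OF this]
    have 1: "(\<Sum>j\<in>{j\<in>?U. linked W m j}. \<bar>\<theta>' j - \<theta>0 j\<bar>)
        \<le> 2 * (d / real n) * (\<Sum>j\<in>?U. \<bar>\<theta>' j - \<theta>0 j\<bar>) + 7 * L * (M + X)" .
    have 2: "2 * (d / real n) * (\<Sum>j\<in>?U. \<bar>\<theta>' j - \<theta>0 j\<bar>) \<le> 2 * (d / real n) * (Cl1 * r * real n)"
      using loo_l1[OF m f] d by (intro mult_left_mono) auto
    have 3: "2 * (d / real n) * (Cl1 * r * real n) = 2 * Cl1 * (d * r)" using n by simp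
    have 4: "7 * L * (M + X) \<le> 7 * (d / c1) * M + 7 * d * X"
      using Ld M0 X0 by (simp only: distrib_left) (intro add_mono mult_right_mono, auto)
    have "(\<Sum>j\<in>{j\<in>?U. linked W m j}. \<bar>\<theta> j - \<theta>' j\<bar>) \<le> (\<Sum>j\<in>{j\<in>?U. linked W m j}. X)"
      using \<eta> by (intro sum_mono) auto
    also have "\<dots> = real (card {j\<in>?U. linked W m j}) * X" by simp
    also have "\<dots> \<le> 3 * d * X"
    proof (intro mult_right_mono X0)
      have "card {j\<in>?U. linked W m j} \<le> card {j\<in>{1..n}. linked W m j}" by (intro card_mono) auto
      then show "real (card {j\<in>?U. linked W m j}) \<le> 3 * d" using deg[OF m] by linarith
    qed
    finally have 5: "(\<Sum>j\<in>{j\<in>?U. linked W m j}. \<bar>\<theta> j - \<theta>' j\<bar>) \<le> 3 * d * X" .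
    have "(\<Sum>j\<in>{j\<in>?U. linked W m j}. \<bar>\<delta> j\<bar>)
      \<le> (\<Sum>j\<in>{j\<in>?U. linked W m j}. \<bar>\<theta>' j - \<theta>0 j\<bar> + \<bar>\<theta> j - \<theta>' j\<bar>)"
      unfolding \<delta>_def by (intro sum_mono) linarith
    then show ?thesis using 1 2 3 4 5 by (simp add: sum.distrib)
  qed
  define b where "b = score \<psi> {1..n} W \<theta>0 m + \<gamma> * \<theta>0 m + w m"
  have b: "\<bar>b\<bar> \<le> 3 * B1 * (d * r)"
    using score0[OF m] ridge0[OF m] noise0[OF m] unfolding b_def by linarith
  have eq: "(\<Sum>j\<in>{1..n}. coef \<theta> \<theta>0 m j * (\<delta> m - \<delta> j)) + \<gamma> * \<delta> m = - b"
  proof -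
    have "score \<psi> {1..n} W \<theta> m + \<gamma> * \<theta> m + w m = 0" using g m unfolding foc_def by blast
    then show ?thesis unfolding \<delta>_def score_diff[symmetric] b_def by (simp add: algebra_simps)
  qed
  define s where "s = (if 0 \<le> \<delta> m then 1 else - 1 :: real)"
  have s: "s * \<delta> m = M" "\<bar>s\<bar> = 1" using mM by (auto simp: s_def)
  have sj: "s * \<delta> j \<le> \<bar>\<delta> j\<bar>" for j by (auto simp: s_def)
  have "M * (\<Sum>j\<in>?U. coef \<theta> \<theta>0 m j) - (\<Sum>j\<in>?U. coef \<theta> \<theta>0 m j * \<bar>\<delta> j\<bar>)
      = (\<Sum>j\<in>?U. coef \<theta> \<theta>0 m j * (M - \<bar>\<delta> j\<bar>))"
    unfolding sum_distrib_left sum_subtractf[symmetric]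
    by (intro sum.cong refl) (simp add: algebra_simps)
  also have "\<dots> \<le> (\<Sum>j\<in>?U. coef \<theta> \<theta>0 m j * (s * \<delta> m - s * \<delta> j))"
    using sj coef_nonneg s(1) by (intro sum_mono mult_left_mono) (auto intro: diff_left_mono)
  also have "\<dots> = s * (\<Sum>j\<in>?U. coef \<theta> \<theta>0 m j * (\<delta> m - \<delta> j))"
    by (simp add: sum_distrib_left algebra_simps)
  also have "(\<Sum>j\<in>?U. coef \<theta> \<theta>0 m j * (\<delta> m - \<delta> j)) = (\<Sum>j\<in>{1..n}. coef \<theta> \<theta>0 m j * (\<delta> m - \<delta> j))"
    using m by (simp add: sum_diff1)
  also have "s * \<dots> = - (s * b) - \<gamma> * M"
  proof -
    have "(\<Sum>j\<in>{1..n}. coef \<theta> \<theta>0 m j * (\<delta> m - \<delta> j)) = - b - \<gamma> * \<delta> m" using eq by linarith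
    then show ?thesis unfolding s(1)[symmetric] by (simp only:) (simp add: algebra_simps)
  qed
  also have "\<dots> \<le> \<bar>b\<bar>"
  proof -
    have "- (s * b) \<le> \<bar>b\<bar>" by (auto simp: s_def)
    moreover have "0 \<le> \<gamma> * M" using \<gamma> M0 by simp
    ultimately show ?thesis by linarith
  qed
  finally have main: "M * (\<Sum>j\<in>?U. coef \<theta> \<theta>0 m j) \<le> \<bar>b\<bar> + (\<Sum>j\<in>?U. coef \<theta> \<theta>0 m j * \<bar>\<delta> j\<bar>)" by simp
  have "(\<Sum>j\<in>?U. coef \<theta> \<theta>0 m j * \<bar>\<delta> j\<bar>) \<le> (\<Sum>j\<in>?U. (if linked W m j then 2 * \<beta> else 0) * \<bar>\<delta> j\<bar>)"
    using coef_le by (intro sum_mono mult_right_mono) auto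
  also have "\<dots> = 2 * \<beta> * (\<Sum>j\<in>{j\<in>?U. linked W m j}. \<bar>\<delta> j\<bar>)"
  proof -
    have "(\<Sum>j\<in>?U. (if linked W m j then 2 * \<beta> else 0) * \<bar>\<delta> j\<bar>) = (\<Sum>j\<in>{j\<in>?U. linked W m j}. 2 * \<beta> * \<bar>\<delta> j\<bar>)"
      by (intro sum.mono_neutral_cong_right) auto
    then show ?thesis by (simp add: sum_distrib_left)
  qed
  also have "\<dots> \<le> 2 * \<beta> * (2 * Cl1 * (d * r) + 7 * (d / c1) * M + 10 * d * X)"
    using nb \<beta> by (intro mult_left_mono) auto
  finally have up: "(\<Sum>j\<in>?U. coef \<theta> \<theta>0 m j * \<bar>\<delta> j\<bar>) \<le> \<dots>" .
  have "M * (\<alpha> * (d / 16)) \<le> M * (\<Sum>j\<in>?U. coef \<theta> \<theta>0 m j)"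
  proof (intro mult_left_mono M0)
    have "\<alpha> * (d / 16) \<le> \<alpha> * real (card {j\<in>?U. linked W m j})"
      using degree_ge[OF m] \<alpha> by (intro mult_left_mono) auto
    also have "\<dots> = (\<Sum>j\<in>{j\<in>?U. linked W m j}. \<alpha>)" by simp
    also have "\<dots> \<le> (\<Sum>j\<in>{j\<in>?U. linked W m j}. coef \<theta> \<theta>0 m j)"
      using coef_ge by (intro sum_mono) auto
    also have "\<dots> \<le> (\<Sum>j\<in>?U. coef \<theta> \<theta>0 m j)"
      using coef_nonneg by (intro sum_mono2) auto
    finally show "\<alpha> * (d / 16) \<le> (\<Sum>j\<in>?U. coef \<theta> \<theta>0 m j)" .
  qed
  with main up b have "M * (\<alpha> * (d / 16)) \<le> 3 * B1 * (d * r) + 2 * \<beta> * (2 * Cl1 * (d * r) + 7 * (d / c1) * M + 10 * d * X)"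
    by linarith
  also have "\<dots> = d * ((3 * B1 + 4 * \<beta> * Cl1 + 20 * \<beta> * E1) * r + (14 * \<beta> + 20 * \<beta> * E2) / c1 * M)"
    unfolding X_def using c1 by (simp add: field_simps)
  finally have "d * (M * (\<alpha> / 16)) \<le> d * ((3 * B1 + 4 * \<beta> * Cl1 + 20 * \<beta> * E1) * r + (14 * \<beta> + 20 * \<beta> * E2) / c1 * M)"
    by (simp add: mult_ac)
  then have fin: "M * (\<alpha> / 16) \<le> (3 * B1 + 4 * \<beta> * Cl1 + 20 * \<beta> * E1) * r + (14 * \<beta> + 20 * \<beta> * E2) / c1 * M"
    using d(1) by (subst (asm) mult_le_cancel_left_pos) auto
  \<comment> \<open>Half of the coefficient \<open>\<alpha> / 16\<close> on the left pays for the
    terms with \<open>M\<close> on the right.\<close>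
  have "(14 * \<beta> + 20 * \<beta> * E2) / c1 \<le> \<alpha> / 32"
    using c1_large c1 \<alpha> by (simp add: field_simps)
  then have "(14 * \<beta> + 20 * \<beta> * E2) / c1 * M \<le> \<alpha> / 32 * M" using M0 by (intro mult_right_mono) auto
  moreover have "M * (\<alpha> / 16) - \<alpha> / 32 * M = M * \<alpha> / 32" by simp
  ultimately have "M * \<alpha> / 32 \<le> (3 * B1 + 4 * \<beta> * Cl1 + 20 * \<beta> * E1) * r"
    using fin by linarith
  then have "M \<le> 32 * (3 * B1 + 4 * \<beta> * Cl1 + 20 * \<beta> * E1) / \<alpha> * r"
    using \<alpha> by (simp add: field_simps)
  then show ?thesis using M[OF i] unfolding \<delta>_def by linarith
qed

end

subsection \<open>Concentration for the comparison data\<close>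

lemma measure_pmf_support_bound:
  assumes "measure (measure_pmf D) B \<le> c" and "\<And>z. z \<in> set_pmf D \<Longrightarrow> z \<in> A \<Longrightarrow> z \<in> B"
  shows "measure (measure_pmf D) A \<le> c"
proof -
  have "measure (measure_pmf D) A \<le> measure (measure_pmf D) B"
    using assms(2) by (intro measure_pmf.finite_measure_mono_AE) (auto simp: AE_measure_pmf_iff)
  then show ?thesis using assms(1) by simp
qed

text \<open>Markov's inequality for the exponential. The multiplier is part of \<open>f\<close>, so
  the same statement serves upper and lower tails; injectivity of \<open>\<pi>\<close> lets the
  summands read distinct, hence independent, coordinates.\<close>

lemma Pi_pmf_chernoff:
  fixes f :: "'j \<Rightarrow> 'b \<Rightarrow> real"
  assumes I: "finite I" and \<pi>: "\<pi> ` J \<subseteq> I" "inj_on \<pi> J"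
    and mgf: "\<And>j. j \<in> J \<Longrightarrow> (\<integral>\<^sup>+v. ennreal (exp (f j v)) \<partial>measure_pmf (q (\<pi> j))) \<le> ennreal (exp (c j))"
  shows "measure (measure_pmf (Pi_pmf I dflt q)) {z. (\<Sum>j\<in>J. c j) + s \<le> (\<Sum>j\<in>J. f j (z (\<pi> j)))} \<le> exp (- s)"
proof -
  let ?D = "Pi_pmf I dflt q"
  let ?S = "\<lambda>z. \<Sum>j\<in>J. f j (z (\<pi> j))"
  let ?k = "ennreal (exp (- (\<Sum>j\<in>J. c j) - s))"
  have J: "finite J" using I \<pi> by (meson finite_imageD finite_subset)
  define h where "h e v = (if e \<in> \<pi> ` J then ennreal (exp (f (inv_into J \<pi> e) v)) else 1)" for e v
  have "ennreal (exp (?S z)) = (\<Prod>e\<in>I. h e (z e))" for z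
  proof -
    have "(\<Prod>e\<in>I. h e (z e)) = (\<Prod>e\<in>\<pi> ` J. h e (z e))"
      using I \<pi>(1) by (intro prod.mono_neutral_right) (auto simp: h_def)
    also have "\<dots> = (\<Prod>j\<in>J. ennreal (exp (f j (z (\<pi> j)))))"
      using \<pi>(2) by (subst prod.reindex) (auto simp: h_def)
    finally show ?thesis by (simp add: exp_sum[OF J] prod_ennreal)
  qed
  then have "(\<integral>\<^sup>+z. ennreal (exp (?S z)) \<partial>?D) = (\<Prod>e\<in>I. \<integral>\<^sup>+v. h e v \<partial>q e)"
    using nn_integral_prod_Pi_pmf[OF I, of dflt q h] by simp
  also have "\<dots> = (\<Prod>e\<in>\<pi> ` J. \<integral>\<^sup>+v. h e v \<partial>q e)"
    using I \<pi>(1) by (intro prod.mono_neutral_right) (auto simp: h_def)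
  also have "\<dots> = (\<Prod>j\<in>J. \<integral>\<^sup>+v. ennreal (exp (f j v)) \<partial>q (\<pi> j))"
    using \<pi>(2) by (subst prod.reindex) (auto intro!: prod.cong nn_integral_cong simp: h_def)
  also have "\<dots> \<le> (\<Prod>j\<in>J. ennreal (exp (c j)))"
    by (intro prod_mono_ennreal mgf)
  also have "\<dots> = ennreal (exp (\<Sum>j\<in>J. c j))"
    by (simp add: exp_sum[OF J] prod_ennreal)
  finally have E: "(\<integral>\<^sup>+z. ennreal (exp (?S z)) \<partial>?D) \<le> ennreal (exp (\<Sum>j\<in>J. c j))" .
  have "{z. (\<Sum>j\<in>J. c j) + s \<le> ?S z} = {z \<in> UNIV. 1 \<le> ?k * ennreal (exp (?S z))}"
    by (auto simp flip: ennreal_mult exp_add simp: ennreal_1[symmetric] simp del: ennreal_1)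
  then have "emeasure ?D {z. (\<Sum>j\<in>J. c j) + s \<le> ?S z} \<le> ?k * (\<integral>\<^sup>+z. ennreal (exp (?S z)) * indicator UNIV z \<partial>?D)"
    using nn_integral_Markov_inequality[of "\<lambda>z. ennreal (exp (?S z))" UNIV ?D ?k] by (simp add: mult.commute)
  also have "\<dots> \<le> ?k * ennreal (exp (\<Sum>j\<in>J. c j))"
    using E by (intro mult_left_mono) auto
  also have "\<dots> = ennreal (exp (- s))"
    by (simp flip: ennreal_mult exp_add)
  finally show ?thesis
    by (simp add: measure_pmf.emeasure_eq_measure)
qed

section \<open>Comparison data as one product measure\<close>

definition comparison_pmf :: "(real \<Rightarrow> real) \<Rightarrow> real \<Rightarrow> (nat \<Rightarrow> real) \<Rightarrow> nat \<times> nat \<Rightarrow> (bool \<times> bool) pmf" where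
  "comparison_pmf F p \<theta> e = bind_pmf (bernoulli_pmf p) (\<lambda>b.
     map_pmf (Pair b) (if b then bernoulli_pmf (F (\<theta> (fst e) - \<theta> (snd e))) else return_pmf False))"

definition outcomes_pmf :: "(real \<Rightarrow> real) \<Rightarrow> nat \<Rightarrow> real \<Rightarrow> (nat \<Rightarrow> real) \<Rightarrow> (nat \<times> nat \<Rightarrow> bool \<times> bool) pmf" where
  "outcomes_pmf F n p \<theta> = Pi_pmf (item_pairs n) (False, False) (comparison_pmf F p \<theta>)"

definition to_data :: "(nat \<times> nat \<Rightarrow> bool \<times> bool) \<Rightarrow> comparison_data" where
  "to_data z = ({e. fst (z e)}, \<lambda>e. snd (z e))"

text \<open>Drawing the graph and then its outcomes amounts to drawing, independently for each pair,
  whether it is compared and with which outcome, the outcome being \<open>False\<close> if it is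
  not. The single product measure is what the tail bound needs, and the comparisons of one vertex
  can be split off from it.\<close>

lemma data_pmf_eq: "data_pmf F n p \<theta> = map_pmf to_data (outcomes_pmf F n p \<theta>)"
proof -
  let ?I = "item_pairs n"
  let ?Y = "\<lambda>(i, j). bernoulli_pmf (F (\<theta> i - \<theta> j))"
  let ?H = "\<lambda>g e. if g e then ?Y e else return_pmf False"
  have "outcomes_pmf F n p \<theta> = bind_pmf (Pi_pmf ?I False (\<lambda>_. bernoulli_pmf p)) (\<lambda>g.
      Pi_pmf ?I (False, False) (\<lambda>e. map_pmf (Pair (g e)) (?H g e)))"
    unfolding outcomes_pmf_def comparison_pmf_def
    by (subst Pi_pmf_bind[OF finite_item_pairs, where d' = False]) (simp add: case_prod_beta cong: if_cong)
  also have "\<dots> = bind_pmf (Pi_pmf ?I False (\<lambda>_. bernoulli_pmf p)) (\<lambda>g.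
      map_pmf (\<lambda>h e. if e \<in> ?I then (g e, h e) else (False, False)) (Pi_pmf ?I False (?H g)))"
    unfolding map_pmf_def
    by (subst Pi_pmf_bind[OF finite_item_pairs, where d' = False])
       (simp add: Pi_pmf_return_pmf[OF finite_item_pairs])
  finally have 1: "map_pmf to_data (outcomes_pmf F n p \<theta>) = bind_pmf (Pi_pmf ?I False (\<lambda>_. bernoulli_pmf p)) (\<lambda>g.
      map_pmf (\<lambda>h. to_data (\<lambda>e. if e \<in> ?I then (g e, h e) else (False, False))) (Pi_pmf ?I False (?H g)))"
    by (simp add: map_bind_pmf map_pmf_comp)
  have "data_pmf F n p \<theta> = bind_pmf (Pi_pmf ?I False (\<lambda>_. bernoulli_pmf p)) (\<lambda>g.
      map_pmf (Pair (Collect g)) (Pi_pmf (Collect g) False ?Y))"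
    by (simp add: data_pmf_def graph_pmf_def bind_map_pmf)
  also have "\<dots> = map_pmf to_data (outcomes_pmf F n p \<theta>)"
    unfolding 1
  proof (intro bind_pmf_cong refl)
    fix g assume "g \<in> set_pmf (Pi_pmf ?I False (\<lambda>_. bernoulli_pmf p))"
    then have g: "\<And>e. e \<notin> ?I \<Longrightarrow> \<not> g e"
      using set_Pi_pmf_subset[OF finite_item_pairs, of n False] by blast
    then have C: "Collect g = {e\<in>?I. g e}" by auto
    have eq: "Pi_pmf ?I False (?H g) = Pi_pmf (Collect g) False ?Y"
      unfolding C by (rule Pi_pmf_if_set[OF finite_item_pairs])
    show "map_pmf (Pair (Collect g)) (Pi_pmf (Collect g) False ?Y) =
      map_pmf (\<lambda>h. to_data (\<lambda>e. if e \<in> ?I then (g e, h e) else (False, False))) (Pi_pmf ?I False (?H g))"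
      unfolding eq
    proof (intro map_pmf_cong refl)
      fix h assume "h \<in> set_pmf (Pi_pmf (Collect g) False ?Y)"
      then have "\<And>e. \<not> g e \<Longrightarrow> \<not> h e"
        using set_Pi_pmf_subset[of "Collect g" False ?Y] finite_subset[OF _ finite_item_pairs] C by blast
      then show "(Collect g, h) = to_data (\<lambda>e. if e \<in> ?I then (g e, h e) else (False, False))"
        using g by (auto simp: to_data_def fun_eq_iff)
    qed
  qed
  finally show ?thesis .
qed

text \<open>The coordinate at which the comparison of two items is stored, given the items in either
  order.\<close>

definition upair :: "nat \<Rightarrow> nat \<Rightarrow> nat \<times> nat" where
  "upair i j = (min i j, max i j)"

lemma upair_in: "i \<in> {1..n} \<Longrightarrow> j \<in> {1..n} \<Longrightarrow> i \<noteq> j \<Longrightarrow> upair i j \<in> item_pairs n"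
  by (auto simp: upair_def item_pairs_def min_def max_def)

lemma upair_image:
  assumes "i \<in> {1..n}"
  shows "upair i ` ({1..n} - {i}) \<subseteq> item_pairs n"
proof (rule image_subsetI)
  fix j assume "j \<in> {1..n} - {i}"
  then show "upair i j \<in> item_pairs n" using assms by (intro upair_in) auto
qed

lemma inj_on_upair: "inj_on (upair i) J"
  by (auto simp: inj_on_def upair_def min_def max_def split: if_splits)

abbreviation outcome_wins :: "(nat \<times> nat \<Rightarrow> bool \<times> bool) \<Rightarrow> (nat \<times> nat) set" where
  "outcome_wins z \<equiv> wins (to_data z)"

lemma wins_to_data: "(i, j) \<in> outcome_wins z \<longleftrightarrow> z (i, j) = (True, True) \<or> z (j, i) = (True, False)"
  by (cases "z (i, j)"; cases "z (j, i)") (force simp: wins_def to_data_def)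

lemma outcomes_support:
  assumes "z \<in> set_pmf (outcomes_pmf F n p \<theta>)" "e \<notin> item_pairs n"
  shows "z e = (False, False)"
  using assms set_Pi_pmf_subset[OF finite_item_pairs, of n "(False, False)" "comparison_pmf F p \<theta>"]
  unfolding outcomes_pmf_def by blast

lemma to_data_in_data_sets:
  assumes "z \<in> set_pmf (outcomes_pmf F n p \<theta>)"
  shows "to_data z \<in> data_sets n"
  using outcomes_support[OF assms] by (fastforce simp: to_data_def data_sets_def)

lemma linked_outcomes:
  assumes "z \<in> set_pmf (outcomes_pmf F n p \<theta>)"
  shows "linked (outcome_wins z) i j \<longleftrightarrow> i \<noteq> j \<and> fst (z (upair i j))"
proof -
  have "z (i, j) = (False, False)" if "\<not> i < j" for i j
    using that by (intro outcomes_support[OF assms]) (auto simp: item_pairs_def)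
  from this[of i j] this[of j i] show ?thesis
    by (cases i j rule: linorder_cases; cases "z (i, j)"; cases "z (j, i)")
       (auto simp: linked_def wins_to_data upair_def)
qed

section \<open>Tail bounds for degrees, cuts and scores\<close>

lemma exp_le_quadratic:
  assumes "\<bar>u\<bar> \<le> (1::real)"
  shows "exp u \<le> 1 + u + u\<^sup>2"
proof (cases "0 \<le> u")
  case True
  then show ?thesis using exp_bound[of u] assms by simp
next
  case False
  \<comment> \<open>For negative \<open>u\<close> the bound follows from
    \<open>(1 - v + v\<^sup>2) * (1 + v) = 1 + v ^ 3\<close>, which is at least 1, together with
    \<open>1 + v \<le> exp v\<close>.\<close>
  define v where "v = - u"
  have v: "0 \<le> v" "v \<le> 1" using False assms by (auto simp: v_def)
  have q: "0 < 1 - v + v\<^sup>2"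
  proof -
    have "0 < (v - 1 / 2)\<^sup>2 + 3 / 4" by (intro add_nonneg_pos) auto
    then show ?thesis by (simp add: power2_eq_square algebra_simps)
  qed
  have "1 \<le> 1 + v ^ 3" using v by simp
  also have "1 + v ^ 3 = (1 - v + v\<^sup>2) * (1 + v)"
    by (simp add: power2_eq_square power3_eq_cube algebra_simps)
  also have "\<dots> \<le> (1 - v + v\<^sup>2) * exp v"
    using q exp_ge_add_one_self[of v] by (intro mult_left_mono) auto
  finally have "1 \<le> (1 - v + v\<^sup>2) * exp v" .
  then have "inverse (exp v) \<le> 1 - v + v\<^sup>2"
    by (simp add: field_simps)
  then show ?thesis by (simp add: v_def exp_minus)
qed

context link
begin

lemma nn_integral_comparison_pmf:
  assumes "0 \<le> p" "p \<le> 1" "\<And>v. 0 \<le> g v"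
  shows "(\<integral>\<^sup>+v. ennreal (g v) \<partial>comparison_pmf F p \<theta> e) =
    ennreal (p * (F (\<theta> (fst e) - \<theta> (snd e)) * g (True, True) + (1 - F (\<theta> (fst e) - \<theta> (snd e))) * g (True, False))
      + (1 - p) * g (False, False))"
  using assms F_range[of "\<theta> (fst e) - \<theta> (snd e)"] unfolding comparison_pmf_def
  by (simp add: nn_integral_bind_pmf) (simp flip: ennreal_mult' ennreal_mult'' ennreal_plus add: mult.commute)

lemma nn_integral_comparison_edge:
  assumes "0 \<le> p" "p \<le> 1"
  shows "(\<integral>\<^sup>+v. ennreal (exp (t * of_bool (fst v))) \<partial>comparison_pmf F p \<theta> e) = ennreal (1 + p * (exp t - 1))"
  by (subst nn_integral_comparison_pmf[OF assms]) (simp_all add: algebra_simps)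

text \<open>The multiplier 1 costs \<open>2 * p\<close> per pair because
  \<open>exp 1 - 1 \<le> 2\<close>; the rest \<open>n * p\<close> of the threshold is the exponent
  of the tail.\<close>

lemma degree_event:
  assumes p: "0 \<le> p" "p \<le> 1" and i: "i \<in> {1..n}"
  shows "measure (measure_pmf (outcomes_pmf F n p \<theta>))
    {z. \<not> real (card {j\<in>{1..n}. linked (outcome_wins z) i j}) \<le> 3 * (real n * p)} \<le> exp (- (real n * p))"
proof -
  let ?J = "{1..n} - {i}"
  let ?B = "{z. (\<Sum>j\<in>?J. 2 * p) + real n * p \<le> (\<Sum>j\<in>?J. 1 * of_bool (fst (z (upair i j))))}"
  have B: "measure (measure_pmf (outcomes_pmf F n p \<theta>)) ?B \<le> exp (- (real n * p))"
    unfolding outcomes_pmf_def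
  proof (rule Pi_pmf_chernoff[OF finite_item_pairs])
    fix j assume "j \<in> ?J"
    have "1 + p * (exp 1 - 1) \<le> 1 + p * 2"
      using p exp_le by (intro add_left_mono mult_left_mono) auto
    also have "\<dots> \<le> exp (2 * p)" using exp_ge_add_one_self[of "2 * p"] by linarith
    finally show "(\<integral>\<^sup>+v. ennreal (exp (1 * of_bool (fst v))) \<partial>comparison_pmf F p \<theta> (upair i j)) \<le> ennreal (exp (2 * p))"
      unfolding nn_integral_comparison_edge[OF p] by (rule ennreal_leI)
  qed (rule upair_image[OF i] inj_on_upair)+
  have "z \<in> ?B"
    if z: "z \<in> set_pmf (outcomes_pmf F n p \<theta>)"
      and l: "\<not> real (card {j\<in>{1..n}. linked (outcome_wins z) i j}) \<le> 3 * (real n * p)" for z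
  proof -
    have "(\<Sum>j\<in>?J. 1 * of_bool (fst (z (upair i j)))) = real (card {j\<in>?J. fst (z (upair i j))})"
      by (simp add: Int_def)
    also have "{j\<in>?J. fst (z (upair i j))} = {j\<in>{1..n}. linked (outcome_wins z) i j}"
      by (auto simp: linked_outcomes[OF z])
    finally have "3 * (real n * p) \<le> (\<Sum>j\<in>?J. 1 * of_bool (fst (z (upair i j))))" using l by simp
    moreover have "(\<Sum>j\<in>?J. 2 * p) \<le> 2 * (real n * p)"
      using i p by (simp add: algebra_simps)
    ultimately show ?thesis by simp
  qed
  then show ?thesis by (intro measure_pmf_support_bound[OF B]) (simp only: mem_Collect_eq)
qed

text \<open>A lower tail with multiplier \<open>- 1\<close>. The complement of \<open>S\<close> has
  at least \<open>n / 4\<close> vertices besides \<open>m\<close>, so at least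
  \<open>card S * n / 4\<close> pairs can cross. The bound is geometric in \<open>card S\<close>,
  which later pays for the number of sets of that size.\<close>

lemma cut_event:
  assumes p: "0 \<le> p" "p \<le> 1" and n: "2 \<le> n" and m: "m \<in> {1..n}" and S: "S \<subseteq> {1..n} - {m}" "2 * card S \<le> n - 1"
  shows "measure (measure_pmf (outcomes_pmf F n p \<theta>))
    {z. \<not> real n * p / 16 * real (card S) \<le> real (card {(i, j)\<in>S \<times> ({1..n} - {m} - S). linked (outcome_wins z) i j})}
      \<le> exp (- (real n * p / 16)) ^ card S"
proof -
  let ?J = "S \<times> ({1..n} - {m} - S)"
  let ?\<pi> = "\<lambda>(i, j). upair i j"
  let ?B = "{z. (\<Sum>e\<in>?J. - (p / 2)) + real (card ?J) * (p / 4) \<le> (\<Sum>e\<in>?J. (- 1) * of_bool (fst (z (?\<pi> e))))}"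
  have finS: "finite S" using S(1) finite_subset by blast
  have "real (card ?J) * (p / 4) \<ge> real n * p / 16 * real (card S)"
  proof -
    have "card ({1..n} - {m} - S) = n - 1 - card S"
      using m S(1) finS by (simp add: card_Diff_subset)
    then have "real (card ?J) = real (card S) * (real n - 1 - real (card S))"
      using S(2) n by (simp add: card_cartesian_product of_nat_diff)
    also have "\<dots> \<ge> real (card S) * (real n / 4)"
      using S(2) n by (intro mult_left_mono) auto
    finally have "real (card S) * (real n / 4) * (p / 4) \<le> real (card ?J) * (p / 4)"
      using p by (intro mult_right_mono) auto
    then show ?thesis by (simp add: mult_ac)
  qed
  note J = this
  have "measure (measure_pmf (outcomes_pmf F n p \<theta>)) ?B \<le> exp (- (real (card ?J) * (p / 4)))"
    unfolding outcomes_pmf_def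
  proof (rule Pi_pmf_chernoff[OF finite_item_pairs])
    fix e assume "e \<in> ?J"
    have "exp (- 1) \<le> (1 / 2 :: real)"
      using exp_ge_add_one_self[of "1::real"] by (simp add: exp_minus field_simps)
    then have "1 + p * (exp (- 1) - 1) \<le> 1 + p * (- 1 / 2)"
      using p by (intro add_left_mono mult_left_mono) auto
    also have "\<dots> \<le> exp (- (p / 2))" using exp_ge_add_one_self[of "- (p / 2)"] by simp
    finally show "(\<integral>\<^sup>+v. ennreal (exp ((- 1) * of_bool (fst v))) \<partial>comparison_pmf F p \<theta> (?\<pi> e)) \<le> ennreal (exp (- (p / 2)))"
      unfolding nn_integral_comparison_edge[OF p] by (rule ennreal_leI)
  next
    show "?\<pi> ` ?J \<subseteq> item_pairs n"
    proof (rule image_subsetI)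
      fix e assume "e \<in> ?J"
      then obtain i j where e: "e = (i, j)" "i \<in> S" "j \<in> {1..n}" "j \<notin> S" by blast
      then have "upair i j \<in> item_pairs n"
        using S(1) by (intro upair_in) blast+
      then show "?\<pi> e \<in> item_pairs n" using e(1) by simp
    qed
    show "inj_on ?\<pi> ?J"
      using S(1) by (auto simp: inj_on_def upair_def min_def max_def split: if_splits)
  qed
  also have "\<dots> \<le> exp (real (card S) * (- (real n * p / 16)))"
    using J by (simp add: mult_ac)
  also have "\<dots> = exp (- (real n * p / 16)) ^ card S"
    by (rule exp_of_nat_mult)
  finally have B: "measure (measure_pmf (outcomes_pmf F n p \<theta>)) ?B \<le> exp (- (real n * p / 16)) ^ card S" .
  have "z \<in> ?B"
    if z: "z \<in> set_pmf (outcomes_pmf F n p \<theta>)"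
      and l: "\<not> real n * p / 16 * real (card S) \<le> real (card {(i, j)\<in>?J. linked (outcome_wins z) i j})" for z
  proof -
    have "(\<Sum>e\<in>?J. of_bool (fst (z (?\<pi> e)))) = real (card {e\<in>?J. fst (z (?\<pi> e))})"
      using finS by (simp add: Int_def)
    also have "{e\<in>?J. fst (z (?\<pi> e))} = {(i, j)\<in>?J. linked (outcome_wins z) i j}"
      by (auto simp: linked_outcomes[OF z])
    finally have c: "(\<Sum>e\<in>?J. of_bool (fst (z (?\<pi> e)))) = real (card {(i, j)\<in>?J. linked (outcome_wins z) i j})" .
    have "(\<Sum>e\<in>?J. of_bool (fst (z (?\<pi> e)))) \<le> real (card ?J) * (p / 4)"
      unfolding c using l J by linarith
    moreover have "(\<Sum>e\<in>?J. - (p / 2)) = - 2 * (real (card ?J) * (p / 4))" by simp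
    moreover have "(\<Sum>e\<in>?J. (- 1) * of_bool (fst (z (?\<pi> e)))) = - (\<Sum>e\<in>?J. of_bool (fst (z (?\<pi> e))) :: real)"
      by (simp add: sum_negf)
    ultimately show ?thesis by (simp only: mem_Collect_eq)
  qed
  then show ?thesis by (intro measure_pmf_support_bound[OF B]) (simp only: mem_Collect_eq)
qed

text \<open>The summands are centred by \<open>expected_dloss\<close>, bounded by
  \<open>\<kappa>1\<close>, and nonzero only with probability \<open>p\<close>. With
  \<open>t * \<kappa>1 = sqrt (L / d)\<close> the second order terms add up to at most
  \<open>L\<close>; a deviation of \<open>7 * L\<close> on top of it explains the 8 in the
  threshold.\<close>

lemma score_event:
  assumes p: "0 < p" "p \<le> 1" and i: "i \<in> {1..n}" and L: "0 < L" "L \<le> real n * p"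
  shows "measure (measure_pmf (outcomes_pmf F n p \<theta>))
    {z. \<not> \<bar>score dloss {1..n} (outcome_wins z) \<theta> i\<bar> \<le> 8 * \<kappa>1 * sqrt (real n * p * L)} \<le> 2 * exp (- 7 * L)"
proof -
  let ?J = "{1..n} - {i}"
  let ?D = "outcomes_pmf F n p \<theta>"
  define d where "d = real n * p"
  have d: "0 < d" "L \<le> d" using L by (auto simp: d_def)
  \<comment> \<open>The contribution of the comparison with \<open>j\<close> to the score of
    \<open>i\<close>. Outcomes refer to the increasing pair, so \<open>i\<close> has won exactly if
    \<open>snd v = (i < j)\<close>.\<close>
  define X where "X j v = (if fst v then
      (if snd v = (i < j) then dloss (\<theta> i - \<theta> j) else - dloss (\<theta> j - \<theta> i)) else 0)" for j and v :: "bool \<times> bool"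
  have Xb: "\<bar>X j v\<bar> \<le> \<kappa>1" for j v
    using abs_dloss_le \<kappa>1 by (auto simp: X_def)
  define t where "t = sqrt (L / d) / \<kappa>1"
  have t: "0 < t" "t * \<kappa>1 \<le> 1" "(t * \<kappa>1)\<^sup>2 = L / d"
    using L d \<kappa>1 by (auto simp: t_def)
  have mgf: "(\<integral>\<^sup>+v. ennreal (exp (s * t * X j v)) \<partial>comparison_pmf F p \<theta> (upair i j)) \<le> ennreal (exp (p * (L / d)))"
    if s: "\<bar>s\<bar> = 1" and j: "j \<in> ?J" for s j
  proof -
    define x where "x = \<theta> (fst (upair i j)) - \<theta> (snd (upair i j))"
    have F: "0 \<le> F x" "0 \<le> 1 - F x" using F_range[of x] by auto
    have q: "exp (s * t * X j v) \<le> 1 + s * t * X j v + L / d" for v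
    proof -
      have a: "\<bar>s * t * X j v\<bar> \<le> t * \<kappa>1"
        unfolding abs_mult s using t(1) Xb[of j v] by simp
      have "(s * t * X j v)\<^sup>2 \<le> (t * \<kappa>1)\<^sup>2"
        using a t(1) \<kappa>1 by (intro power2_le_iff_abs_le[THEN iffD2]) auto
      then show ?thesis using exp_le_quadratic[of "s * t * X j v"] a t by linarith
    qed
    have zero: "F x * X j (True, True) + (1 - F x) * X j (True, False) = 0"
    proof (cases "i < j")
      case True
      then show ?thesis using expected_dloss[of x] by (simp add: X_def x_def upair_def)
    next
      case False
      then have "j < i" using j by auto
      then show ?thesis using expected_dloss[of x] by (simp add: X_def x_def upair_def)
    qed
    have "p * (F x * exp (s * t * X j (True, True)) + (1 - F x) * exp (s * t * X j (True, False)))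
      \<le> p * (F x * (1 + s * t * X j (True, True) + L / d) + (1 - F x) * (1 + s * t * X j (True, False) + L / d))"
      by (intro mult_left_mono add_mono q F) (use p in simp)
    moreover have "(1 - p) * exp (s * t * X j (False, False)) = (1 - p) * 1"
      by (simp add: X_def)
    ultimately have "p * (F x * exp (s * t * X j (True, True)) + (1 - F x) * exp (s * t * X j (True, False)))
        + (1 - p) * exp (s * t * X j (False, False))
      \<le> p * (F x * (1 + s * t * X j (True, True) + L / d) + (1 - F x) * (1 + s * t * X j (True, False) + L / d))
        + (1 - p) * 1" by linarith
    also have "\<dots> = 1 + p * (L / d) + p * (s * t) * (F x * X j (True, True) + (1 - F x) * X j (True, False))"
      by (simp add: algebra_simps)
    also have "\<dots> = 1 + p * (L / d)" unfolding zero by simp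
    also have "\<dots> \<le> exp (p * (L / d))" by (rule exp_ge_add_one_self)
    finally show ?thesis
      using p by (subst nn_integral_comparison_pmf) (auto simp: x_def intro!: ennreal_leI)
  qed
  define Z where "Z z = (\<Sum>j\<in>?J. X j (z (upair i j)))" for z
  have tail: "measure (measure_pmf ?D) {z. L + 7 * L \<le> s * t * Z z} \<le> exp (- 7 * L)" if s: "\<bar>s\<bar> = 1" for s
  proof -
    have 1: "measure (measure_pmf ?D) {z. (\<Sum>j\<in>?J. p * (L / d)) + 7 * L \<le> (\<Sum>j\<in>?J. s * t * X j (z (upair i j)))}
        \<le> exp (- (7 * L))"
      unfolding outcomes_pmf_def
      by (rule Pi_pmf_chernoff[OF finite_item_pairs]) (rule upair_image[OF i] inj_on_upair mgf[OF s]; assumption)+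
    have "(\<Sum>j\<in>?J. p * (L / d)) \<le> L"
    proof -
      have "(\<Sum>j\<in>?J. p * (L / d)) \<le> (\<Sum>j\<in>{1..n}. p * (L / d))"
        using p L d by (intro sum_mono2) auto
      also have "\<dots> = L" using d(1) by (auto simp: d_def)
      finally show ?thesis .
    qed
    then have "(\<Sum>j\<in>?J. p * (L / d)) + 7 * L \<le> (\<Sum>j\<in>?J. s * t * X j (z (upair i j)))"
      if "L + 7 * L \<le> s * t * Z z" for z
      using that unfolding Z_def sum_distrib_left by linarith
    then show ?thesis by (intro measure_pmf_support_bound[OF 1[unfolded minus_mult_left]]) (simp only: mem_Collect_eq)
  qed
  have sc: "score dloss {1..n} (outcome_wins z) \<theta> i = Z z" if z: "z \<in> set_pmf ?D" for z
  proof -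
    have o: "z (a, b) = (False, False)" if "\<not> a < b" for a b
      using that by (intro outcomes_support[OF z]) (auto simp: item_pairs_def)
    have "(if (i, j) \<in> outcome_wins z then dloss (\<theta> i - \<theta> j) else 0)
        - (if (j, i) \<in> outcome_wins z then dloss (\<theta> j - \<theta> i) else 0) = (if j = i then 0 else X j (z (upair i j)))" for j
      using o[of i j] o[of j i]
      by (cases i j rule: linorder_cases; cases "z (i, j)"; cases "z (j, i)")
         (auto simp: wins_to_data upair_def X_def)
    then have "score dloss {1..n} (outcome_wins z) \<theta> i = (\<Sum>j\<in>{1..n}. if j = i then 0 else X j (z (upair i j)))"
      unfolding score_def by simp
    also have "\<dots> = Z z"
      unfolding Z_def by (intro sum.mono_neutral_cong_right) auto
    finally show ?thesis .
  qed
  have key: "8 * \<kappa>1 * sqrt (real n * p * L) * t = L + 7 * L"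
  proof -
    have "sqrt (d * L) * sqrt (L / d) = sqrt ((d * L) * (L / d))" by (rule real_sqrt_mult[symmetric])
    also have "(d * L) * (L / d) = L\<^sup>2" using d by (simp add: power2_eq_square)
    finally have "sqrt (d * L) * sqrt (L / d) = L" using L by simp
    then show ?thesis unfolding t_def d_def[symmetric] using \<kappa>1 by simp
  qed
  have "measure (measure_pmf ?D) ({z. L + 7 * L \<le> 1 * t * Z z} \<union> {z. L + 7 * L \<le> (- 1) * t * Z z})
      \<le> exp (- 7 * L) + exp (- 7 * L)"
    by (intro order_trans[OF measure_Un_le] add_mono tail) auto
  then show ?thesis
  proof (rule measure_pmf_support_bound[THEN order_trans])
    fix z assume z: "z \<in> set_pmf ?D"
      and "z \<in> {z. \<not> \<bar>score dloss {1..n} (outcome_wins z) \<theta> i\<bar> \<le> 8 * \<kappa>1 * sqrt (real n * p * L)}"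
    then have "8 * \<kappa>1 * sqrt (real n * p * L) \<le> \<bar>Z z\<bar>" using sc[OF z] by simp
    then have "8 * \<kappa>1 * sqrt (real n * p * L) * t \<le> \<bar>Z z\<bar> * t" using t by (intro mult_right_mono) auto
    then have "L + 7 * L \<le> \<bar>Z z\<bar> * t" unfolding key .
    then show "z \<in> {z. L + 7 * L \<le> 1 * t * Z z} \<union> {z. L + 7 * L \<le> (- 1) * t * Z z}"
      by (cases "0 \<le> Z z") (simp_all add: mult.commute)
  qed simp
qed

end

section \<open>Conditioning on the comparisons away from one vertex\<close>

lemma foc_cong:
  assumes "\<And>i j. i \<in> U \<Longrightarrow> j \<in> U \<Longrightarrow> (i, j) \<in> W \<longleftrightarrow> (i, j) \<in> W'"
  shows "foc \<psi> U W \<gamma> w = foc \<psi> U W' \<gamma> w"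
proof
  fix \<theta>
  have "score \<psi> U W \<theta> k = score \<psi> U W' \<theta> k" if "k \<in> U" for k
    unfolding score_def using assms that by (intro sum.cong) auto
  then show "foc \<psi> U W \<gamma> w \<theta> = foc \<psi> U W' \<gamma> w \<theta>"
    by (simp add: foc_def)
qed

text \<open>Conditioning on the independent second component: a bound valid for each of its values
  survives averaging.\<close>

lemma measure_map_pair_pmf_le:
  assumes "\<And>y. measure (measure_pmf P) {x. h (x, y) \<in> S} \<le> c" and "0 \<le> c"
  shows "measure (measure_pmf (map_pmf h (pair_pmf P Q))) S \<le> c"
proof -
  have "map_pmf h (pair_pmf P Q) = bind_pmf Q (\<lambda>y. map_pmf (\<lambda>x. h (x, y)) P)"
    unfolding pair_pmf_def map_bind_pmf map_return_pmf map_pmf_def[of _ P]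
    by (rule bind_commute_pmf)
  then have "emeasure (measure_pmf (map_pmf h (pair_pmf P Q))) S = (\<integral>\<^sup>+y. emeasure (measure_pmf P) {x. h (x, y) \<in> S} \<partial>Q)"
    by (simp add: vimage_def)
  also have "\<dots> \<le> (\<integral>\<^sup>+y. ennreal c \<partial>Q)"
    using assms by (intro nn_integral_mono) (simp add: measure_pmf.emeasure_eq_measure)
  also have "\<dots> = ennreal c" by simp
  finally show ?thesis using assms(2) by (simp add: measure_pmf.emeasure_eq_measure)
qed

lemma exp_le_linear:
  assumes "0 \<le> u" "u \<le> (1::real)"
  shows "exp u \<le> 1 + 2 * u"
proof -
  have "u * u \<le> u * 1" using assms by (intro mult_left_mono)
  then show ?thesis using exp_bound[OF assms] by (simp add: power2_eq_square)
qed

context link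
begin

text \<open>\<open>SOME\<close> is applied to the predicate itself, so comparison sets with the same
  condition on \<open>{1..n} - {m}\<close> give literally the same function. Uniqueness would
  identify only the values on \<open>{1..n} - {m}\<close>.\<close>

definition loo_sol :: "nat \<Rightarrow> nat \<Rightarrow> real \<Rightarrow> (nat \<Rightarrow> real) \<Rightarrow> (nat \<times> nat) set \<Rightarrow> nat \<Rightarrow> real" where
  "loo_sol n m \<gamma> w W = (SOME \<theta>. foc xdloss ({1..n} - {m}) W \<gamma> w \<theta>)"

lemma foc_loo_sol:
  assumes "0 < \<gamma>"
  shows "foc xdloss ({1..n} - {m}) W \<gamma> w (loo_sol n m \<gamma> w W)"
proof -
  let ?U = "{1..n} - {m}"
  have "\<exists>\<theta>. foc xdloss ?U (W \<inter> ?U \<times> ?U) \<gamma> w \<theta>"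
    using assms by (intro ex_foc_xdloss) auto
  moreover have "foc xdloss ?U (W \<inter> ?U \<times> ?U) \<gamma> w = foc xdloss ?U W \<gamma> w"
    by (rule foc_cong) auto
  ultimately show ?thesis unfolding loo_sol_def by (metis someI_ex)
qed

text \<open>\<open>X\<close> ranges over all upper bounds of the errors instead of being their
  maximum, so that any convenient sup bound can be inserted later.\<close>

definition loo_good :: "nat \<Rightarrow> nat \<Rightarrow> real \<Rightarrow> real \<Rightarrow> real \<Rightarrow> (nat \<Rightarrow> real) \<Rightarrow> (nat \<Rightarrow> real) \<Rightarrow> (nat \<times> nat) set \<Rightarrow> bool" where
  "loo_good n m p L \<gamma> w \<theta>0 W \<longleftrightarrow> (\<forall>X. (\<forall>j\<in>{1..n} - {m}. \<bar>loo_sol n m \<gamma> w W j - \<theta>0 j\<bar> \<le> X) \<longrightarrow>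
     (\<Sum>j\<in>{j\<in>{1..n} - {m}. linked W m j}. \<bar>loo_sol n m \<gamma> w W j - \<theta>0 j\<bar>)
       \<le> 2 * p * (\<Sum>j\<in>{1..n} - {m}. \<bar>loo_sol n m \<gamma> w W j - \<theta>0 j\<bar>) + 7 * L * X)"

text \<open>The leave-one-out solution does not depend on the comparisons of \<open>m\<close>, so conditionally on
  the other comparisons the sum over the neighbours of \<open>m\<close> is a sum of independent terms.\<close>

lemma loo_event:
  assumes p: "0 \<le> p" "p \<le> 1" and m: "m \<in> {1..n}" and n: "2 \<le> n" and L: "0 < L"
  shows "measure (measure_pmf (outcomes_pmf F n p \<theta>0))
    {z. \<not> loo_good n m p L \<gamma> w \<theta>0 (outcome_wins z)} \<le> exp (- 7 * L)"
proof -
  let ?U = "{1..n} - {m}"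
  define x where "x z j = \<bar>loo_sol n m \<gamma> w (outcome_wins z) j - \<theta>0 j\<bar>" for z j
  define X where "X z = Max (x z ` ?U)" for z
  have Une: "?U \<noteq> {}"
  proof
    assume "?U = {}"
    then have "card ?U = 0" by (simp only: card.empty)
    moreover have "card ?U = n - 1" using m by simp
    ultimately have "n - 1 = 0" by (simp only:)
    then show False using n by simp
  qed
  have xX: "0 \<le> x z j" "j \<in> ?U \<Longrightarrow> x z j \<le> X z" for z j
    by (auto simp: x_def X_def)
  define bad where "bad = {z. \<not> (\<Sum>j\<in>?U. of_bool (fst (z (upair m j))) * x z j) \<le> 2 * p * (\<Sum>j\<in>?U. x z j) + 7 * L * X z}"
  define A where "A = upair m ` ?U"
  have A: "A \<subseteq> item_pairs n" "finite A"
    unfolding A_def by (rule upair_image[OF m]) simp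
  \<comment> \<open>Merges the comparisons of \<open>m\<close>, drawn as \<open>f\<close>, with all
    the others, drawn as \<open>g\<close>; afterwards \<open>g\<close> is held fixed.\<close>
  define h where "h = (\<lambda>(f, g) e. if e \<in> A then f e else g e :: bool \<times> bool)"
  have split: "outcomes_pmf F n p \<theta>0 = map_pmf h (pair_pmf
      (Pi_pmf A (False, False) (comparison_pmf F p \<theta>0)) (Pi_pmf (item_pairs n - A) (False, False) (comparison_pmf F p \<theta>0)))"
  proof -
    have eq: "A \<union> (item_pairs n - A) = item_pairs n" using A(1) by blast
    show ?thesis
      using Pi_pmf_union[of A "item_pairs n - A" "(False, False)" "comparison_pmf F p \<theta>0"] A(2) finite_item_pairs
      unfolding eq outcomes_pmf_def h_def by simp
  qed
  \<comment> \<open>Resampling the comparisons of \<open>m\<close> does not change the condition on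
    the other vertices, hence not the chosen solution either.\<close>
  have x_h: "x (h (f, g)) = x g" for f g
  proof -
    have "h (f, g) (i, j) = g (i, j)" if "i \<in> ?U" "j \<in> ?U" for i j
      using that by (auto simp: h_def A_def upair_def min_def max_def split: if_splits)
    then have "foc xdloss ?U (outcome_wins (h (f, g))) \<gamma> w = foc xdloss ?U (outcome_wins g) \<gamma> w"
      by (intro foc_cong) (simp add: wins_to_data)
    then show ?thesis unfolding x_def loo_sol_def by simp
  qed
  have "measure (measure_pmf (outcomes_pmf F n p \<theta>0)) bad \<le> exp (- (7 * L))"
    unfolding split
  proof (rule measure_map_pair_pmf_le)
    fix g
    let ?P = "Pi_pmf A (False, False) (comparison_pmf F p \<theta>0)"
    have hA: "h (f, g) (upair m j) = f (upair m j)" if "j \<in> ?U" for f j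
      using that by (auto simp: h_def A_def)
    have b: "h (f, g) \<in> bad \<longleftrightarrow>
        \<not> (\<Sum>j\<in>?U. of_bool (fst (f (upair m j))) * x g j) \<le> 2 * p * (\<Sum>j\<in>?U. x g j) + 7 * L * X g" for f
    proof -
      have "(\<Sum>j\<in>?U. of_bool (fst (h (f, g) (upair m j))) * x (h (f, g)) j) = (\<Sum>j\<in>?U. of_bool (fst (f (upair m j))) * x g j)"
        by (intro sum.cong refl) (simp add: hA x_h)
      then show ?thesis unfolding bad_def mem_Collect_eq X_def x_h by (simp only:)
    qed
    show "measure (measure_pmf ?P) {f. h (f, g) \<in> bad} \<le> exp (- (7 * L))"
    proof (cases "X g = 0")
      case True
      then have "x g j = 0" if "j \<in> ?U" for j
        using xX(1)[of g j] xX(2)[OF that, of g] by linarith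
      then have "{f. h (f, g) \<in> bad} = {}" unfolding b using True by simp
      then show ?thesis by simp
    next
      case False
      obtain j where "j \<in> ?U" using Une by blast
      then have X0: "0 < X g" using xX(1)[of g j] xX(2)[of j g] False by linarith
      \<comment> \<open>Division by the maximum brings the weights into \<open>[0, 1]\<close>, where
        \<open>exp u \<le> 1 + 2 * u\<close>; this is the source of the factor 2 before
        \<open>p\<close>.\<close>
      have "measure (measure_pmf ?P) {f. (\<Sum>j\<in>?U. 2 * p * (x g j / X g)) + 7 * L
          \<le> (\<Sum>j\<in>?U. x g j / X g * of_bool (fst (f (upair m j))))} \<le> exp (- (7 * L))"
      proof (rule Pi_pmf_chernoff[OF A(2)])
        fix j assume j: "j \<in> ?U"
        have u: "0 \<le> x g j / X g" "x g j / X g \<le> 1" using xX(1)[of g j] xX(2)[OF j, of g] X0 by auto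
        have "1 + p * (exp (x g j / X g) - 1) \<le> 1 + p * (2 * (x g j / X g))"
          using exp_le_linear[OF u] p by (intro add_left_mono mult_left_mono) auto
        also have "\<dots> \<le> exp (2 * p * (x g j / X g))"
          using exp_ge_add_one_self[of "2 * p * (x g j / X g)"] by (simp add: mult_ac)
        finally show "(\<integral>\<^sup>+v. ennreal (exp (x g j / X g * of_bool (fst v))) \<partial>comparison_pmf F p \<theta>0 (upair m j))
            \<le> ennreal (exp (2 * p * (x g j / X g)))"
          unfolding nn_integral_comparison_edge[OF p] by (rule ennreal_leI)
      qed (simp_all add: A_def inj_on_upair)
      then show ?thesis
      proof (rule measure_pmf_support_bound)
        fix f assume "f \<in> {f. h (f, g) \<in> bad}"
        then have "2 * p * (\<Sum>j\<in>?U. x g j) + 7 * L * X g \<le> (\<Sum>j\<in>?U. of_bool (fst (f (upair m j))) * x g j)"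
          by (simp add: b)
        then have "(2 * p * (\<Sum>j\<in>?U. x g j) + 7 * L * X g) / X g \<le> (\<Sum>j\<in>?U. of_bool (fst (f (upair m j))) * x g j) / X g"
          using X0 by (intro divide_right_mono) auto
        moreover have "(2 * p * (\<Sum>j\<in>?U. x g j) + 7 * L * X g) / X g = (\<Sum>j\<in>?U. 2 * p * (x g j / X g)) + 7 * L"
          using X0 by (simp add: add_divide_distrib sum_divide_distrib sum_distrib_left)
        moreover have "(\<Sum>j\<in>?U. of_bool (fst (f (upair m j))) * x g j) / X g = (\<Sum>j\<in>?U. x g j / X g * of_bool (fst (f (upair m j))))"
          unfolding sum_divide_distrib by (intro sum.cong refl) (simp add: mult.commute)
        ultimately show "f \<in> {f. (\<Sum>j\<in>?U. 2 * p * (x g j / X g)) + 7 * L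
          \<le> (\<Sum>j\<in>?U. x g j / X g * of_bool (fst (f (upair m j))))}" by (simp only: mem_Collect_eq)
      qed
    qed
  qed simp
  then have B: "measure (measure_pmf (outcomes_pmf F n p \<theta>0)) bad \<le> exp (- 7 * L)" by simp
  show ?thesis
  proof (rule measure_pmf_support_bound[OF B])
    fix z assume z: "z \<in> set_pmf (outcomes_pmf F n p \<theta>0)"
      and "z \<in> {z. \<not> loo_good n m p L \<gamma> w \<theta>0 (outcome_wins z)}"
    then obtain Y where Y: "\<And>j. j \<in> ?U \<Longrightarrow> x z j \<le> Y"
      "\<not> (\<Sum>j\<in>{j\<in>?U. linked (outcome_wins z) m j}. x z j) \<le> 2 * p * (\<Sum>j\<in>?U. x z j) + 7 * L * Y"
      unfolding loo_good_def x_def[symmetric] by blast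
    have "X z \<le> Y" unfolding X_def using Y(1) Une by simp
    then have "7 * L * X z \<le> 7 * L * Y" using L by simp
    moreover have "(\<Sum>j\<in>{j\<in>?U. linked (outcome_wins z) m j}. x z j) = (\<Sum>j\<in>?U. of_bool (fst (z (upair m j))) * x z j)"
      by (intro sum.mono_neutral_cong_left) (auto simp: linked_outcomes[OF z])
    ultimately show "z \<in> bad" using Y(2) unfolding bad_def by auto
  qed
qed

section \<open>Union bound over the data events\<close>

definition good_data :: "nat \<Rightarrow> real \<Rightarrow> real \<Rightarrow> (nat \<Rightarrow> real) \<Rightarrow> (nat \<Rightarrow> real) \<Rightarrow> (nat \<times> nat) set \<Rightarrow> bool" where
  "good_data n p \<gamma> w \<theta>0 W \<longleftrightarrow>
     (\<forall>i\<in>{1..n}. real (card {j\<in>{1..n}. linked W i j}) \<le> 3 * (real n * p)) \<and>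
     (\<forall>i\<in>{1..n}. \<bar>score dloss {1..n} W \<theta>0 i\<bar> \<le> 8 * \<kappa>1 * sqrt (real n * p * ln (real n))) \<and>
     (\<forall>m\<in>{1..n}. loo_good n m p (ln (real n)) \<gamma> w \<theta>0 W) \<and>
     (\<forall>m\<in>{1..n}. \<forall>S\<in>{S. S \<subseteq> {1..n} - {m} \<and> S \<noteq> {} \<and> 2 * card S \<le> n - 1}.
       real n * p / 16 * real (card S) \<le> real (card {(i, j)\<in>S \<times> ({1..n} - {m} - S). linked W i j}))"

text \<open>As 112 = 16 * 7, the hypothesis makes \<open>exp (- (n * p / 16))\<close> at most
  \<open>1 / n ^ 7\<close>. Degrees, scores and neighbour sums cost 1 + 2 + 1 times
  \<open>n / n ^ 7\<close>; the cuts for all \<open>m\<close> cost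
  \<open>2 * n\<^sup>2 / n ^ 7\<close> and determine the order \<open>1 / n ^ 5\<close>.\<close>

lemma good_data_prob:
  assumes p: "0 < p" "p \<le> 1" and n: "3 \<le> n" and L: "112 * ln (real n) \<le> real n * p"
  shows "measure (measure_pmf (outcomes_pmf F n p \<theta>0))
    {z. \<not> good_data n p \<gamma> w \<theta>0 (outcome_wins z)} \<le> 6 / real n ^ 5"
proof -
  let ?D = "measure_pmf (outcomes_pmf F n p \<theta>0)" and ?V = "{1..n}" and ?L = "ln (real n)"
  let ?SS = "\<lambda>m. {S. S \<subseteq> ?V - {m} \<and> S \<noteq> {} \<and> 2 * card S \<le> n - 1}"
  define A1 where "A1 i = {z. \<not> real (card {j\<in>{1..n}. linked (outcome_wins z) i j}) \<le> 3 * (real n * p)}" for i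
  define A2 where "A2 i = {z. \<not> \<bar>score dloss {1..n} (outcome_wins z) \<theta>0 i\<bar> \<le> 8 * \<kappa>1 * sqrt (real n * p * ?L)}" for i
  define A3 where "A3 m = {z. \<not> loo_good n m p ?L \<gamma> w \<theta>0 (outcome_wins z)}" for m
  define A4 where "A4 m S = {z. \<not> real n * p / 16 * real (card S) \<le> real (card {(i, j)\<in>S \<times> ({1..n} - {m} - S). linked (outcome_wins z) i j})}" for m S
  have L0: "0 < ?L" using n by simp
  have Ln: "?L \<le> real n * p" "7 * ?L \<le> real n * p / 16" using L L0 by linarith+
  have finSS: "finite (?SS m)" for m by (rule finite_subset[of _ "Pow ?V"]) auto
  define e where "e = exp (- 7 * ?L)"
  have "exp (- 7 * ?L) = inverse (exp (real 7 * ?L))" by (simp add: exp_minus)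
  also have "exp (real 7 * ?L) = real n ^ 7" unfolding exp_of_nat_mult using n by simp
  finally have e: "e = 1 / real n ^ 7" by (simp add: e_def inverse_eq_divide)
  have e0: "0 < e" by (simp add: e_def)
  have u1: "measure ?D (\<Union>i\<in>?V. A1 i) \<le> real n * e"
  proof -
    have "measure ?D (\<Union>i\<in>?V. A1 i) \<le> (\<Sum>i\<in>?V. measure ?D (A1 i))"
      by (intro measure_UNION_le) auto
    also have "\<dots> \<le> (\<Sum>i\<in>?V. e)"
    proof (intro sum_mono)
      fix i assume "i \<in> ?V"
      then have "measure ?D (A1 i) \<le> exp (- (real n * p))"
        unfolding A1_def using p by (intro degree_event) auto
      also have "\<dots> \<le> e" unfolding e_def using L L0 by simp
      finally show "measure ?D (A1 i) \<le> e" .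
    qed
    finally show ?thesis by simp
  qed
  have u2: "measure ?D (\<Union>i\<in>?V. A2 i) \<le> 2 * (real n * e)"
  proof -
    have "measure ?D (\<Union>i\<in>?V. A2 i) \<le> (\<Sum>i\<in>?V. measure ?D (A2 i))"
      by (intro measure_UNION_le) auto
    also have "\<dots> \<le> (\<Sum>i\<in>?V. 2 * e)"
      unfolding A2_def e_def by (intro sum_mono score_event[OF p] L0 Ln(1))
    finally show ?thesis by simp
  qed
  have u3: "measure ?D (\<Union>i\<in>?V. A3 i) \<le> real n * e"
  proof -
    have "measure ?D (\<Union>i\<in>?V. A3 i) \<le> (\<Sum>i\<in>?V. measure ?D (A3 i))"
      by (intro measure_UNION_le) auto
    also have "\<dots> \<le> (\<Sum>i\<in>?V. e)"
      unfolding A3_def e_def using p n L0 by (intro sum_mono loo_event) auto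
    finally show ?thesis by simp
  qed
  have u4: "measure ?D (\<Union>m\<in>?V. \<Union>S\<in>?SS m. A4 m S) \<le> real n * (2 * (real n * e))"
  proof -
    define q where "q = exp (- (real n * p / 16))"
    have q: "0 \<le> q" "q \<le> e" unfolding q_def e_def using Ln by auto
    have "real n * q \<le> real n * (1 / real n ^ 7)" using q(2) e by (intro mult_left_mono) auto
    also have "\<dots> = 1 / real n ^ 6" using n by (simp add: field_simps power_eq_if)
    also have "\<dots> \<le> 1" using n by simp
    finally have nq: "real n * q \<le> 1" .
    have "measure ?D (\<Union>S\<in>?SS m. A4 m S) \<le> 2 * (real n * e)" if m: "m \<in> ?V" for m
    proof -
      have "measure ?D (\<Union>S\<in>?SS m. A4 m S) \<le> (\<Sum>S\<in>?SS m. measure ?D (A4 m S))"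
        by (intro measure_UNION_le finSS) auto
      also have "\<dots> \<le> (\<Sum>S\<in>?SS m. q ^ card S)"
        unfolding A4_def q_def using p n m by (intro sum_mono cut_event) auto
      also have "\<dots> \<le> (\<Sum>S\<in>Pow ?V - {{}}. q ^ card S)"
        using q by (intro sum_mono2) auto
      also have "\<dots> = (\<Sum>S\<in>Pow ?V. q ^ card S) - 1"
        by (subst sum_diff1) auto
      \<comment> \<open>The binomial theorem over subsets: all nonempty \<open>S\<close> together
        cost \<open>(1 + q) ^ n - 1\<close>, which is at most \<open>2 * n * q\<close> because
        \<open>n * q \<le> 1\<close>.\<close>
      also have "(\<Sum>S\<in>Pow ?V. q ^ card S) = (q + 1) ^ n"
        using prod_add[of ?V "\<lambda>_. q" "\<lambda>_. 1"] by simp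
      also have "(q + 1) ^ n \<le> exp q ^ n"
        using q exp_ge_add_one_self[of q] by (intro power_mono) linarith+
      also have "exp q ^ n = exp (real n * q)" by (rule exp_of_nat_mult[symmetric])
      also have "exp (real n * q) \<le> 1 + 2 * (real n * q)"
        using nq q by (intro exp_le_linear) auto
      also have "1 + 2 * (real n * q) - 1 \<le> 2 * (real n * e)"
        using q by (simp add: mult_left_mono)
      finally show ?thesis by simp
    qed
    then have "(\<Sum>m\<in>?V. measure ?D (\<Union>S\<in>?SS m. A4 m S)) \<le> (\<Sum>m\<in>?V. 2 * (real n * e))"
      by (intro sum_mono)
    moreover have "measure ?D (\<Union>m\<in>?V. \<Union>S\<in>?SS m. A4 m S) \<le> (\<Sum>m\<in>?V. measure ?D (\<Union>S\<in>?SS m. A4 m S))"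
      by (intro measure_UNION_le) auto
    ultimately show ?thesis by simp
  qed
  have sub: "{z. \<not> good_data n p \<gamma> w \<theta>0 (outcome_wins z)} \<subseteq>
    ((\<Union>i\<in>?V. A1 i) \<union> (\<Union>i\<in>?V. A2 i)) \<union> ((\<Union>i\<in>?V. A3 i) \<union> (\<Union>m\<in>?V. \<Union>S\<in>?SS m. A4 m S))"
    unfolding good_data_def A1_def A2_def A3_def A4_def by blast
  have "measure ?D {z. \<not> good_data n p \<gamma> w \<theta>0 (outcome_wins z)} \<le>
     measure ?D (((\<Union>i\<in>?V. A1 i) \<union> (\<Union>i\<in>?V. A2 i)) \<union> ((\<Union>i\<in>?V. A3 i) \<union> (\<Union>m\<in>?V. \<Union>S\<in>?SS m. A4 m S)))"
    by (intro measure_pmf.finite_measure_mono sub) simp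
  also have "\<dots> \<le> (measure ?D (\<Union>i\<in>?V. A1 i) + measure ?D (\<Union>i\<in>?V. A2 i))
      + (measure ?D (\<Union>i\<in>?V. A3 i) + measure ?D (\<Union>m\<in>?V. \<Union>S\<in>?SS m. A4 m S))"
    by (intro order_trans[OF measure_Un_le] add_mono measure_Un_le) auto
  also have "\<dots> \<le> 4 * (real n * e) + 2 * (real n * (real n * e))"
    using u1 u2 u3 u4 by linarith
  also have "\<dots> \<le> 4 * (real n * (real n * e)) + 2 * (real n * (real n * e))"
    using n e0 by simp
  also have "real n * (real n * e) = 1 / real n ^ 5"
    unfolding e using n by (simp add: field_simps power_eq_if)
  finally show ?thesis by simp
qed

end

subsection \<open>Bi-Lipschitz maps and Laplace noise\<close>

lemma interval_measure_eqI:
  assumes mono: "\<And>x y. x \<le> y \<Longrightarrow> G x \<le> G y" and cont: "\<And>a. isCont G a"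
    and sets: "sets M = sets borel" and Ioc: "\<And>a b. a \<le> b \<Longrightarrow> emeasure M {a<..b} = ennreal (G b - G a)"
  shows "M = interval_measure G"
proof (rule measure_eqI_generator_eq[where \<Omega> = UNIV and A = "\<lambda>n. {- real n<..real n}"
      and E = "range (\<lambda>(a, b). {a<..b::real})"])
  show "Int_stable (range (\<lambda>(a, b). {a<..b::real}))"
    by (force simp: Int_stable_def intro!: image_eqI[where x = "(max _ _, min _ _)"])
  have cr: "continuous (at_right a) G" for a
    using cont[of a] by (simp add: continuous_at_imp_continuous_at_within)
  show "emeasure M X = emeasure (interval_measure G) X" if "X \<in> range (\<lambda>(a, b). {a<..b})" for X
  proof -
    from that obtain ab where "X = (case ab of (a, b) \<Rightarrow> {a<..b})" by (rule rangeE)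
    then obtain a b where X: "X = {a<..b}" by (cases ab) simp
    show ?thesis
      unfolding X using Ioc[of a b] emeasure_interval_measure_Ioc[of a b G, OF _ mono cr] by (cases "a \<le> b") auto
  qed
  have "sets (borel :: real measure) = sigma_sets UNIV (range (\<lambda>(a, b). {a<..b::real}))"
    by (subst borel_sigma_sets_Ioc) simp
  then show "sets M = sigma_sets UNIV (range (\<lambda>(a, b). {a<..b::real}))"
    "sets (interval_measure G) = sigma_sets UNIV (range (\<lambda>(a, b). {a<..b::real}))"
    using sets by simp_all
  show "(\<Union>n. {- real n<..real n}) = UNIV"
  proof (intro equalityI subsetI UNIV_I)
    fix x :: real
    obtain n where "\<bar>x\<bar> < real n" using reals_Archimedean2 by blast
    then show "x \<in> (\<Union>n. {- real n<..real n})" by (intro UN_I[of n]) (auto simp: abs_less_iff)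
  qed
  show "emeasure M {- real n<..real n} \<noteq> \<infinity>" for n
    using Ioc[of "- real n" "real n"] by simp
qed auto

text \<open>If the increments of \<open>G\<close> are dominated by those of \<open>H\<close>, then
  \<open>H - G\<close> is again a distribution function, and its measure added to that of
  \<open>G\<close> is the measure of \<open>H\<close>. This lifts the comparison from intervals to
  all Borel sets.\<close>

lemma interval_measure_mono:
  assumes G: "\<And>x y. x \<le> y \<Longrightarrow> G x \<le> G y" "\<And>a. isCont G a"
    and H: "\<And>x y. x \<le> y \<Longrightarrow> G y - G x \<le> H y - H x" "\<And>a. isCont H a"
    and A: "A \<in> sets borel"
  shows "emeasure (interval_measure G) A \<le> emeasure (interval_measure H) A"
proof -
  define D where "D x = H x - G x" for x
  have D_eq: "D = (\<lambda>x. H x - G x)" by (simp add: D_def fun_eq_iff)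
  have D: "x \<le> y \<Longrightarrow> D x \<le> D y" "isCont D a" for x y a
    using H(1)[of x y] G(2)[of a] H(2)[of a] unfolding D_eq by (auto intro!: continuous_intros)
  have cr: "continuous (at_right a) G" "continuous (at_right a) D" for a
    using G(2)[of a] D(2)[of a] by (simp_all add: continuous_at_imp_continuous_at_within)
  define N where "N = measure_of UNIV (sets (borel :: real measure))
      (\<lambda>A. emeasure (interval_measure G) A + emeasure (interval_measure D) A)"
  have N: "emeasure N A = emeasure (interval_measure G) A + emeasure (interval_measure D) A"
    if "A \<in> sets borel" for A
  proof (rule emeasure_measure_of[OF N_def])
    show "positive (sets N) (\<lambda>A. emeasure (interval_measure G) A + emeasure (interval_measure D) A)"
      by (simp add: positive_def)
    show "countably_additive (sets N) (\<lambda>A. emeasure (interval_measure G) A + emeasure (interval_measure D) A)"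
    proof (rule countably_additiveI)
      fix B :: "nat \<Rightarrow> real set"
      assume B: "range B \<subseteq> sets N" "disjoint_family B"
      have sN: "sets N = sets borel"
        unfolding N_def by (subst sets_measure_of) (auto simp: sets.sigma_sets_eq[of borel, simplified])
      have *: "(\<Sum>i. emeasure (interval_measure K) (B i)) = emeasure (interval_measure K) (\<Union>i. B i)" for K
        using B sN by (intro suminf_emeasure) auto
      show "(\<Sum>i. emeasure (interval_measure G) (B i) + emeasure (interval_measure D) (B i)) =
         emeasure (interval_measure G) (\<Union>i. B i) + emeasure (interval_measure D) (\<Union>i. B i)"
        by (subst suminf_add[symmetric]) (simp_all add: *)
    qed
    show "A \<in> sets N"
      unfolding N_def using that by (subst sets_measure_of) (auto simp: sets.sigma_sets_eq[of borel, simplified])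
  qed auto
  have "N = interval_measure H"
  proof (rule interval_measure_eqI)
    show "H x \<le> H y" if "x \<le> y" for x y using G(1)[OF that] H(1)[OF that] by linarith
    show "sets N = sets borel"
      unfolding N_def by (subst sets_measure_of) (auto simp: sets.sigma_sets_eq[of borel, simplified])
    show "emeasure N {a<..b} = ennreal (H b - H a)" if "a \<le> b" for a b
    proof -
      have "emeasure (interval_measure G) {a<..b} = ennreal (G b - G a)"
        "emeasure (interval_measure D) {a<..b} = ennreal (D b - D a)"
        by (rule emeasure_interval_measure_Ioc[OF that G(1) cr(1)] emeasure_interval_measure_Ioc[OF that D(1) cr(2)]; assumption)+
      then have "emeasure N {a<..b} = ennreal (G b - G a) + ennreal (D b - D a)" by (simp add: N)
      also have "\<dots> = ennreal ((G b - G a) + (D b - D a))"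
        using G(1)[OF that] D(1)[OF that] by (intro ennreal_plus[symmetric]) auto
      also have "(G b - G a) + (D b - D a) = H b - H a" by (simp add: D_def)
      finally show ?thesis .
    qed
  qed (fact H)
  then show ?thesis using N[OF A] by simp
qed

lemma lborel_eq_interval_measure: "lborel = interval_measure (\<lambda>x. x)"
  by (rule interval_measure_eqI) auto

text \<open>A bi-Lipschitz map of the line changes Lebesgue integrals by at most its Lipschitz constants;
  comparing distribution functions avoids any differentiability assumption.\<close>

lemma nn_integral_bilipschitz:
  fixes \<tau> :: "real \<Rightarrow> real"
  assumes K: "1 \<le> K" and lo: "\<And>x y. x \<le> y \<Longrightarrow> y - x \<le> \<tau> y - \<tau> x"
    and hi: "\<And>x y. x \<le> y \<Longrightarrow> \<tau> y - \<tau> x \<le> K * (y - x)"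
    and g[measurable]: "g \<in> borel_measurable borel"
  shows "(\<integral>\<^sup>+t. g (\<tau> t) \<partial>lborel) \<le> (\<integral>\<^sup>+t. g t \<partial>lborel)"
    and "(\<integral>\<^sup>+t. g t \<partial>lborel) \<le> ennreal K * (\<integral>\<^sup>+t. g (\<tau> t) \<partial>lborel)"
proof -
  have abs: "\<bar>\<tau> y - \<tau> x\<bar> \<le> K * \<bar>y - x\<bar>" "\<bar>y - x\<bar> \<le> \<bar>\<tau> y - \<tau> x\<bar>" for x y
    using lo[of x y] lo[of y x] hi[of x y] hi[of y x] by (cases "x \<le> y"; simp)+
  have cont: "isCont \<tau> x" for x
  proof -
    have "((\<lambda>y. \<tau> y - \<tau> x) \<longlongrightarrow> 0) (at x)"
    proof (rule Lim_null_comparison)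
      show "\<forall>\<^sub>F y in at x. norm (\<tau> y - \<tau> x) \<le> K * \<bar>y - x\<bar>" using abs by simp
      have "((\<lambda>y. K * \<bar>y - x\<bar>) \<longlongrightarrow> K * \<bar>x - x\<bar>) (at x)" by (intro tendsto_intros)
      then show "((\<lambda>y. K * \<bar>y - x\<bar>) \<longlongrightarrow> 0) (at x)" by simp
    qed
    then show ?thesis by (simp add: isCont_def LIM_zero_iff)
  qed
  have inj: "inj \<tau>" using abs(2) by (metis injI abs_0 abs_le_zero_iff diff_self eq_iff_diff_eq_0)
  have surj: "surj \<tau>"
    unfolding surj_def
  proof
    fix y
    define a where "a = \<bar>y - \<tau> 0\<bar>"
    have "\<tau> (- a) \<le> y" "y \<le> \<tau> a"
      using lo[of "- a" 0] lo[of 0 a] by (auto simp: a_def abs_if split: if_splits)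
    then show "\<exists>x. y = \<tau> x" using IVT[of \<tau> "- a" y a] cont by (auto simp: a_def)
  qed
  \<comment> \<open>The image of Lebesgue measure under \<open>\<tau>\<close> has the inverse
    \<open>\<sigma>\<close> as its distribution function, whose increments lie between
    \<open>1 / K\<close> and 1 times those of the identity.\<close>
  define \<sigma> where "\<sigma> = inv \<tau>"
  have \<tau>\<sigma>: "\<tau> (\<sigma> x) = x" for x unfolding \<sigma>_def using surj by (rule surj_f_inv_f)
  have \<sigma>mono: "\<sigma> x \<le> \<sigma> y" if "x \<le> y" for x y
    using lo[of "\<sigma> y" "\<sigma> x"] that by (simp add: \<tau>\<sigma>) linarith
  have \<sigma>1: "\<sigma> y - \<sigma> x \<le> y - x" "y - x \<le> K * (\<sigma> y - \<sigma> x)" if "x \<le> y" for x y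
    using lo[OF \<sigma>mono[OF that]] hi[OF \<sigma>mono[OF that]] by (simp_all add: \<tau>\<sigma>)
  have \<sigma>cont: "isCont \<sigma> x" for x
  proof -
    have "\<bar>\<sigma> y - \<sigma> x\<bar> \<le> \<bar>y - x\<bar>" for y using abs(2)[of "\<sigma> y" "\<sigma> x"] by (simp add: \<tau>\<sigma>)
    then have "\<forall>\<^sub>F y in at x. norm (\<sigma> y - \<sigma> x) \<le> \<bar>y - x\<bar>" by simp
    moreover have "((\<lambda>y. \<bar>y - x\<bar>) \<longlongrightarrow> \<bar>x - x\<bar>) (at x)" by (intro tendsto_intros)
    then have "((\<lambda>y. \<bar>y - x\<bar>) \<longlongrightarrow> 0) (at x)" by simp
    ultimately have "((\<lambda>y. \<sigma> y - \<sigma> x) \<longlongrightarrow> 0) (at x)" by (rule Lim_null_comparison)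
    then show ?thesis by (simp add: isCont_def LIM_zero_iff)
  qed
  have \<tau>m[measurable]: "\<tau> \<in> borel_measurable borel"
    using cont by (intro borel_measurable_continuous_onI continuous_at_imp_continuous_on) auto
  have "{x. a < \<tau> x \<and> \<tau> x \<le> b} = {\<sigma> a<..\<sigma> b}" for a b
  proof -
    have "x \<le> y \<longleftrightarrow> \<tau> x \<le> \<tau> y" for x y
      using lo[of x y] lo[of y x] abs(2)[of x y] by (cases "x \<le> y") auto
    from this[of _ "\<sigma> b"] this[of _ "\<sigma> a"] show ?thesis by (auto simp: \<tau>\<sigma> not_le[symmetric])
  qed
  then have pre: "\<tau> -` {a<..b} = {\<sigma> a<..\<sigma> b}" for a b by (simp add: vimage_def)
  have d: "distr lborel borel \<tau> = interval_measure \<sigma>"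
    by (rule interval_measure_eqI) (auto simp: \<sigma>mono \<sigma>cont emeasure_distr pre)
  have K\<sigma>: "scale_measure (ennreal K) (distr lborel borel \<tau>) = interval_measure (\<lambda>x. K * \<sigma> x)"
  proof (rule interval_measure_eqI)
    show "isCont (\<lambda>x. K * \<sigma> x) a" for a by (intro continuous_intros \<sigma>cont)
    show "emeasure (scale_measure (ennreal K) (distr lborel borel \<tau>)) {a<..b} = ennreal (K * \<sigma> b - K * \<sigma> a)"
      if "a \<le> b" for a b
      using K \<sigma>mono[OF that] by (simp add: emeasure_distr pre right_diff_distrib flip: ennreal_mult)
  qed (use K \<sigma>mono in auto)
  have "distr lborel borel \<tau> \<le> interval_measure (\<lambda>x. x)"
    unfolding d by (subst le_measure) (auto intro!: interval_measure_mono \<sigma>mono \<sigma>1 \<sigma>cont)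
  from nn_integral_mono_measure[OF _ this, of g, folded lborel_eq_interval_measure]
  show "(\<integral>\<^sup>+t. g (\<tau> t) \<partial>lborel) \<le> (\<integral>\<^sup>+t. g t \<partial>lborel)"
    by (simp add: nn_integral_distr)
  have "interval_measure (\<lambda>x. x) \<le> scale_measure (ennreal K) (distr lborel borel \<tau>)"
    unfolding K\<sigma>
    by (subst le_measure)
       (auto intro!: interval_measure_mono continuous_intros \<sigma>cont simp: right_diff_distrib[symmetric] \<sigma>1)
  from nn_integral_mono_measure[OF _ this, of g, folded lborel_eq_interval_measure]
  show "(\<integral>\<^sup>+t. g t \<partial>lborel) \<le> ennreal K * (\<integral>\<^sup>+t. g (\<tau> t) \<partial>lborel)"
    by (simp add: nn_integral_distr nn_integral_scale_measure)
qed

section \<open>Laplace densities and moments\<close>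

definition laplace_density :: "real \<Rightarrow> real \<Rightarrow> real" where
  "laplace_density b x = 1 / (2 * b) * exp (- \<bar>x\<bar> / b)"

lemma laplace_density_measurable[measurable]: "laplace_density b \<in> borel_measurable borel"
  unfolding laplace_density_def by measurable

lemma laplace_eq: "laplace b = density lborel (\<lambda>x. ennreal (laplace_density b x))"
  by (simp add: laplace_def laplace_density_def)

lemma sets_laplace[simp, measurable_cong]: "sets (laplace b) = sets borel"
  by (simp add: laplace_eq)

lemma space_laplace[simp]: "space (laplace b) = UNIV"
  by (simp add: laplace_eq)

lemma nn_integral_exp_half_line:
  assumes "0 < a"
  shows "(\<integral>\<^sup>+x. ennreal (exp (- (a * x))) * indicator {0..} x \<partial>lborel) = ennreal (1 / a)"
proof -
  interpret prob_space "density lborel (exponential_density a)"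
    using assms by (rule prob_space_exponential_density)
  have "1 = (\<integral>\<^sup>+x. ennreal (exponential_density a x) \<partial>lborel)"
    using emeasure_space_1 by (simp add: emeasure_density)
  also have "\<dots> = (\<integral>\<^sup>+x. ennreal a * (ennreal (exp (- (a * x))) * indicator {0..} x) \<partial>lborel)"
    using assms by (intro nn_integral_cong)
      (auto simp: exponential_density_def indicator_def ennreal_mult mult.commute split: split_indicator)
  also have "\<dots> = ennreal a * (\<integral>\<^sup>+x. ennreal (exp (- (a * x))) * indicator {0..} x \<partial>lborel)"
    by (rule nn_integral_cmult) measurable
  finally have *: "ennreal a * (\<integral>\<^sup>+x. ennreal (exp (- (a * x))) * indicator {0..} x \<partial>lborel) = 1" ..
  have "(\<integral>\<^sup>+x. ennreal (exp (- (a * x))) * indicator {0..} x \<partial>lborel)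
      = ennreal (1 / a) * (ennreal a * (\<integral>\<^sup>+x. ennreal (exp (- (a * x))) * indicator {0..} x \<partial>lborel))"
    using assms by (simp add: mult.assoc[symmetric] flip: ennreal_mult)
  then show ?thesis by (simp only: * mult_1_right)
qed

text \<open>Two half-line integrals with rates \<open>1 / b - s\<close> and
  \<open>1 / b + s\<close>, both positive by the hypothesis on \<open>s\<close>. The case
  \<open>s = 0\<close> also gives the normalisation of the density.\<close>

lemma laplace_mgf:
  assumes b: "0 < b" and s: "\<bar>s\<bar> * b < 1"
  shows "(\<integral>\<^sup>+x. ennreal (exp (s * x)) \<partial>laplace b) = ennreal (1 / (1 - (s * b)\<^sup>2))"
proof -
  have s1: "0 < 1 / b - s" "0 < 1 / b + s"
  proof -
    have "\<bar>s * b\<bar> < 1" using b s by (simp add: abs_mult)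
    then have "- 1 < s * b" "s * b < 1" by linarith+
    then show "0 < 1 / b - s" "0 < 1 / b + s" using b by (simp_all add: field_simps)
  qed
  have null: "AE x in lborel. x \<noteq> (0::real)" by (rule AE_lborel_singleton)
  have half: "(\<integral>\<^sup>+x. ennreal (exp (- ((1 / b + s) * x))) * indicator {0..} x \<partial>lborel)
      = (\<integral>\<^sup>+x. ennreal (exp ((1 / b + s) * x)) * indicator {..0} x \<partial>lborel)"
    by (subst nn_integral_real_affine[of _ "-1" 0]) (auto intro!: nn_integral_cong simp: indicator_def)
  have "(\<integral>\<^sup>+x. ennreal (exp (s * x)) \<partial>laplace b)
      = (\<integral>\<^sup>+x. ennreal (laplace_density b x) * ennreal (exp (s * x)) \<partial>lborel)"
    unfolding laplace_eq by (rule nn_integral_density) measurable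
  also have "\<dots> = (\<integral>\<^sup>+x. ennreal (1 / (2 * b)) * (ennreal (exp (- ((1 / b - s) * x))) * indicator {0..} x)
      + ennreal (1 / (2 * b)) * (ennreal (exp ((1 / b + s) * x)) * indicator {..0} x) \<partial>lborel)"
  proof (rule nn_integral_cong_AE, use null in eventually_elim)
    fix x :: real assume "x \<noteq> 0"
    then show "ennreal (laplace_density b x) * ennreal (exp (s * x)) =
      ennreal (1 / (2 * b)) * (ennreal (exp (- ((1 / b - s) * x))) * indicator {0..} x)
      + ennreal (1 / (2 * b)) * (ennreal (exp ((1 / b + s) * x)) * indicator {..0} x)"
      using b unfolding laplace_density_def
      by (cases "0 < x") (auto simp: indicator_def algebra_simps add_divide_distrib simp flip: ennreal_mult exp_add)
  qed
  also have "\<dots> = ennreal (1 / (2 * b)) * ennreal (1 / (1 / b - s)) + ennreal (1 / (2 * b)) * ennreal (1 / (1 / b + s))"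
    by (subst nn_integral_add; (subst nn_integral_cmult)?; measurable?)
       (simp add: nn_integral_cmult nn_integral_exp_half_line[OF s1(1)] nn_integral_exp_half_line[OF s1(2)] flip: half)
  also have "\<dots> = ennreal (1 / (2 * b) * (1 / (1 / b - s)) + 1 / (2 * b) * (1 / (1 / b + s)))"
    using b s1 by (simp flip: ennreal_mult ennreal_plus)
  also have "1 / (2 * b) * (1 / (1 / b - s)) + 1 / (2 * b) * (1 / (1 / b + s)) = 1 / (1 - (s * b)\<^sup>2)"
  proof -
    define u where "u = s * b"
    have e: "1 / b - s = (1 - u) / b" "1 / b + s = (1 + u) / b" using b by (simp_all add: u_def field_simps)
    have p: "0 < 1 - u" "0 < 1 + u" using s1 b unfolding e by (simp_all add: zero_less_divide_iff)
    have "1 / (2 * b) * (1 / (1 / b - s)) + 1 / (2 * b) * (1 / (1 / b + s)) = 1 / (2 * (1 - u)) + 1 / (2 * (1 + u))"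
      unfolding e using b by simp
    also have "\<dots> = ((1 + u) + (1 - u)) / (2 * ((1 - u) * (1 + u)))"
      using p by (simp add: divide_simps) (simp add: algebra_simps)
    also have "\<dots> = 1 / ((1 - u) * (1 + u))" by simp
    also have "(1 - u) * (1 + u) = 1 - u\<^sup>2" by (simp add: power2_eq_square algebra_simps)
    finally show ?thesis by (simp add: u_def)
  qed
  finally show ?thesis .
qed

lemma prob_space_laplace: "0 < b \<Longrightarrow> prob_space (laplace b)"
  using laplace_mgf[of b 0] by (intro prob_spaceI) simp

lemma laplace_density_ratio:
  assumes "0 < b"
  shows "laplace_density b x \<le> exp (\<bar>x - y\<bar> / b) * laplace_density b y"
proof -
  have "- \<bar>x\<bar> / b \<le> \<bar>x - y\<bar> / b + - \<bar>y\<bar> / b"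
    using assms by (subst add_divide_distrib[symmetric]) (intro divide_right_mono, auto)
  then have "exp (- \<bar>x\<bar> / b) \<le> exp (\<bar>x - y\<bar> / b) * exp (- \<bar>y\<bar> / b)" by (simp flip: exp_add)
  then show ?thesis unfolding laplace_density_def using assms by (simp add: field_simps)
qed

text \<open>Writing the second noise coordinate as \<open>s - t\<close> cuts the plane of the
  coordinates \<open>i\<close> and \<open>j\<close> into lines of direction e_i - e_j:
  \<open>s\<close> labels the line and \<open>t\<close> runs along it. The substitution is a shear,
  so no Jacobian appears.\<close>

lemma laplace_noise_two_coordinates:
  fixes f :: "(nat \<Rightarrow> real) \<Rightarrow> ennreal"
  assumes b: "0 < b" and fin: "finite R" and ij: "i \<notin> R" "j \<notin> R" "i \<noteq> j"
    and f[measurable]: "f \<in> borel_measurable (PiM (insert i (insert j R)) (\<lambda>_. borel))"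
  shows "(\<integral>\<^sup>+w. f w \<partial>PiM (insert i (insert j R)) (\<lambda>_. laplace b)) =
    (\<integral>\<^sup>+x. (\<integral>\<^sup>+s. (\<integral>\<^sup>+t. ennreal (laplace_density b t * laplace_density b (s - t)) * f (x(j := s - t, i := t))
       \<partial>lborel) \<partial>lborel) \<partial>PiM R (\<lambda>_. laplace b))"
proof -
  interpret prob_space "laplace b" by (rule prob_space_laplace[OF b])
  interpret product_sigma_finite "\<lambda>_::nat. laplace b" by standard
  have s: "sets (PiM I (\<lambda>_. laplace b)) = sets (PiM I (\<lambda>_. borel))" for I :: "nat set"
    by (intro sets_PiM_cong) auto
  have fm: "f \<in> borel_measurable (PiM (insert i (insert j R)) (\<lambda>_. laplace b))"
    using f by (simp cong: measurable_cong_sets add: measurable_cong_sets[OF s refl])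
  have upd: "(\<lambda>p. x(j := h p, i := k p)) \<in> N \<rightarrow>\<^sub>M PiM (insert i (insert j R)) (\<lambda>_. borel)"
    if "x \<in> space (PiM R (\<lambda>_. laplace b))" and [measurable]: "h \<in> borel_measurable N" "k \<in> borel_measurable N"
    for x h k and N :: "'n measure"
  proof (rule measurable_fun_upd[where J = "insert j R"])
    have "x \<in> space (PiM R (\<lambda>_. borel))" using that(1) by (simp add: space_PiM)
    then show "(\<lambda>p. x(j := h p)) \<in> N \<rightarrow>\<^sub>M PiM (insert j R) (\<lambda>_. borel)"
      by (intro measurable_fun_upd[where J = R]) auto
  qed auto
  let ?r = "\<lambda>x. ennreal (laplace_density b x)"
  have r0: "0 \<le> laplace_density b x" for x using b by (simp add: laplace_density_def)
  have g1: "(\<lambda>y. \<integral>\<^sup>+t. f (y(i := t)) \<partial>laplace b) \<in> borel_measurable (PiM (insert j R) (\<lambda>_. laplace b))"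
    using fm by measurable
  have "(\<integral>\<^sup>+w. f w \<partial>PiM (insert i (insert j R)) (\<lambda>_. laplace b))
      = (\<integral>\<^sup>+x. (\<integral>\<^sup>+u. (\<integral>\<^sup>+t. f (x(j := u, i := t)) \<partial>laplace b) \<partial>laplace b) \<partial>PiM R (\<lambda>_. laplace b))"
    using fin ij by (subst product_nn_integral_insert[OF _ _ fm]) (auto simp: product_nn_integral_insert[OF fin ij(2) g1])
  also have "\<dots> = (\<integral>\<^sup>+x. (\<integral>\<^sup>+s. (\<integral>\<^sup>+t. ennreal (laplace_density b t * laplace_density b (s - t)) * f (x(j := s - t, i := t))
       \<partial>lborel) \<partial>lborel) \<partial>PiM R (\<lambda>_. laplace b))"
  proof (rule nn_integral_cong)
    fix x assume x: "x \<in> space (PiM R (\<lambda>_. laplace b))"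
    note u = upd[OF x]
    have [measurable]: "(\<lambda>(u, t). f (x(j := u, i := t))) \<in> borel_measurable (borel \<Otimes>\<^sub>M borel)"
      unfolding case_prod_beta by (rule measurable_compose[OF u f]) auto
    have [measurable]: "(\<lambda>(s, t). f (x(j := s - t, i := t))) \<in> borel_measurable (borel \<Otimes>\<^sub>M borel)"
      unfolding case_prod_beta by (rule measurable_compose[OF u f]) auto
    have [measurable]: "(\<lambda>t. f (x(j := u, i := t))) \<in> borel_measurable borel" for u
      by (rule measurable_compose[OF u f]) auto
    have [measurable]: "(\<lambda>u. f (x(j := u, i := t))) \<in> borel_measurable borel" for t
      by (rule measurable_compose[OF u f]) auto
    have "(\<integral>\<^sup>+u. (\<integral>\<^sup>+t. f (x(j := u, i := t)) \<partial>laplace b) \<partial>laplace b)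
        = (\<integral>\<^sup>+u. ?r u * (\<integral>\<^sup>+t. ?r t * f (x(j := u, i := t)) \<partial>lborel) \<partial>lborel)"
      unfolding laplace_eq by (simp add: nn_integral_density)
    also have "\<dots> = (\<integral>\<^sup>+u. (\<integral>\<^sup>+t. ?r u * (?r t * f (x(j := u, i := t))) \<partial>lborel) \<partial>lborel)"
      by (intro nn_integral_cong nn_integral_cmult[symmetric]) measurable
    also have "\<dots> = (\<integral>\<^sup>+t. (\<integral>\<^sup>+u. ?r u * (?r t * f (x(j := u, i := t))) \<partial>lborel) \<partial>lborel)"
      by (rule lborel_pair.Fubini') measurable
    also have "\<dots> = (\<integral>\<^sup>+t. (\<integral>\<^sup>+s. ?r (s - t) * (?r t * f (x(j := s - t, i := t))) \<partial>lborel) \<partial>lborel)"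
    proof (rule nn_integral_cong)
      fix t
      have "(\<lambda>u. ?r u * (?r t * f (x(j := u, i := t)))) \<in> borel_measurable borel" by measurable
      from nn_integral_real_affine[OF this, of 1 "- t"]
      show "(\<integral>\<^sup>+u. ?r u * (?r t * f (x(j := u, i := t))) \<partial>lborel)
          = (\<integral>\<^sup>+s. ?r (s - t) * (?r t * f (x(j := s - t, i := t))) \<partial>lborel)" by simp
    qed
    also have "\<dots> = (\<integral>\<^sup>+s. (\<integral>\<^sup>+t. ?r (s - t) * (?r t * f (x(j := s - t, i := t))) \<partial>lborel) \<partial>lborel)"
      by (rule lborel_pair.Fubini') measurable
    also have "\<dots> = (\<integral>\<^sup>+s. (\<integral>\<^sup>+t. ennreal (laplace_density b t * laplace_density b (s - t)) * f (x(j := s - t, i := t))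
       \<partial>lborel) \<partial>lborel)"
      by (intro nn_integral_cong) (simp add: ennreal_mult r0 mult_ac)
    finally show "(\<integral>\<^sup>+u. (\<integral>\<^sup>+t. f (x(j := u, i := t)) \<partial>laplace b) \<partial>laplace b) = \<dots>" .
  qed
  finally show ?thesis .
qed

subsection \<open>Edge privacy\<close>

context link
begin

text \<open>Defined for sets of ordered pairs instead of data sets, because the chain between
  adjacent data sets passes through their common pairs.\<close>

definition pair_est :: "nat set \<Rightarrow> (nat \<times> nat) set \<Rightarrow> real \<Rightarrow> (nat \<Rightarrow> real) \<Rightarrow> (nat \<Rightarrow> real)" where
  "pair_est V W \<gamma> = ridge_min (pair_loss loss W) V \<gamma>"

lemma pair_est:
  assumes "finite V" "W \<subseteq> V \<times> V" "0 < \<gamma>"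
  shows pair_est_in: "pair_est V W \<gamma> w \<in> V \<rightarrow>\<^sub>E UNIV"
    and foc_pair_est: "foc dloss V W \<gamma> w (pair_est V W \<gamma> w)"
    and measurable_pair_est: "pair_est V W \<gamma> \<in> PiM V (\<lambda>_. borel) \<rightarrow>\<^sub>M PiM V (\<lambda>_. borel)"
proof -
  interpret convex_loss "pair_loss loss W" V \<gamma>
    by (rule convex_loss_pairs[OF assms(1,3)])
  show "pair_est V W \<gamma> w \<in> V \<rightarrow>\<^sub>E UNIV"
    unfolding pair_est_def by (rule ridge_min_in)
  show "foc dloss V W \<gamma> w (pair_est V W \<gamma> w)"
    unfolding pair_est_def by (rule foc_ridge_min[OF assms loss_nonneg DERIV_loss mono_dloss])
  show "pair_est V W \<gamma> \<in> PiM V (\<lambda>_. borel) \<rightarrow>\<^sub>M PiM V (\<lambda>_. borel)"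
    unfolding pair_est_def by (rule measurable_ridge_min)
qed

lemma pair_est_eqI:
  assumes "finite V" "W \<subseteq> V \<times> V" "0 < \<gamma>" "\<theta> \<in> V \<rightarrow>\<^sub>E UNIV" "foc dloss V W \<gamma> w \<theta>"
  shows "pair_est V W \<gamma> w = \<theta>"
proof
  fix k
  show "pair_est V W \<gamma> w k = \<theta> k"
    using foc_unique[OF assms(1,2) mono_dloss assms(3) foc_pair_est[OF assms(1-3)] assms(5)]
      pair_est_in[OF assms(1-3), of w] assms(4)
    by (cases "k \<in> V") (auto simp: PiE_def extensional_def)
qed

text \<open>Adding the comparison \<open>(i, j)\<close> changes the first order condition only in the direction
  \<open>e\<^sub>i - e\<^sub>j\<close>, so both estimators agree after a one-dimensional change of the noise.\<close>

lemma line_shift: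
  fixes x :: "nat \<Rightarrow> real" and s :: real
  assumes V: "finite V" and W: "insert (i, j) W \<subseteq> V \<times> V" "(i, j) \<notin> W" and ij: "i \<noteq> j" and \<gamma>: "0 < \<gamma>"
  defines "wt t \<equiv> x(j := s - t, i := t)"
  defines "\<tau> t \<equiv> t - dloss (pair_est V W \<gamma> (wt t) i - pair_est V W \<gamma> (wt t) j)"
  shows "t \<le> t' \<Longrightarrow> t' - t \<le> \<tau> t' - \<tau> t"
    and "t \<le> t' \<Longrightarrow> \<tau> t' - \<tau> t \<le> (1 + 2 * \<kappa>2 / \<gamma>) * (t' - t)"
    and "\<bar>\<tau> t - t\<bar> \<le> \<kappa>1"
    and "pair_est V (insert (i, j) W) \<gamma> (wt (\<tau> t)) = pair_est V W \<gamma> (wt t)"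
proof -
  have W0: "W \<subseteq> V \<times> V" and iV: "i \<in> V" "j \<in> V" using W by auto
  define \<theta> where "\<theta> t = pair_est V W \<gamma> (wt t)" for t
  define d where "d t = \<theta> t i - \<theta> t j" for t
  have f: "foc dloss V W \<gamma> (wt t) (\<theta> t)" for t
    unfolding \<theta>_def by (rule foc_pair_est[OF V W0 \<gamma>])
  have \<tau>: "\<tau> t = t - dloss (d t)" for t by (simp add: \<tau>_def d_def \<theta>_def)
  \<comment> \<open>Moving noise from \<open>j\<close> to \<open>i\<close> lowers the difference
    \<open>d\<close> of the two estimates, and the strong convexity due to the ridge limits its rate
    of change to \<open>2 / \<gamma>\<close>.\<close>
  have key: "\<gamma> / 2 * (d t - d t')\<^sup>2 \<le> (t' - t) * (d t - d t')" for t t'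
  proof -
    have "0 \<le> (dloss a - dloss b) * (a - b)" for a b
      using dloss_mono[of a b] dloss_mono[of b a] by (cases "a \<le> b") (auto simp: mult_nonpos_nonpos)
    then have "0 \<le> (\<Sum>(k, l)\<in>W. (dloss (\<theta> t k - \<theta> t l) - dloss (\<theta> t' k - \<theta> t' l)) * ((\<theta> t k - \<theta> t l) - (\<theta> t' k - \<theta> t' l)))"
      by (intro sum_nonneg) auto
    with foc_diff[OF V W0 f f, of t t']
    have "\<gamma> * (\<Sum>k\<in>V. (\<theta> t k - \<theta> t' k)\<^sup>2) \<le> - (\<Sum>k\<in>V. (wt t k - wt t' k) * (\<theta> t k - \<theta> t' k))" by simp
    also have "(\<Sum>k\<in>V. (wt t k - wt t' k) * (\<theta> t k - \<theta> t' k)) = (\<Sum>k\<in>{i, j}. (wt t k - wt t' k) * (\<theta> t k - \<theta> t' k))"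
      using V iV by (intro sum.mono_neutral_right) (auto simp: wt_def)
    also have "\<dots> = (t - t') * (d t - d t')"
      using ij by (simp add: wt_def d_def algebra_simps)
    finally have 1: "\<gamma> * (\<Sum>k\<in>V. (\<theta> t k - \<theta> t' k)\<^sup>2) \<le> (t' - t) * (d t - d t')" by (simp add: algebra_simps)
    have "(\<Sum>k\<in>{i, j}. (\<theta> t k - \<theta> t' k)\<^sup>2) \<le> (\<Sum>k\<in>V. (\<theta> t k - \<theta> t' k)\<^sup>2)"
      using V iV by (intro sum_mono2) auto
    moreover have "(d t - d t')\<^sup>2 / 2 \<le> (\<Sum>k\<in>{i, j}. (\<theta> t k - \<theta> t' k)\<^sup>2)"
    proof -
      have "(a - c)\<^sup>2 / 2 \<le> a\<^sup>2 + c\<^sup>2" for a c :: real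
        using zero_le_power2[of "a + c"] by (simp add: power2_eq_square field_simps)
      from this[of "\<theta> t i - \<theta> t' i" "\<theta> t j - \<theta> t' j"]
      have "((\<theta> t i - \<theta> t' i) - (\<theta> t j - \<theta> t' j))\<^sup>2 / 2 \<le> (\<Sum>k\<in>{i, j}. (\<theta> t k - \<theta> t' k)\<^sup>2)"
        using ij by simp
      moreover have "(\<theta> t i - \<theta> t' i) - (\<theta> t j - \<theta> t' j) = d t - d t'" by (simp add: d_def)
      ultimately show ?thesis by simp
    qed
    ultimately have "\<gamma> * ((d t - d t')\<^sup>2 / 2) \<le> \<gamma> * (\<Sum>k\<in>V. (\<theta> t k - \<theta> t' k)\<^sup>2)"
      using \<gamma> by (intro mult_left_mono) auto
    then show ?thesis using 1 by simp
  qed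
  have d: "d t' \<le> d t" "d t - d t' \<le> 2 / \<gamma> * (t' - t)" if "t \<le> t'" for t t'
  proof -
    show dd: "d t' \<le> d t"
    proof (rule ccontr)
      assume "\<not> d t' \<le> d t"
      then have "0 < \<gamma> / 2 * (d t - d t')\<^sup>2" "(t' - t) * (d t - d t') \<le> 0"
        using \<gamma> that by (auto intro: mult_nonneg_nonpos)
      then show False using key[of t t'] by linarith
    qed
    show "d t - d t' \<le> 2 / \<gamma> * (t' - t)"
    proof (cases "d t = d t'")
      case False
      then have p: "0 < d t - d t'" using dd by simp
      have "(d t - d t') * (\<gamma> / 2 * (d t - d t')) \<le> (d t - d t') * (t' - t)"
        using key[of t t'] by (simp add: power2_eq_square mult_ac)
      then have "\<gamma> / 2 * (d t - d t') \<le> t' - t" using p by (simp only: mult_le_cancel_left_pos)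
      then show ?thesis using \<gamma> by (simp add: field_simps)
    qed (use \<gamma> that in simp)
  qed
  \<comment> \<open>\<open>dloss\<close> increases while \<open>d\<close> decreases, so subtracting
    \<open>dloss (d t)\<close> can only add to the unit slope of \<open>\<tau>\<close>.\<close>
  show "t' - t \<le> \<tau> t' - \<tau> t" if "t \<le> t'"
    using dloss_mono[OF d(1)[OF that]] by (simp add: \<tau>)
  show "\<tau> t' - \<tau> t \<le> (1 + 2 * \<kappa>2 / \<gamma>) * (t' - t)" if "t \<le> t'"
  proof -
    have "dloss (d t) - dloss (d t') \<le> \<kappa>2 * (d t - d t')"
      by (rule dloss_lipschitz[OF d(1)[OF that]])
    also have "\<dots> \<le> \<kappa>2 * (2 / \<gamma> * (t' - t))"
      using d(2)[OF that] \<kappa>2 by (intro mult_left_mono) auto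
    finally show ?thesis by (simp add: \<tau> algebra_simps)
  qed
  show "\<bar>\<tau> t - t\<bar> \<le> \<kappa>1"
    using abs_dloss_le[of "d t"] by (simp add: \<tau>)
  \<comment> \<open>The new comparison adds \<open>dloss (d t)\<close> to the gradient at
    \<open>i\<close> and subtracts it at \<open>j\<close>; passing from \<open>t\<close> to
    \<open>\<tau> t\<close> with \<open>s\<close> fixed changes the noise by exactly the opposite
    amounts.\<close>
  have "foc dloss V (insert (i, j) W) \<gamma> (wt (\<tau> t)) (\<theta> t)"
    unfolding foc_def
  proof
    fix k assume k: "k \<in> V"
    have ins: "(if (a, b) \<in> insert (i, j) W then y else 0) = (if (a, b) \<in> W then y else 0) + (if a = i \<and> b = j then y else 0)"
      for a b and y :: real using W(2) by simp
    have "(\<Sum>l\<in>V. if k = i \<and> l = j then dloss (\<theta> t k - \<theta> t l) else 0) = (if k = i then dloss (d t) else 0)"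
      using V iV by (cases "k = i") (simp_all add: d_def)
    moreover have "(\<Sum>l\<in>V. if l = i \<and> k = j then dloss (\<theta> t l - \<theta> t k) else 0) = (if k = j then dloss (d t) else 0)"
      using V iV by (cases "k = j") (simp_all add: d_def)
    ultimately have sc: "score dloss V (insert (i, j) W) (\<theta> t) k = score dloss V W (\<theta> t) k
        + ((if k = i then dloss (d t) else 0) - (if k = j then dloss (d t) else 0))"
      unfolding score_def ins by (simp only: sum_subtractf sum.distrib)
    have "score dloss V W (\<theta> t) k + \<gamma> * \<theta> t k + wt t k = 0"
      using f[of t] k unfolding foc_def by blast
    then show "score dloss V (insert (i, j) W) (\<theta> t) k + \<gamma> * \<theta> t k + wt (\<tau> t) k = 0"
      unfolding sc using ij by (cases "k = i"; cases "k = j"; simp add: wt_def \<tau>)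
  qed
  then show "pair_est V (insert (i, j) W) \<gamma> (wt (\<tau> t)) = pair_est V W \<gamma> (wt t)"
    using pair_est_eqI[OF V W(1) \<gamma> pair_est_in[OF V W0 \<gamma>, of "wt t"]] by (simp add: \<theta>_def)
qed

definition pair_mechanism :: "nat set \<Rightarrow> (nat \<times> nat) set \<Rightarrow> real \<Rightarrow> real \<Rightarrow> (nat \<Rightarrow> real) measure" where
  "pair_mechanism V W \<gamma> b = distr (PiM V (\<lambda>_. laplace b)) (PiM V (\<lambda>_. borel)) (pair_est V W \<gamma>)"

lemma sets_PiM_laplace: "sets (PiM V (\<lambda>_. laplace b)) = sets (PiM V (\<lambda>_. borel))"
  by (intro sets_PiM_cong) auto

lemma emeasure_pair_mechanism:
  assumes V: "finite V" and W: "W \<subseteq> V \<times> V" and \<gamma>: "0 < \<gamma>" and A: "A \<in> sets (PiM V (\<lambda>_. borel))"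
  shows "emeasure (pair_mechanism V W \<gamma> b) A = (\<integral>\<^sup>+w. indicator A (pair_est V W \<gamma> w) \<partial>PiM V (\<lambda>_. laplace b))"
proof -
  have m: "pair_est V W \<gamma> \<in> PiM V (\<lambda>_. laplace b) \<rightarrow>\<^sub>M PiM V (\<lambda>_. borel)"
    using measurable_pair_est[OF V W \<gamma>] by (simp add: measurable_cong_sets[OF sets_PiM_laplace refl])
  have "emeasure (pair_mechanism V W \<gamma> b) A = (\<integral>\<^sup>+\<theta>. indicator A \<theta> \<partial>pair_mechanism V W \<gamma> b)"
    using A by (simp add: pair_mechanism_def)
  also have "\<dots> = (\<integral>\<^sup>+w. indicator A (pair_est V W \<gamma> w) \<partial>PiM V (\<lambda>_. laplace b))"
    unfolding pair_mechanism_def using A by (intro nn_integral_distr m) auto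
  finally show ?thesis .
qed

text \<open>Fix the other coordinates and \<open>s\<close>, and substitute along the line. Each of
  the two affected Laplace densities changes by a factor of at most
  \<open>exp (\<kappa>1 / b)\<close>. The substitution costs
  \<open>1 + 2 * \<kappa>2 / \<gamma>\<close> in one direction and nothing in the other; the larger
  constant is stated for both.\<close>

lemma add_comparison_privacy:
  assumes V: "finite V" and W: "insert (i, j) W \<subseteq> V \<times> V" "(i, j) \<notin> W" and ij: "i \<noteq> j" and \<gamma>: "0 < \<gamma>" and b: "0 < b"
    and A: "A \<in> sets (PiM V (\<lambda>_. borel))"
  defines "K \<equiv> ennreal (exp (2 * \<kappa>1 / b) * (1 + 2 * \<kappa>2 / \<gamma>))"
  shows "emeasure (pair_mechanism V W \<gamma> b) A \<le> K * emeasure (pair_mechanism V (insert (i, j) W) \<gamma> b) A"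
    and "emeasure (pair_mechanism V (insert (i, j) W) \<gamma> b) A \<le> K * emeasure (pair_mechanism V W \<gamma> b) A"
proof -
  let ?W' = "insert (i, j) W"
  let ?R = "V - {i, j}"
  let ?P = "PiM ?R (\<lambda>_. laplace b)"
  have W0: "W \<subseteq> V \<times> V" and iV: "i \<in> V" "j \<in> V" using W by auto
  have Veq: "insert i (insert j ?R) = V" using iV by auto
  define f where "f U w = (indicator A (pair_est V U \<gamma> w) :: ennreal)" for U w
  have fm: "f U \<in> borel_measurable (PiM (insert i (insert j ?R)) (\<lambda>_. borel))" if "U \<subseteq> V \<times> V" for U
    unfolding f_def Veq using A measurable_pair_est[OF V that \<gamma>] by measurable
  define J where "J U x s = (\<integral>\<^sup>+t. ennreal (laplace_density b t * laplace_density b (s - t)) * f U (x(j := s - t, i := t)) \<partial>lborel)"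
    for U and x :: "nat \<Rightarrow> real" and s
  have em: "emeasure (pair_mechanism V U \<gamma> b) A = (\<integral>\<^sup>+x. (\<integral>\<^sup>+s. J U x s \<partial>lborel) \<partial>?P)" if "U \<subseteq> V \<times> V" for U
  proof -
    have "emeasure (pair_mechanism V U \<gamma> b) A = (\<integral>\<^sup>+w. f U w \<partial>PiM (insert i (insert j ?R)) (\<lambda>_. laplace b))"
      unfolding Veq f_def by (rule emeasure_pair_mechanism[OF V that \<gamma> A])
    also have "\<dots> = (\<integral>\<^sup>+x. (\<integral>\<^sup>+s. J U x s \<partial>lborel) \<partial>?P)"
      unfolding J_def using V ij by (intro laplace_noise_two_coordinates[OF b _ _ _ _ fm[OF that]]) auto
    finally show ?thesis .
  qed
  have upd: "(\<lambda>t. x(j := s - t, i := t)) \<in> borel \<rightarrow>\<^sub>M PiM (insert i (insert j ?R)) (\<lambda>_. borel)"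
    if "x \<in> space ?P" for x s
  proof (rule measurable_fun_upd[where J = "insert j ?R"])
    have "x \<in> space (PiM ?R (\<lambda>_. borel))" using that by (simp add: space_PiM)
    then show "(\<lambda>t. x(j := s - t)) \<in> borel \<rightarrow>\<^sub>M PiM (insert j ?R) (\<lambda>_. borel)"
      by (intro measurable_fun_upd[where J = ?R]) auto
  qed auto
  have Jm: "(\<lambda>s. J U x s) \<in> borel_measurable lborel" if "x \<in> space ?P" "U \<subseteq> V \<times> V" for U x
  proof -
    have "(\<lambda>(s, t). x(j := s - t, i := t)) \<in> borel \<Otimes>\<^sub>M borel \<rightarrow>\<^sub>M PiM (insert i (insert j ?R)) (\<lambda>_. borel)"
      unfolding case_prod_beta
    proof (rule measurable_fun_upd[where J = "insert j ?R"])
      have "x \<in> space (PiM ?R (\<lambda>_. borel))" using that by (simp add: space_PiM)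
      then show "(\<lambda>p. x(j := fst p - snd p)) \<in> borel \<Otimes>\<^sub>M borel \<rightarrow>\<^sub>M PiM (insert j ?R) (\<lambda>_. borel)"
        by (intro measurable_fun_upd[where J = ?R]) auto
    qed auto
    from measurable_compose[OF this fm[OF that(2)]]
    have [measurable]: "(\<lambda>(s, t). f U (x(j := s - t, i := t))) \<in> borel_measurable (borel \<Otimes>\<^sub>M borel)"
      by (simp add: case_prod_beta)
    show ?thesis unfolding J_def by measurable
  qed
  define E where "E = exp (2 * \<kappa>1 / b)"
  define C where "C = 1 + 2 * \<kappa>2 / \<gamma>"
  have E1: "1 \<le> E" "0 \<le> E" using \<kappa>1 b by (simp_all add: E_def)
  have C1: "1 \<le> C" using \<kappa>2 \<gamma> by (simp add: C_def)
  have K: "K = ennreal E * ennreal C" unfolding K_def E_def C_def using C1 by (simp add: C_def ennreal_mult)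
  have cmp: "J W x s \<le> K * J ?W' x s" "J ?W' x s \<le> K * J W x s" if x: "x \<in> space ?P" for x s
  proof -
    define \<tau> where "\<tau> t = t - dloss (pair_est V W \<gamma> (x(j := s - t, i := t)) i - pair_est V W \<gamma> (x(j := s - t, i := t)) j)" for t
    note L = line_shift[OF V W ij \<gamma>, where x = x and s = s, folded \<tau>_def C_def]
    define \<rho> where "\<rho> t = laplace_density b t * laplace_density b (s - t)" for t
    have \<rho>0: "0 \<le> \<rho> t" for t using b by (simp add: \<rho>_def laplace_density_def)
    have ratio: "\<rho> u \<le> E * \<rho> v" if "\<bar>u - v\<bar> \<le> \<kappa>1" for u v
    proof -
      have l0: "0 \<le> laplace_density b y" for y using b by (simp add: laplace_density_def)
      have h: "laplace_density b y \<le> exp (\<kappa>1 / b) * laplace_density b z" if "\<bar>y - z\<bar> \<le> \<kappa>1" for y z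
      proof -
        have "exp (\<bar>y - z\<bar> / b) \<le> exp (\<kappa>1 / b)" using that b by (simp add: divide_right_mono)
        then have "exp (\<bar>y - z\<bar> / b) * laplace_density b z \<le> exp (\<kappa>1 / b) * laplace_density b z"
          using l0 by (intro mult_right_mono) auto
        then show ?thesis using laplace_density_ratio[OF b, of y z] by linarith
      qed
      have "\<rho> u \<le> (exp (\<kappa>1 / b) * laplace_density b v) * (exp (\<kappa>1 / b) * laplace_density b (s - v))"
        unfolding \<rho>_def using that by (intro mult_mono h l0 mult_nonneg_nonneg) auto
      also have "\<dots> = (exp (\<kappa>1 / b) * exp (\<kappa>1 / b)) * \<rho> v" by (simp add: \<rho>_def)
      also have "exp (\<kappa>1 / b) * exp (\<kappa>1 / b) = E" by (simp add: E_def flip: exp_add)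
      finally show ?thesis .
    qed
    \<comment> \<open>The integrand for the larger comparison set; composed with
      \<open>\<tau>\<close> it carries the indicator of the smaller set and a shifted
      density.\<close>
    define g where "g t = ennreal (\<rho> t) * f ?W' (x(j := s - t, i := t))" for t
    have fmt: "(\<lambda>t. f U (x(j := s - t, i := t))) \<in> borel_measurable borel" if "U \<subseteq> V \<times> V" for U
      by (rule measurable_compose[OF upd[OF x] fm[OF that]])
    note fmt[OF W(1), measurable] fmt[OF W0, measurable]
    have [measurable]: "\<rho> \<in> borel_measurable borel" unfolding \<rho>_def by measurable
    have gm: "g \<in> borel_measurable borel" unfolding g_def by measurable
    have g\<tau>: "g (\<tau> t) = ennreal (\<rho> (\<tau> t)) * f W (x(j := s - t, i := t))" for t
      unfolding g_def f_def L(4) ..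
    have J': "J ?W' x s = (\<integral>\<^sup>+t. g t \<partial>lborel)" by (simp add: J_def g_def \<rho>_def)
    have JW: "J W x s = (\<integral>\<^sup>+t. ennreal (\<rho> t) * f W (x(j := s - t, i := t)) \<partial>lborel)" by (simp add: J_def \<rho>_def)
    note B = nn_integral_bilipschitz[OF C1 L(1,2) gm]
    have "\<bar>t - \<tau> t\<bar> \<le> \<kappa>1" "\<bar>\<tau> t - t\<bar> \<le> \<kappa>1" for t using L(3)[of t] by (simp_all add: abs_minus_commute)
    then have r: "ennreal (\<rho> t) \<le> ennreal E * ennreal (\<rho> (\<tau> t))" "ennreal (\<rho> (\<tau> t)) \<le> ennreal E * ennreal (\<rho> t)" for t
      using ratio E1 \<rho>0 by (auto simp flip: ennreal_mult intro!: ennreal_leI)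
    have \<tau>m: "\<tau> \<in> borel_measurable borel"
    proof (rule borel_measurable_mono)
      show "mono \<tau>" using L(1) by (intro monoI) (smt (verit))
    qed
    have g\<tau>m: "(\<lambda>t. g (\<tau> t)) \<in> borel_measurable lborel" using measurable_compose[OF \<tau>m gm] by simp
    have "J W x s \<le> (\<integral>\<^sup>+t. ennreal E * g (\<tau> t) \<partial>lborel)"
      unfolding JW g\<tau> using r(1) by (intro nn_integral_mono) (simp add: mult.assoc[symmetric] mult_right_mono)
    also have "\<dots> = ennreal E * (\<integral>\<^sup>+t. g (\<tau> t) \<partial>lborel)" by (rule nn_integral_cmult[OF g\<tau>m])
    also have "\<dots> \<le> ennreal E * J ?W' x s" unfolding J' using B(1) by (intro mult_left_mono) auto
    also have "\<dots> \<le> K * J ?W' x s"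
    proof (intro mult_right_mono)
      have "ennreal E * 1 \<le> ennreal E * ennreal C" using C1 by (intro mult_left_mono) auto
      then show "ennreal E \<le> K" by (simp add: K)
    qed auto
    finally show "J W x s \<le> K * J ?W' x s" .
    have "(\<integral>\<^sup>+t. g (\<tau> t) \<partial>lborel) \<le> (\<integral>\<^sup>+t. ennreal E * (ennreal (\<rho> t) * f W (x(j := s - t, i := t))) \<partial>lborel)"
      unfolding g\<tau> using r(2) by (intro nn_integral_mono) (simp add: mult.assoc[symmetric] mult_right_mono)
    also have "\<dots> = ennreal E * J W x s"
      unfolding JW by (rule nn_integral_cmult) measurable
    finally have h: "(\<integral>\<^sup>+t. g (\<tau> t) \<partial>lborel) \<le> ennreal E * J W x s" .
    have "J ?W' x s \<le> ennreal C * (\<integral>\<^sup>+t. g (\<tau> t) \<partial>lborel)" unfolding J' by (rule B(2))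
    also have "\<dots> \<le> ennreal C * (ennreal E * J W x s)" by (rule mult_left_mono[OF h]) simp
    also have "\<dots> = K * J W x s" by (simp add: K mult_ac)
    finally show "J ?W' x s \<le> K * J W x s" .
  qed
  have integ: "(\<integral>\<^sup>+x. (\<integral>\<^sup>+s. J U x s \<partial>lborel) \<partial>?P) \<le> K * (\<integral>\<^sup>+x. (\<integral>\<^sup>+s. J U' x s \<partial>lborel) \<partial>?P)"
    if c: "\<And>x s. x \<in> space ?P \<Longrightarrow> J U x s \<le> K * J U' x s" and U': "U' \<subseteq> V \<times> V" for U U'
  proof -
    interpret prob_space "laplace b" by (rule prob_space_laplace[OF b])
    interpret product_sigma_finite "\<lambda>_::nat. laplace b" by standard
    have m: "(\<lambda>x. \<integral>\<^sup>+s. J U' x s \<partial>lborel) \<in> borel_measurable ?P"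
    proof -
      let ?Q = "(PiM ?R (\<lambda>_. borel) \<Otimes>\<^sub>M borel) \<Otimes>\<^sub>M borel :: (((nat \<Rightarrow> real) \<times> real) \<times> real) measure"
      have 1: "(\<lambda>p. (fst (fst p))(j := snd (fst p) - snd p, i := snd p)) \<in> ?Q \<rightarrow>\<^sub>M PiM (insert i (insert j ?R)) (\<lambda>_. borel)"
      proof (rule measurable_fun_upd[where J = "insert j ?R"])
        show "(\<lambda>p. (fst (fst p))(j := snd (fst p) - snd p)) \<in> ?Q \<rightarrow>\<^sub>M PiM (insert j ?R) (\<lambda>_. borel)"
          by (intro measurable_fun_upd[where J = ?R]) auto
      qed auto
      note measurable_compose[OF 1 fm[OF U'], measurable]
      show ?thesis unfolding J_def by measurable
    qed
    have "(\<integral>\<^sup>+x. (\<integral>\<^sup>+s. J U x s \<partial>lborel) \<partial>?P) \<le> (\<integral>\<^sup>+x. (\<integral>\<^sup>+s. K * J U' x s \<partial>lborel) \<partial>?P)"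
      using c by (intro nn_integral_mono)
    also have "\<dots> = (\<integral>\<^sup>+x. K * (\<integral>\<^sup>+s. J U' x s \<partial>lborel) \<partial>?P)"
      using Jm[OF _ U'] by (intro nn_integral_cong nn_integral_cmult)
    also have "\<dots> = K * (\<integral>\<^sup>+x. (\<integral>\<^sup>+s. J U' x s \<partial>lborel) \<partial>?P)"
      by (rule nn_integral_cmult[OF m])
    finally show ?thesis .
  qed
  show "emeasure (pair_mechanism V W \<gamma> b) A \<le> K * emeasure (pair_mechanism V ?W' \<gamma> b) A"
    unfolding em[OF W0] em[OF W(1)] by (rule integ[OF cmp(1) W(1)])
  show "emeasure (pair_mechanism V ?W' \<gamma> b) A \<le> K * emeasure (pair_mechanism V W \<gamma> b) A"
    unfolding em[OF W0] em[OF W(1)] by (rule integ[OF cmp(2) W0])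
qed

end

section \<open>Adjacency in terms of winner-loser pairs\<close>

lemma wins_remove:
  assumes "(G, y) \<in> data_sets n" "e \<in> G"
  obtains i j where "i \<noteq> j" "wins (G, y) = insert (i, j) (wins (G - {e}, y))" "(i, j) \<notin> wins (G - {e}, y)"
proof -
  obtain a b where e: "e = (a, b)" by (cases e)
  have ord: "k < l" if "(k, l) \<in> G" for k l
    using assms(1) that by (auto simp: data_sets_def item_pairs_def)
  have ab: "a < b" using assms(2) ord e by simp
  have no: "(b, a) \<notin> G" using ord[of b a] ab by auto
  show ?thesis
  proof (cases "y e")
    case True
    show ?thesis
    proof (rule that[of a b])
      show "wins (G, y) = insert (a, b) (wins (G - {e}, y))"
        using assms(2) True unfolding e by (auto simp: wins_def)
      show "(a, b) \<notin> wins (G - {e}, y)" using no unfolding e by (auto simp: wins_def)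
    qed (use ab in simp)
  next
    case False
    show ?thesis
    proof (rule that[of b a])
      show "wins (G, y) = insert (b, a) (wins (G - {e}, y))"
        using assms(2) False unfolding e by (force simp: wins_def)
      show "(b, a) \<notin> wins (G - {e}, y)" using no unfolding e by (auto simp: wins_def)
    qed (use ab in simp)
  qed
qed

lemma wins_cong: "(\<And>e. e \<in> G \<Longrightarrow> y e = y' e) \<Longrightarrow> wins (G, y) = wins (G, y')"
  by (auto simp: wins_def image_iff)

text \<open>Merges the two kinds of adjacency: a flipped outcome, too, exchanges one ordered pair
  for another over a common set. That set is what remains after deleting the differing comparison on
  either side.\<close>

lemma adjacent_wins:
  assumes "adjacent X X'" "X \<in> data_sets n" "X' \<in> data_sets n"
  obtains W i j i' j' where "wins X = insert (i, j) W" "(i, j) \<notin> W" "i \<noteq> j"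
    "wins X' = insert (i', j') W" "(i', j') \<notin> W" "i' \<noteq> j'"
proof -
  obtain G y G' y' where X: "X = (G, y)" "X' = (G', y')" by (cases X, cases X')
  obtain e e' where ee: "e \<in> G" "e' \<in> G'" "G - {e} = G' - {e'}" "\<And>k. k \<in> G - {e} \<Longrightarrow> y k = y' k"
  proof -
    from assms(1) consider "G = G'" "\<exists>!e. e \<in> G \<and> y e \<noteq> y' e"
      | e e' where "e \<notin> G \<inter> G'" "e' \<notin> G \<inter> G'" "G = insert e (G \<inter> G')" "G' = insert e' (G \<inter> G')" "\<forall>e\<in>G \<inter> G'. y e = y' e"
      unfolding adjacent_def X prod.case by blast
    then show ?thesis
    proof cases
      case 1
      then obtain e where "e \<in> G" "y e \<noteq> y' e" "\<And>k. k \<in> G \<Longrightarrow> y k \<noteq> y' k \<Longrightarrow> k = e" by blast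
      then have e: "e \<in> G" "\<And>k. k \<in> G - {e} \<Longrightarrow> y k = y' k" by blast+
      show ?thesis by (rule that[of e e]) (use e 1(1) in simp_all)
    next
      case 2
      then have "G - {e} = G \<inter> G'" "G' - {e'} = G \<inter> G'" by blast+
      moreover have "e \<in> G" "e' \<in> G'" using 2(3,4) by blast+
      ultimately show ?thesis using 2(5) by (intro that[of e e']) simp_all
    qed
  qed
  obtain i j where 1: "i \<noteq> j" "wins (G, y) = insert (i, j) (wins (G - {e}, y))" "(i, j) \<notin> wins (G - {e}, y)"
    using wins_remove[of G y n e] assms(2) ee(1) unfolding X by blast
  obtain i' j' where 2: "i' \<noteq> j'" "wins (G', y') = insert (i', j') (wins (G' - {e'}, y'))" "(i', j') \<notin> wins (G' - {e'}, y')"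
    using wins_remove[of G' y' n e'] assms(3) ee(2) unfolding X by blast
  have "wins (G' - {e'}, y') = wins (G - {e}, y)"
    using ee(3,4) by (metis wins_cong)
  with 1 2 show ?thesis by (intro that[of i j "wins (G - {e}, y)" i' j']) (simp_all add: X)
qed

context link
begin

lemma estimator_eq_pair_est:
  "X \<in> data_sets n \<Longrightarrow> estimator F n \<gamma> X = pair_est {1..n} (wins X) \<gamma>"
  unfolding estimator_eq_ridge_min pair_est_def by (simp add: neg_log_lik_wins)

text \<open>The noise scale makes the density factor \<open>exp (2 * \<kappa>1 / b)\<close> equal to
  \<open>exp (\<epsilon> / 4)\<close>, and \<open>large\<close> bounds the substitution factor by
  the same number. One comparison thus costs \<open>exp (\<epsilon> / 2)\<close>, and removing one
  and adding another costs \<open>exp \<epsilon>\<close>; this explains the 8 in the scale.\<close>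

theorem edge_privacy:
  assumes \<gamma>: "0 < \<gamma>" and \<epsilon>: "0 < \<epsilon>" and large: "8 * \<kappa>2 / \<gamma> \<le> \<epsilon>"
  shows "edge_diff_private n (euclid n) \<epsilon> 0 (estimator_mechanism F n \<gamma> (8 * \<kappa>1 / \<epsilon>))"
proof -
  define b where "b = 8 * \<kappa>1 / \<epsilon>"
  have b: "0 < b" using \<kappa>1 \<epsilon> by (simp add: b_def)
  interpret L: prob_space "laplace b" by (rule prob_space_laplace[OF b])
  interpret P: product_prob_space "\<lambda>_::nat. laplace b" "{1..n}" by standard
  have prob: "estimator_mechanism F n \<gamma> b X \<in> space (prob_algebra (euclid n))" for X
  proof -
    have "estimator F n \<gamma> X \<in> laplace_noise n b \<rightarrow>\<^sub>M euclid n"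
      unfolding laplace_noise_def using measurable_estimator[OF \<gamma>]
      by (simp add: measurable_cong_sets[OF sets_PiM_laplace refl])
    moreover have "prob_space (laplace_noise n b)"
      unfolding laplace_noise_def by (rule P.prob_space_axioms)
    ultimately show ?thesis
      unfolding estimator_mechanism_def space_prob_algebra by (auto intro: prob_space.prob_space_distr)
  qed
  have mech: "estimator_mechanism F n \<gamma> b X = pair_mechanism {1..n} (wins X) \<gamma> b" if "X \<in> data_sets n" for X
    unfolding estimator_mechanism_def pair_mechanism_def laplace_noise_def estimator_eq_pair_est[OF that] ..
  have main: "measure (estimator_mechanism F n \<gamma> b X) A \<le> exp \<epsilon> * measure (estimator_mechanism F n \<gamma> b X') A + 0"
    if X: "X \<in> data_sets n" "X' \<in> data_sets n" and adj: "adjacent X X'" and A: "A \<in> sets (euclid n)" for X X' A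
  proof -
    obtain W i j i' j' where w: "wins X = insert (i, j) W" "(i, j) \<notin> W" "i \<noteq> j"
      "wins X' = insert (i', j') W" "(i', j') \<notin> W" "i' \<noteq> j'"
      by (rule adjacent_wins[OF adj X])
    have s: "insert (i, j) W \<subseteq> {1..n} \<times> {1..n}" "insert (i', j') W \<subseteq> {1..n} \<times> {1..n}"
      using wins_subset[OF X(1)] wins_subset[OF X(2)] w by simp_all
    define K where "K = exp (2 * \<kappa>1 / b) * (1 + 2 * \<kappa>2 / \<gamma>)"
    have K0: "0 \<le> K" using \<kappa>2 \<gamma> by (simp add: K_def)
    have "K \<le> exp (\<epsilon> / 4) * exp (2 * \<kappa>2 / \<gamma>)"
      unfolding K_def b_def using \<kappa>1 exp_ge_add_one_self[of "2 * \<kappa>2 / \<gamma>"] by simp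
    also have "\<dots> \<le> exp (\<epsilon> / 4) * exp (\<epsilon> / 4)"
      using large by (intro mult_left_mono) auto
    also have "\<dots> = exp (\<epsilon> / 2)" by (simp flip: exp_add)
    finally have "K * K \<le> exp (\<epsilon> / 2) * exp (\<epsilon> / 2)" using K0 by (intro mult_mono) auto
    also have "\<dots> = exp \<epsilon>" by (simp flip: exp_add)
    finally have KK: "K * K \<le> exp \<epsilon>" .
    let ?M = "\<lambda>W. emeasure (pair_mechanism {1..n} W \<gamma> b) A"
    have "?M (wins X) \<le> ennreal K * ?M W"
      unfolding w(1) K_def using add_comparison_privacy(2)[OF _ s(1) w(2,3) \<gamma> b A] by simp
    also have "\<dots> \<le> ennreal K * (ennreal K * ?M (wins X'))"
      unfolding w(4) K_def using add_comparison_privacy(1)[OF _ s(2) w(5,6) \<gamma> b A]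
      by (intro mult_left_mono) simp_all
    also have "\<dots> = ennreal (K * K) * ?M (wins X')" using K0 by (simp add: ennreal_mult mult.assoc)
    also have "\<dots> \<le> ennreal (exp \<epsilon>) * ?M (wins X')"
      using KK by (intro mult_right_mono ennreal_leI) auto
    finally have e: "emeasure (estimator_mechanism F n \<gamma> b X) A \<le> ennreal (exp \<epsilon>) * emeasure (estimator_mechanism F n \<gamma> b X') A"
      unfolding mech[OF X(1)] mech[OF X(2)] .
    interpret X: prob_space "estimator_mechanism F n \<gamma> b X"
      using prob[of X] by (simp add: space_prob_algebra)
    interpret X': prob_space "estimator_mechanism F n \<gamma> b X'"
      using prob[of X'] by (simp add: space_prob_algebra)
    show ?thesis
      using e unfolding X.emeasure_eq_measure X'.emeasure_eq_measure
      by (simp flip: ennreal_mult)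
  qed
  then show ?thesis
    unfolding edge_diff_private_def b_def[symmetric] using prob by blast
qed

end

subsection \<open>Noise concentration and measurability\<close>

lemma laplace_noise_chernoff:
  assumes b: "0 < b" and V: "finite V" and a: "\<And>i. i \<in> V \<Longrightarrow> \<bar>a i\<bar> * b < 1"
  shows "measure (PiM V (\<lambda>_::nat. laplace b)) {w \<in> space (PiM V (\<lambda>_. laplace b)). c \<le> (\<Sum>i\<in>V. a i * w i)}
      \<le> exp (- c) * (\<Prod>i\<in>V. 1 / (1 - (a i * b)\<^sup>2))"
proof -
  let ?M = "PiM V (\<lambda>_::nat. laplace b)"
  interpret L: prob_space "laplace b" by (rule prob_space_laplace[OF b])
  interpret product_sigma_finite "\<lambda>_::nat. laplace b" by standard
  interpret P: product_prob_space "\<lambda>_::nat. laplace b" V by standard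
  have m: "(\<lambda>w. \<Sum>i\<in>V. a i * w i) \<in> borel_measurable ?M"
  proof (intro borel_measurable_sum borel_measurable_times)
    fix i assume "i \<in> V"
    then show "(\<lambda>w. w i) \<in> borel_measurable ?M"
      using measurable_component_singleton[of i V "\<lambda>_. laplace b"] by (simp cong: measurable_cong_sets)
  qed auto
  have pos: "0 \<le> 1 / (1 - (a i * b)\<^sup>2)" if "i \<in> V" for i
  proof -
    have "\<bar>a i * b\<bar> < 1" using a[OF that] b by (simp add: abs_mult)
    then have "(a i * b)\<^sup>2 < 1" by (simp add: abs_square_less_1)
    then show ?thesis by simp
  qed
  have "emeasure ?M {w \<in> space ?M. c \<le> (\<Sum>i\<in>V. a i * w i)}
      = emeasure ?M {w \<in> space ?M. 1 \<le> ennreal (exp (- c)) * ennreal (exp (\<Sum>i\<in>V. a i * w i))}"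
    by (rule arg_cong[where f = "emeasure ?M"])
       (auto simp: ennreal_1[symmetric] simp del: ennreal_1 simp flip: ennreal_mult exp_add)
  also have "\<dots> \<le> ennreal (exp (- c)) * (\<integral>\<^sup>+w. ennreal (exp (\<Sum>i\<in>V. a i * w i)) * indicator (space ?M) w \<partial>?M)"
    using m by (intro nn_integral_Markov_inequality) auto
  also have "(\<integral>\<^sup>+w. ennreal (exp (\<Sum>i\<in>V. a i * w i)) * indicator (space ?M) w \<partial>?M)
      = (\<integral>\<^sup>+w. (\<Prod>i\<in>V. ennreal (exp (a i * w i))) \<partial>?M)"
    by (intro nn_integral_cong) (simp add: exp_sum[OF V] prod_ennreal)
  also have "\<dots> = (\<Prod>i\<in>V. \<integral>\<^sup>+x. ennreal (exp (a i * x)) \<partial>laplace b)"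
    by (rule product_nn_integral_prod[OF V]) simp
  also have "\<dots> = (\<Prod>i\<in>V. ennreal (1 / (1 - (a i * b)\<^sup>2)))"
    by (intro prod.cong refl laplace_mgf[OF b a])
  also have "\<dots> = ennreal (\<Prod>i\<in>V. 1 / (1 - (a i * b)\<^sup>2))"
    using pos by (rule prod_ennreal)
  also have "ennreal (exp (- c)) * \<dots> = ennreal (exp (- c) * (\<Prod>i\<in>V. 1 / (1 - (a i * b)\<^sup>2)))"
    by (simp add: ennreal_mult')
  finally show ?thesis
    unfolding P.emeasure_eq_measure
    using pos by (subst (asm) ennreal_le_iff) (auto intro!: mult_nonneg_nonneg prod_nonneg)
qed

text \<open>The sum is bounded separately because it drives the mean of the solution, where
  \<open>n\<close> times the bound on the maximum would be far too large.\<close>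

definition good_noise :: "nat \<Rightarrow> real \<Rightarrow> (nat \<Rightarrow> real) \<Rightarrow> bool" where
  "good_noise n b w \<longleftrightarrow> (\<forall>i\<in>{1..n}. \<bar>w i\<bar> \<le> 14 * b * ln (real n)) \<and>
     \<bar>\<Sum>i\<in>{1..n}. w i\<bar> \<le> 8 * b * sqrt (real n * ln (real n))"

lemma good_noise_prob:
  assumes b: "0 < b" and n: "3 \<le> n" and L: "2 * ln (real n) \<le> real n"
  shows "{w \<in> space (laplace_noise n b). \<not> good_noise n b w} \<in> sets (laplace_noise n b)"
    and "measure (laplace_noise n b) {w \<in> space (laplace_noise n b). \<not> good_noise n b w} \<le> 5 / real n ^ 5"
proof -
  let ?M = "laplace_noise n b" and ?V = "{1..n}" and ?L = "ln (real n)"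
  have M: "?M = PiM ?V (\<lambda>_. laplace b)" by (simp add: laplace_noise_def)
  interpret Lp: prob_space "laplace b" by (rule prob_space_laplace[OF b])
  interpret P: product_prob_space "\<lambda>_::nat. laplace b" ?V by standard
  interpret prob_space ?M unfolding M by (rule P.prob_space_axioms)
  have w[measurable]: "(\<lambda>w. w i) \<in> borel_measurable ?M" if "i \<in> ?V" for i
    using measurable_component_singleton[OF that, of "\<lambda>_. laplace b"] by (simp add: M cong: measurable_cong_sets)
  have ws: "(\<lambda>w. \<Sum>i\<in>?V. a i * w i) \<in> borel_measurable ?M" for a :: "nat \<Rightarrow> real"
    using w by (intro borel_measurable_sum borel_measurable_times) auto
  have L0: "0 < ?L" using n by simp
  define A where "A a c = {w \<in> space ?M. c \<le> (\<Sum>i\<in>?V. a i * w i)}" for a :: "nat \<Rightarrow> real" and c :: real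
  have A: "A a c \<in> sets ?M" for a c unfolding A_def using ws by measurable
  have Ab: "measure ?M (A a c) \<le> exp (- c) * (\<Prod>i\<in>?V. 1 / (1 - (a i * b)\<^sup>2))"
    if "\<And>i. i \<in> ?V \<Longrightarrow> \<bar>a i\<bar> * b < 1" for a c
    unfolding A_def M using that by (intro laplace_noise_chernoff[OF b]) auto
  define e where "e = exp (- 7 * ?L)"
  have "exp (- 7 * ?L) = inverse (exp (real 7 * ?L))" by (simp add: exp_minus)
  also have "exp (real 7 * ?L) = real n ^ 7" unfolding exp_of_nat_mult using n by simp
  finally have e: "e = 1 / real n ^ 7" by (simp add: e_def inverse_eq_divide)
  have "exp (- 6 * ?L) = inverse (exp (real 6 * ?L))" by (simp add: exp_minus)
  also have "exp (real 6 * ?L) = real n ^ 6" unfolding exp_of_nat_mult using n by simp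
  finally have e6: "exp (- 6 * ?L) = 1 / real n ^ 6" by (simp add: inverse_eq_divide)
  \<comment> \<open>Tilting a single coordinate by \<open>1 / (2 * b)\<close> gives the moment
    \<open>1 / (1 - 1 / 4) = 4 / 3\<close>; the threshold \<open>7 * ln n\<close> for the tilted
    coordinate is \<open>14 * b * ln n\<close> for the noise.\<close>
  define a1 where "a1 s k i = (if i = k then s / (2 * b) else 0)" for s :: real and k i :: nat
  have p1: "measure ?M (A (a1 s k) (7 * ?L)) \<le> 4 / 3 * e" if s: "\<bar>s\<bar> = 1" and k: "k \<in> ?V" for s k
  proof -
    have "measure ?M (A (a1 s k) (7 * ?L)) \<le> exp (- (7 * ?L)) * (\<Prod>i\<in>?V. 1 / (1 - (a1 s k i * b)\<^sup>2))"
      using s b by (intro Ab) (auto simp: a1_def)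
    also have "(\<Prod>i\<in>?V. 1 / (1 - (a1 s k i * b)\<^sup>2)) = (\<Prod>i\<in>?V. if i = k then 4 / 3 else 1)"
    proof (intro prod.cong refl)
      fix i
      have "s\<^sup>2 = 1" using s by (simp add: abs_square_eq_1)
      then show "1 / (1 - (a1 s k i * b)\<^sup>2) = (if i = k then 4 / 3 else 1)"
        using b by (simp add: a1_def power_divide)
    qed
    also have "\<dots> = 4 / 3" using k by (simp add: prod.delta)
    finally show ?thesis by (simp add: e_def)
  qed
  \<comment> \<open>With this tilt each coordinate has moment at most
    \<open>exp (2 * ln n / n)\<close>, in total \<open>n\<^sup>2\<close>, so the threshold
    \<open>8 * ln n\<close> leaves a probability of \<open>1 / n ^ 6\<close>.\<close>
  define t where "t = sqrt (?L / real n) / b"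
  have t: "0 < t" "(t * b)\<^sup>2 = ?L / real n" using b L0 n by (auto simp: t_def)
  have p2: "measure ?M (A (\<lambda>_. s * t) (8 * ?L)) \<le> 1 / real n ^ 6" if s: "\<bar>s\<bar> = 1" for s
  proof -
    define x where "x = ?L / real n"
    have x: "0 \<le> x" "x \<le> 1 / 2" using L0 L n by (simp_all add: x_def field_simps)
    have s2: "s\<^sup>2 = 1" using s by (simp add: abs_square_eq_1)
    have stb: "(s * t * b)\<^sup>2 = x" using t(2) s2 by (simp add: power_mult_distrib x_def)
    have "(t * b)\<^sup>2 < 1" using t(2)[folded x_def] x by linarith
    then have tb: "\<bar>t * b\<bar> < 1" by (simp add: abs_square_less_1)
    have "measure ?M (A (\<lambda>_. s * t) (8 * ?L)) \<le> exp (- (8 * ?L)) * (\<Prod>i\<in>?V. 1 / (1 - (s * t * b)\<^sup>2))"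
      using s b t(1) tb by (intro Ab) (simp add: abs_mult)
    also have "(\<Prod>i\<in>?V. 1 / (1 - (s * t * b)\<^sup>2)) = (1 / (1 - x)) ^ n" unfolding stb by simp
    also have "(1 / (1 - x)) ^ n \<le> exp (2 * x) ^ n"
    proof (rule power_mono)
      have "x * x \<le> x * (1 / 2)" using x by (intro mult_left_mono) auto
      then have "1 \<le> (1 - x) * (1 + 2 * x)" by (simp add: algebra_simps)
      also have "\<dots> \<le> (1 - x) * exp (2 * x)"
        using x exp_ge_add_one_self[of "2 * x"] by (intro mult_left_mono) auto
      finally show "1 / (1 - x) \<le> exp (2 * x)" using x by (simp add: divide_le_eq mult.commute)
    qed (use x in simp)
    also have "exp (2 * x) ^ n = exp (real n * (2 * x))" by (rule exp_of_nat_mult[symmetric])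
    also have "real n * (2 * x) = 2 * ?L" using n by (simp add: x_def)
    also have "exp (- (8 * ?L)) * exp (2 * ?L) = exp (- 6 * ?L)" by (simp flip: exp_add)
    finally show ?thesis unfolding e6 by simp
  qed
  define U1 where "U1 s = (\<Union>k\<in>?V. A (a1 s k) (7 * ?L))" for s
  define U2 where "U2 s = A (\<lambda>_. s * t) (8 * ?L)" for s
  have U1: "U1 s \<in> sets ?M" for s unfolding U1_def using A by (intro sets.finite_UN) auto
  have U2: "U2 s \<in> sets ?M" for s unfolding U2_def by (rule A)
  have m1: "measure ?M (U1 s) \<le> 4 / 3 * (real n * e)" if "\<bar>s\<bar> = 1" for s
  proof -
    have "measure ?M (U1 s) \<le> (\<Sum>k\<in>?V. measure ?M (A (a1 s k) (7 * ?L)))"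
      unfolding U1_def using A by (intro measure_UNION_le) auto
    also have "\<dots> \<le> (\<Sum>k\<in>?V. 4 / 3 * e)" by (intro sum_mono p1 that)
    finally show ?thesis by simp
  qed
  have m2: "measure ?M (U2 s) \<le> 1 / real n ^ 6" if "\<bar>s\<bar> = 1" for s
    unfolding U2_def by (rule p2[OF that])
  have sub: "{w \<in> space ?M. \<not> good_noise n b w} \<subseteq> (U1 1 \<union> U1 (- 1)) \<union> (U2 1 \<union> U2 (- 1))"
  proof (intro subsetI)
    fix w assume "w \<in> {w \<in> space ?M. \<not> good_noise n b w}"
    then have w: "w \<in> space ?M" "\<not> good_noise n b w" by auto
    then consider k where "k \<in> ?V" "14 * b * ?L < \<bar>w k\<bar>" | "8 * b * sqrt (real n * ?L) < \<bar>\<Sum>i\<in>?V. w i\<bar>"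
      by (auto simp: good_noise_def not_le)
    then show "w \<in> (U1 1 \<union> U1 (- 1)) \<union> (U2 1 \<union> U2 (- 1))"
    proof cases
      case 1
      have S: "(\<Sum>i\<in>?V. a1 s k i * w i) = s * w k / (2 * b)" for s
      proof -
        have "(\<Sum>i\<in>?V. a1 s k i * w i) = (\<Sum>i\<in>?V. if i = k then s / (2 * b) * w i else 0)"
          by (intro sum.cong) (auto simp: a1_def)
        then show ?thesis using 1(1) by (simp add: sum.delta)
      qed
      have "7 * ?L \<le> \<bar>w k\<bar> / (2 * b)" using 1(2) b by (simp add: field_simps)
      then have "7 * ?L \<le> 1 * w k / (2 * b) \<or> 7 * ?L \<le> (- 1) * w k / (2 * b)" by (cases "0 \<le> w k") auto
      then show ?thesis using w(1) 1(1) unfolding U1_def A_def mem_Collect_eq S[symmetric] by blast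
    next
      case 2
      have key: "8 * b * sqrt (real n * ?L) * t = 8 * ?L"
      proof -
        have "sqrt (real n * ?L) * sqrt (?L / real n) = sqrt ((real n * ?L) * (?L / real n))" by (rule real_sqrt_mult[symmetric])
        also have "(real n * ?L) * (?L / real n) = ?L\<^sup>2" using n by (simp add: power2_eq_square)
        finally have "sqrt (real n * ?L) * sqrt (?L / real n) = ?L" using L0 by simp
        then show ?thesis unfolding t_def using b by simp
      qed
      have "8 * b * sqrt (real n * ?L) * t \<le> \<bar>\<Sum>i\<in>?V. w i\<bar> * t" using 2 t(1) by (intro mult_right_mono) auto
      then have "8 * ?L \<le> \<bar>\<Sum>i\<in>?V. w i\<bar> * t" unfolding key .
      then have "8 * ?L \<le> 1 * t * (\<Sum>i\<in>?V. w i) \<or> 8 * ?L \<le> (- 1) * t * (\<Sum>i\<in>?V. w i)"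
        by (cases "0 \<le> (\<Sum>i\<in>?V. w i)") (simp_all add: mult.commute)
      then show ?thesis using w(1) unfolding U2_def A_def mem_Collect_eq sum_distrib_left by blast
    qed
  qed
  have "{w \<in> space ?M. \<not> good_noise n b w} = space ?M -
      ((\<Inter>i\<in>?V. {w \<in> space ?M. \<bar>w i\<bar> \<le> 14 * b * ?L}) \<inter> {w \<in> space ?M. \<bar>\<Sum>i\<in>?V. 1 * w i\<bar> \<le> 8 * b * sqrt (real n * ?L)})"
    using n by (auto simp: good_noise_def)
  also have "\<dots> \<in> sets ?M"
    using n by (intro sets.Diff sets.top sets.Int sets.finite_INT) (auto intro!: borel_measurable_le borel_measurable_abs w ws)
  finally show "{w \<in> space ?M. \<not> good_noise n b w} \<in> sets ?M" .
  have "measure ?M {w \<in> space ?M. \<not> good_noise n b w} \<le> measure ?M ((U1 1 \<union> U1 (- 1)) \<union> (U2 1 \<union> U2 (- 1)))"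
    using U1 U2 by (intro finite_measure_mono sub) auto
  also have "\<dots> \<le> (measure ?M (U1 1) + measure ?M (U1 (- 1))) + (measure ?M (U2 1) + measure ?M (U2 (- 1)))"
    using U1 U2 by (intro order_trans[OF measure_Un_le] add_mono measure_Un_le) auto
  also have "\<dots> \<le> (4 / 3 * (real n * e) + 4 / 3 * (real n * e)) + (1 / real n ^ 6 + 1 / real n ^ 6)"
    by (intro add_mono m1 m2) auto
  also have "real n * e = 1 / real n ^ 6" unfolding e using n by (simp add: field_simps power_eq_if)
  also have "(4 / 3 * (1 / real n ^ 6) + 4 / 3 * (1 / real n ^ 6)) + (1 / real n ^ 6 + 1 / real n ^ 6) \<le> 5 * (1 / real n ^ 6)"
  proof -
    have "4 / 3 * x + 4 / 3 * x + (x + x) \<le> 5 * x" if "0 \<le> x" for x :: real using that by simp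
    then show ?thesis by (simp only: zero_le_divide_1_iff zero_le_power of_nat_0_le_iff)
  qed
  also have "1 / real n ^ 6 \<le> 1 / real n ^ 5" using n by (intro divide_left_mono power_increasing) auto
  finally show "measure ?M {w \<in> space ?M. \<not> good_noise n b w} \<le> 5 / real n ^ 5" by simp
qed

text \<open>The estimator depends on the data through the graph and the pairs in it with outcome
  \<open>True\<close>. Infinite graphs share one key, since the likelihood sum over any of them is 0
  by convention; the finite ones are countably many.\<close>

definition data_key :: "comparison_data \<Rightarrow> ((nat \<times> nat) set \<times> (nat \<times> nat) set) option" where
  "data_key X = (if finite (fst X) then Some (fst X, {e\<in>fst X. snd X e}) else None)"

lemma countable_data_key: "countable (range data_key)"
proof (rule countable_subset)
  show "range data_key \<subseteq> insert None (Some ` (Collect finite \<times> Collect finite))"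
    by (auto simp: data_key_def)
  show "countable (insert None (Some ` (Collect finite \<times> Collect finite)) :: ((nat \<times> nat) set \<times> (nat \<times> nat) set) option set)"
    by (intro countable_insert countable_image countable_SIGMA countable_Collect_finite)
qed

lemma estimator_data_key:
  assumes "data_key X = data_key X'"
  shows "estimator F n \<gamma> X = estimator F n \<gamma> X'"
proof -
  obtain G y G' y' where X: "X = (G, y)" "X' = (G', y')" by (cases X, cases X')
  have "neg_log_lik F X \<theta> = neg_log_lik F X' \<theta>" for \<theta>
  proof (cases "finite G")
    case True
    then have G: "G' = G" "{e\<in>G. y e} = {e\<in>G. y' e}"
      using assms by (auto simp: X data_key_def split: if_splits)
    then have "y e = y' e" if "e \<in> G" for e using that by blast
    then show ?thesis unfolding neg_log_lik_def X prod.case G(1) by (intro sum.cong) auto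
  next
    case False
    then have "infinite G'" using assms by (auto simp: X data_key_def split: if_splits)
    then show ?thesis using False by (simp add: neg_log_lik_def X)
  qed
  then have "neg_log_lik F X = neg_log_lik F X'" by (rule ext)
  then show ?thesis unfolding estimator_def objective_def[abs_def] by (simp only:)
qed

context link
begin

text \<open>Comparison data form an uncountable type, on which a set need not be measurable just because
  its sections are; but the estimator factors through the countable type of keys.\<close>

lemma estimator_event_measurable:
  assumes \<gamma>: "0 < \<gamma>" and n: "1 \<le> n"
  shows "{(X, w) \<in> space (measure_pmf D \<Otimes>\<^sub>M laplace_noise n b).
     max_norm n (\<lambda>i. estimator F n \<gamma> X w i - \<theta>0 i) \<le> c} \<in> sets (measure_pmf D \<Otimes>\<^sub>M laplace_noise n b)"
proof -
  let ?N = "laplace_noise n b"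
  define Sec where "Sec X = {w \<in> space ?N. max_norm n (\<lambda>i. estimator F n \<gamma> X w i - \<theta>0 i) \<le> c}" for X
  have Sec: "Sec X \<in> sets ?N" for X
  proof -
    have m: "estimator F n \<gamma> X \<in> ?N \<rightarrow>\<^sub>M euclid n"
      unfolding laplace_noise_def using measurable_estimator[OF \<gamma>]
      by (simp add: measurable_cong_sets[OF sets_PiM_laplace refl])
    have mi: "(\<lambda>w. estimator F n \<gamma> X w i) \<in> borel_measurable ?N" if "i \<in> {1..n}" for i
      by (rule measurable_compose[OF m measurable_component_singleton[OF that]])
    have "Sec X = (\<Inter>i\<in>{1..n}. {w \<in> space ?N. \<bar>estimator F n \<gamma> X w i - \<theta>0 i\<bar> \<le> c})"
      using n by (auto simp: Sec_def max_norm_def)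
    also have "\<dots> \<in> sets ?N"
      using n by (intro sets.finite_INT) (auto intro!: borel_measurable_le borel_measurable_abs borel_measurable_diff mi)
    finally show ?thesis .
  qed
  define rep where "rep k = (SOME X. data_key X = k)" for k
  have rep: "data_key (rep (data_key X)) = data_key X" for X
    unfolding rep_def by (rule someI) (rule refl)
  have Sec_rep: "Sec (rep (data_key X)) = Sec X" for X
    unfolding Sec_def estimator_data_key[OF rep] ..
  have "{(X, w) \<in> space (measure_pmf D \<Otimes>\<^sub>M ?N). max_norm n (\<lambda>i. estimator F n \<gamma> X w i - \<theta>0 i) \<le> c}
     = {(X, w). w \<in> Sec (rep (data_key X))}"
    unfolding Sec_rep by (auto simp: Sec_def space_pair_measure)
  also have "\<dots> = (\<Union>k\<in>range data_key. (data_key -` {k}) \<times> Sec (rep k))"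
    by auto
  also have "\<dots> \<in> sets (measure_pmf D \<Otimes>\<^sub>M ?N)"
    by (intro sets.countable_UN' countable_data_key image_subsetI pair_measureI Sec) auto
  finally show ?thesis .
qed

end

subsection \<open>The error rate\<close>

text \<open>The constants of \<open>leave_one_out.sup_norm_bound\<close> for \<open>\<alpha> = 1 / \<kappa>2\<close> and \<open>\<beta> = \<kappa>2\<close>; the last summand of
  \<open>degree_const\<close> makes the resulting error bound at most \<open>1\<close>.\<close>

definition grad_const :: "real \<Rightarrow> real \<Rightarrow> real" where
  "grad_const \<kappa>1 c0 = 112 * \<kappa>1 + c0"

definition mean_const :: "real \<Rightarrow> real \<Rightarrow> real" where
  "mean_const \<kappa>1 c0 = 2 + 224 * \<kappa>1 / c0"

definition rate_const :: "real \<Rightarrow> real \<Rightarrow> real \<Rightarrow> real" where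
  "rate_const \<kappa>1 \<kappa>2 c0 = 32 * (3 * grad_const \<kappa>1 c0
     + 4 * \<kappa>2 * (6208 * (3 * grad_const \<kappa>1 c0 + 2 * \<kappa>1) / (1 / \<kappa>2) + 3 * mean_const \<kappa>1 c0)
     + 20 * \<kappa>2 * (37376 * \<kappa>1 / (1 / \<kappa>2) + 2 * mean_const \<kappa>1 c0)) / (1 / \<kappa>2)"

definition degree_const :: "real \<Rightarrow> real \<Rightarrow> real \<Rightarrow> real" where
  "degree_const \<kappa>1 \<kappa>2 c0 = 112 + 32 * (14 * \<kappa>2 + 20 * \<kappa>2 * (74752 * \<kappa>2 / (1 / \<kappa>2) + 2)) / (1 / \<kappa>2)
     + 4 * (rate_const \<kappa>1 \<kappa>2 c0)\<^sup>2"

lemma const_pos: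
  assumes "0 < \<kappa>1" "0 < \<kappa>2" "0 < c0"
  shows "0 < grad_const \<kappa>1 c0" "0 < mean_const \<kappa>1 c0" "0 < rate_const \<kappa>1 \<kappa>2 c0"
    and "112 \<le> degree_const \<kappa>1 \<kappa>2 c0"
    and "32 * (14 * \<kappa>2 + 20 * \<kappa>2 * (74752 * \<kappa>2 / (1 / \<kappa>2) + 2)) / (1 / \<kappa>2) \<le> degree_const \<kappa>1 \<kappa>2 c0"
    and "4 * (rate_const \<kappa>1 \<kappa>2 c0)\<^sup>2 \<le> degree_const \<kappa>1 \<kappa>2 c0"
proof -
  show g: "0 < grad_const \<kappa>1 c0" "0 < mean_const \<kappa>1 c0"
    using assms by (simp_all add: grad_const_def mean_const_def add_pos_pos)
  show "0 < rate_const \<kappa>1 \<kappa>2 c0"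
    unfolding rate_const_def using assms g by (intro divide_pos_pos mult_pos_pos add_pos_pos) auto
  have "0 \<le> 32 * (14 * \<kappa>2 + 20 * \<kappa>2 * (74752 * \<kappa>2 / (1 / \<kappa>2) + 2)) / (1 / \<kappa>2)"
    using assms by (intro divide_nonneg_nonneg mult_nonneg_nonneg add_nonneg_nonneg) auto
  then show "112 \<le> degree_const \<kappa>1 \<kappa>2 c0"
    "32 * (14 * \<kappa>2 + 20 * \<kappa>2 * (74752 * \<kappa>2 / (1 / \<kappa>2) + 2)) / (1 / \<kappa>2) \<le> degree_const \<kappa>1 \<kappa>2 c0"
    "4 * (rate_const \<kappa>1 \<kappa>2 c0)\<^sup>2 \<le> degree_const \<kappa>1 \<kappa>2 c0"
    unfolding degree_const_def using zero_le_power2[of "rate_const \<kappa>1 \<kappa>2 c0"] by linarith+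
qed

context link
begin

lemma score_xdloss_cong:
  assumes "\<And>i j. i \<in> U \<Longrightarrow> j \<in> U \<Longrightarrow> \<bar>\<theta> i - \<theta> j\<bar> \<le> 4" and "k \<in> U"
  shows "score xdloss U W \<theta> k = score dloss U W \<theta> k"
  unfolding score_def using assms by (intro sum.cong) (auto simp: xdloss_eq)

lemma estimator_error:
  assumes c0: "0 < c0" and n: "3 \<le> n" and p: "0 < p" "p \<le> 1"
    and \<theta>0: "(\<Sum>i\<in>{1..n}. \<theta>0 i) = 0" "\<And>i. i \<in> {1..n} \<Longrightarrow> \<bar>\<theta>0 i\<bar> \<le> 1"
    and \<epsilon>: "0 < \<epsilon>" "\<epsilon> < 1" and L: "1 \<le> ln (real n)"
    and \<gamma>: "\<gamma> = c0 * sqrt (real n * p * ln (real n))"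
    and dens: "degree_const \<kappa>1 \<kappa>2 c0 * ln (real n) \<le> real n * p * \<epsilon>"
    and X: "X \<in> data_sets n" and gd: "good_data n p \<gamma> w \<theta>0 (wins X)"
    and gn: "good_noise n (8 * \<kappa>1 / \<epsilon>) w" and i: "i \<in> {1..n}"
  shows "\<bar>estimator F n \<gamma> X w i - \<theta>0 i\<bar> \<le> rate_const \<kappa>1 \<kappa>2 c0 *
     (sqrt (ln (real n) / (real n * p)) + ln (real n) / (real n * p * \<epsilon>))"
proof -
  define d where "d = real n * p"
  define l where "l = ln (real n)"
  define r where "r = sqrt (l / d) + l / (d * \<epsilon>)"
  define c1 where "c1 = degree_const \<kappa>1 \<kappa>2 c0"
  define B1 where "B1 = grad_const \<kappa>1 c0"
  define B2 where "B2 = mean_const \<kappa>1 c0"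
  note K = const_pos[OF \<kappa>1 \<kappa>2 c0, folded c1_def B1_def B2_def]
  have n3: "3 \<le> real n" using n by simp
  have l1: "1 \<le> l" using L by (simp add: l_def)
  have d: "0 < d" "d \<le> real n" using p n3 by (simp_all add: d_def)
  have cl: "c1 * l \<le> d * \<epsilon>" using dens by (simp add: c1_def l_def d_def)
  have de: "d * \<epsilon> \<le> d" using d \<epsilon> by simp
  have c1: "1 \<le> c1" "0 < c1" using K(4) by linarith+
  have "1 * l \<le> c1 * l" using c1 l1 by (intro mult_right_mono) auto
  then have ld: "l \<le> d" using cl de by linarith
  have s1: "d * sqrt (l / d) = sqrt (d * l)"
  proof -
    have "sqrt (d * l) = sqrt (d\<^sup>2 * (l / d))" using d by (simp add: power2_eq_square)
    also have "\<dots> = sqrt (d\<^sup>2) * sqrt (l / d)" by (rule real_sqrt_mult)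
    also have "sqrt (d\<^sup>2) = d" using d by simp
    finally show ?thesis ..
  qed
  have sp: "0 < sqrt (l / d)" using l1 d by simp
  have lp: "0 < l / (d * \<epsilon>)" using l1 d \<epsilon> by simp
  have r0: "0 < r" using sp lp unfolding r_def by linarith
  \<comment> \<open>The first summand covers the score and the ridge term at the truth, both of
    order \<open>sqrt (d * l)\<close>; the second covers the noise, of order
    \<open>l / \<epsilon>\<close>.\<close>
  have dr: "d * r = sqrt (d * l) + l / \<epsilon>" unfolding r_def distrib_left s1 using d by simp
  have dr1: "sqrt (d * l) \<le> d * r" "l / \<epsilon> \<le> d * r"
    unfolding dr using l1 d \<epsilon> by simp_all
  have dr2: "l \<le> d * r"
  proof -
    have "l \<le> l / \<epsilon>" using l1 \<epsilon> by (simp add: le_divide_eq)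
    then show ?thesis using dr1(2) by linarith
  qed
  have \<gamma>': "\<gamma> = c0 * sqrt (d * l)" using \<gamma> by (simp add: d_def l_def)
  have \<gamma>0: "0 < \<gamma>" unfolding \<gamma>' using c0 d l1 by simp
  have \<theta>4: "\<bar>\<theta>0 i - \<theta>0 j\<bar> \<le> 4" if "i \<in> {1..n}" "j \<in> {1..n}" for i j
    using \<theta>0(2)[OF that(1)] \<theta>0(2)[OF that(2)] by linarith
  have noise: "\<bar>w i\<bar> \<le> 112 * \<kappa>1 * (l / \<epsilon>)" if "i \<in> {1..n}" for i
    using gn that by (simp add: good_noise_def l_def)
  have noise_sum: "\<bar>\<Sum>i\<in>{1..n}. w i\<bar> \<le> 64 * \<kappa>1 / \<epsilon> * sqrt (real n * l)"
    using gn by (simp add: good_noise_def l_def)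
  have half: "real n / 2 \<le> real n - 1" using n3 by simp
  \<comment> \<open>the lower bound on \<open>\<gamma> (n - 1) r\<close> against which the noise terms are compared\<close>
  have base: "c0 / 2 * (l * sqrt l * sqrt (real n) / \<epsilon>) \<le> \<gamma> * ((real n - 1) * r)"
  proof -
    have "sqrt d \<le> sqrt (real n)" using d by simp
    then have "sqrt (real n) * sqrt d \<le> sqrt (real n) * sqrt (real n)" by (intro mult_left_mono) auto
    then have sn: "sqrt (real n) * sqrt d \<le> real n" by simp
    have "sqrt (real n) \<le> real n / sqrt d" using sn d by (simp add: le_divide_eq)
    then have "c0 / 2 * (l * sqrt l / \<epsilon>) * sqrt (real n) \<le> c0 / 2 * (l * sqrt l / \<epsilon>) * (real n / sqrt d)"
      using c0 l1 \<epsilon> by (intro mult_left_mono) auto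
    also have "\<dots> = (c0 * (sqrt d * sqrt l)) * ((real n / 2) * (l / (d * \<epsilon>)))"
    proof -
      have "1 / sqrt d = sqrt d / d" using d by (simp add: field_simps)
      then have "real n / sqrt d = real n * (sqrt d / d)" by (metis times_divide_eq_right mult.right_neutral)
      then show ?thesis by (simp add: mult_ac)
    qed
    also have "\<dots> = \<gamma> * ((real n / 2) * (l / (d * \<epsilon>)))" by (simp add: \<gamma>' real_sqrt_mult)
    also have "\<dots> \<le> \<gamma> * ((real n - 1) * r)"
      using half lp sp \<gamma>0 n3 by (intro mult_left_mono mult_mono) (auto simp: r_def)
    finally show ?thesis by (simp add: mult_ac)
  qed
  have sl: "1 \<le> sqrt l" using l1 by simp
  have ln1: "sqrt (real n) * sqrt l \<le> l * sqrt l * sqrt (real n)"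
  proof -
    have "1 * (sqrt l * sqrt (real n)) \<le> l * (sqrt l * sqrt (real n))" using l1 by (intro mult_right_mono) auto
    then show ?thesis by (simp add: mult_ac)
  qed
  have ln2: "l \<le> l * sqrt l * sqrt (real n)"
  proof -
    have "1 * 1 \<le> sqrt l * sqrt (real n)" using sl n3 by (intro mult_mono) auto
    then have "l * 1 \<le> l * (sqrt l * sqrt (real n))" using l1 by (intro mult_left_mono) auto
    then show ?thesis by (simp add: mult_ac)
  qed
  \<comment> \<open>Prepares \<open>base\<close> for the noise terms: \<open>y / \<epsilon>\<close>
    is their size and \<open>k\<close> their constant; the 2 in the last condition undoes the half
    in \<open>base\<close>.\<close>
  have upto: "k * (y / \<epsilon>) \<le> \<gamma> * ((real n - 1) * (B2 * r))"
    if "y \<le> l * sqrt l * sqrt (real n)" "0 \<le> y" "0 \<le> k" "2 * k \<le> B2 * c0" for y k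
  proof -
    define Y where "Y = l * sqrt l * sqrt (real n) / \<epsilon>"
    have Y: "y / \<epsilon> \<le> Y" "0 \<le> Y" using that \<epsilon> l1 by (auto simp: Y_def divide_right_mono)
    have "k * (y / \<epsilon>) \<le> k * Y" using Y that by (intro mult_left_mono) auto
    also have "\<dots> \<le> B2 * c0 / 2 * Y" using that Y by (intro mult_right_mono) auto
    also have "\<dots> = B2 * (c0 / 2 * Y)" by simp
    also have "\<dots> \<le> B2 * (\<gamma> * ((real n - 1) * r))" using base K(2) unfolding Y_def by (intro mult_left_mono) auto
    finally show ?thesis by (simp add: mult_ac)
  qed
  \<comment> \<open>The 224 in \<open>mean_const\<close> is twice the 112 from the maximum of the
    noise, which also covers twice the 64 from its sum.\<close>
  have B2c: "2 * (112 * \<kappa>1) \<le> B2 * c0" "2 * (64 * \<kappa>1) \<le> B2 * c0"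
    using c0 \<kappa>1 by (simp_all add: B2_def mean_const_def field_simps)
  interpret lo: leave_one_out xdloss "1 / \<kappa>2" \<kappa>2 \<kappa>1 n "wins X" \<gamma> w \<theta>0 d l r B1 B2 c1
  proof
    show "0 < 1 / \<kappa>2" using \<kappa>2 by simp
    show "1 / \<kappa>2 * (y - x) \<le> xdloss y - xdloss x" "xdloss y - xdloss x \<le> \<kappa>2 * (y - x)" if "x \<le> y" for x y
      by (rule xdloss_slope[OF that])+
    show "\<bar>xdloss (\<theta>0 i - \<theta>0 j)\<bar> \<le> \<kappa>1" if "i \<in> {1..n}" "j \<in> {1..n}" for i j
      using xdloss_eq[OF \<theta>4[OF that]] abs_dloss_le by simp
    show "0 < \<kappa>1" "3 \<le> n" "0 < \<gamma>" "0 < d" "d \<le> real n" "0 < r" "0 < B1" "0 < B2" "1 \<le> l" "ln (real n) \<le> l" "1 \<le> c1" "l \<le> d * r"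
      using \<kappa>1 n \<gamma>0 d r0 K l1 c1 dr2 by (auto simp: l_def)
    show "\<bar>score xdloss {1..n} (wins X) \<theta>0 i\<bar> \<le> B1 * (d * r)" if i: "i \<in> {1..n}" for i
    proof -
      have "\<bar>score dloss {1..n} (wins X) \<theta>0 i\<bar> \<le> 8 * \<kappa>1 * sqrt (d * l)"
        using gd i by (simp add: good_data_def d_def l_def)
      also have "\<dots> \<le> 8 * \<kappa>1 * (d * r)" using dr1(1) \<kappa>1 by (intro mult_left_mono) auto
      also have "\<dots> \<le> B1 * (d * r)"
        using \<kappa>1 c0 dr2 l1 by (intro mult_right_mono) (auto simp: B1_def grad_const_def)
      finally show ?thesis using score_xdloss_cong[OF \<theta>4 i, where W = "wins X"] by simp
    qed
    show "\<bar>\<gamma> * \<theta>0 i\<bar> \<le> B1 * (d * r)" if i: "i \<in> {1..n}" for i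
    proof -
      have "\<bar>\<gamma> * \<theta>0 i\<bar> \<le> \<gamma> * 1"
        unfolding abs_mult using \<gamma>0 \<theta>0(2)[OF i] by (intro mult_mono) auto
      also have "\<dots> \<le> c0 * (d * r)" unfolding \<gamma>' using dr1(1) c0 by simp
      also have "\<dots> \<le> B1 * (d * r)"
        using \<kappa>1 c0 dr2 l1 by (intro mult_right_mono) (auto simp: B1_def grad_const_def)
      finally show ?thesis .
    qed
    show "\<bar>w i\<bar> \<le> B1 * (d * r)" if i: "i \<in> {1..n}" for i
    proof -
      have "\<bar>w i\<bar> \<le> 112 * \<kappa>1 * (d * r)"
        using noise[OF i] dr1(2) \<kappa>1 by (intro order_trans[OF noise[OF i]] mult_left_mono) auto
      also have "\<dots> \<le> B1 * (d * r)"
        using \<kappa>1 c0 dr2 l1 by (intro mult_right_mono) (auto simp: B1_def grad_const_def)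
      finally show ?thesis .
    qed
    show "\<bar>\<theta>0 i\<bar> \<le> 1" if "i \<in> {1..n}" for i by (rule \<theta>0(2)[OF that])
    show "(\<Sum>i\<in>{1..n}. \<theta>0 i) = 0" by (rule \<theta>0(1))
    show "\<bar>\<Sum>i\<in>{1..n}. w i\<bar> \<le> \<gamma> * ((real n - 1) * (B2 * r))"
    proof -
      have "64 * \<kappa>1 / \<epsilon> * sqrt (real n * l) = 64 * \<kappa>1 * (sqrt (real n) * sqrt l / \<epsilon>)" by (simp add: real_sqrt_mult)
      also have "\<dots> \<le> \<gamma> * ((real n - 1) * (B2 * r))"
        by (rule upto[OF ln1]) (use \<kappa>1 l1 B2c in auto)
      finally show ?thesis using noise_sum by linarith
    qed
    show "\<bar>w i\<bar> \<le> \<gamma> * ((real n - 1) * (B2 * r))" if i: "i \<in> {1..n}" for i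
      by (rule order_trans[OF noise[OF i] upto[OF ln2]]) (use \<kappa>1 l1 B2c in auto)
    show "1 \<le> (real n - 1) * (B2 * r)"
    proof -
      have "d * \<epsilon> \<le> real n * l"
      proof -
        have "real n * 1 \<le> real n * l" using l1 by (intro mult_left_mono) auto
        then show ?thesis using de d(2) by linarith
      qed
      then have "1 \<le> real n * (l / (d * \<epsilon>))" using d \<epsilon> by (simp add: le_divide_eq)
      also have "\<dots> \<le> real n * r" using sp n3 by (intro mult_left_mono) (auto simp: r_def)
      also have "\<dots> = (real n / 2) * (2 * r)" by simp
      also have "\<dots> \<le> (real n - 1) * (B2 * r)"
        using half r0 n3 \<kappa>1 c0 by (intro mult_mono mult_right_mono) (auto simp: B2_def mean_const_def)
      finally show ?thesis .
    qed
    show "real (card {j \<in> {1..n}. linked (wins X) i j}) \<le> 3 * d" if "i \<in> {1..n}" for i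
      using gd that unfolding good_data_def d_def by blast
    show "d / 16 * real (card S) \<le> real (card {(i, j)\<in>S \<times> ({1..n} - {m} - S). linked (wins X) i j})"
      if "m \<in> {1..n}" "S \<subseteq> {1..n} - {m}" "S \<noteq> {}" "2 * card S \<le> n - 1" for m S
      using gd that unfolding good_data_def d_def by blast
    show "c1 * l \<le> d" using cl de by linarith
    show "1 \<le> d * r" using dr2 l1 by linarith
    show "\<exists>\<theta>'. foc xdloss ({1..n} - {m}) (wins X) \<gamma> w \<theta>' \<and>
        (\<forall>Y. (\<forall>j\<in>{1..n} - {m}. \<bar>\<theta>' j - \<theta>0 j\<bar> \<le> Y) \<longrightarrow>
          (\<Sum>j\<in>{j\<in>{1..n} - {m}. linked (wins X) m j}. \<bar>\<theta>' j - \<theta>0 j\<bar>)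
            \<le> 2 * (d / real n) * (\<Sum>j\<in>{1..n} - {m}. \<bar>\<theta>' j - \<theta>0 j\<bar>) + 7 * l * Y)"
      if m: "m \<in> {1..n}" for m
    proof -
      have dp: "d / real n = p" using n3 by (simp add: d_def)
      have "loo_good n m p l \<gamma> w \<theta>0 (wins X)" using gd m unfolding good_data_def l_def by blast
      then show ?thesis
        using foc_loo_sol[OF \<gamma>0, of n m "wins X" w] unfolding loo_good_def dp by blast
    qed
  qed
  obtain \<theta> where \<theta>: "foc xdloss {1..n} (wins X) \<gamma> w \<theta>"
    using ex_foc_xdloss[OF _ wins_subset[OF X] \<gamma>0] by auto
  have err: "\<bar>\<theta> i - \<theta>0 i\<bar> \<le> rate_const \<kappa>1 \<kappa>2 c0 * r" if "i \<in> {1..n}" for i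
    unfolding rate_const_def B1_def[symmetric] B2_def[symmetric]
    by (rule lo.sup_norm_bound[OF \<theta> that, unfolded lo.E1_def lo.E2_def lo.Cl1_def, OF K(5)])
  \<comment> \<open>Both summands of \<open>r\<close> are at most \<open>1 / sqrt c1\<close>, so
    \<open>r \<le> 2 / sqrt c1\<close>, and
    \<open>4 * (rate_const \<kappa>1 \<kappa>2 c0)\<^sup>2 \<le> c1\<close> suffices.\<close>
  have small: "rate_const \<kappa>1 \<kappa>2 c0 * r \<le> 1"
  proof -
    let ?C = "rate_const \<kappa>1 \<kappa>2 c0"
    have C: "2 * ?C \<le> sqrt c1"
      using K(3,6) by (intro real_le_rsqrt) (simp add: power2_eq_square)
    have le: "l / (d * \<epsilon>) \<le> 1 / c1" using cl c1 d \<epsilon> by (simp add: field_simps)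
    have "c1 * l \<le> d" using cl de by linarith
    then have "l / d \<le> 1 / c1" using c1 d by (simp add: field_simps)
    then have "sqrt (l / d) \<le> sqrt (1 / c1)" by simp
    then have 1: "sqrt (l / d) \<le> 1 / sqrt c1" by (simp add: real_sqrt_divide)
    have "sqrt c1 * 1 \<le> sqrt c1 * sqrt c1" using c1 by (intro mult_left_mono) auto
    then have "sqrt c1 \<le> c1" using c1 by simp
    then have "1 / c1 \<le> 1 / sqrt c1" using c1 by (intro divide_left_mono) auto
    then have "r \<le> 2 / sqrt c1" using 1 le unfolding r_def by simp
    then have "?C * r \<le> ?C * (2 / sqrt c1)" using K(3) by (intro mult_left_mono) auto
    also have "\<dots> = 2 * ?C / sqrt c1" by simp
    also have "\<dots> \<le> 1" using C c1 by (simp add: divide_le_eq)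
    finally show ?thesis .
  qed
  \<comment> \<open>Entries of the truth and errors are at most 1 in absolute value, so entries of
    \<open>\<theta>\<close> are at most 2 and differences at most 4: exactly the range on which
    \<open>xdloss\<close> and \<open>dloss\<close> agree.\<close>
  have near: "\<bar>\<theta> i - \<theta> j\<bar> \<le> 4" if "i \<in> {1..n}" "j \<in> {1..n}" for i j
    using err[OF that(1)] err[OF that(2)] small \<theta>0(2)[OF that(1)] \<theta>0(2)[OF that(2)] by linarith
  have "foc dloss {1..n} (wins X) \<gamma> w \<theta>"
    unfolding foc_def
  proof
    fix k assume k: "k \<in> {1..n}"
    have "score xdloss {1..n} (wins X) \<theta> k = score dloss {1..n} (wins X) \<theta> k"
      by (rule score_xdloss_cong[OF near k])
    then show "score dloss {1..n} (wins X) \<theta> k + \<gamma> * \<theta> k + w k = 0"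
      using \<theta> k unfolding foc_def by metis
  qed
  then have "estimator F n \<gamma> X w i = \<theta> i"
    by (intro foc_unique[OF _ wins_subset[OF X] mono_dloss \<gamma>0 foc_estimator[OF \<gamma>0 X]] i) auto
  then show ?thesis using err[OF i] by (simp add: r_def d_def l_def)
qed

theorem estimator_rate:
  assumes c0: "0 < c0" and n: "3 \<le> n" and p: "0 < p" "p \<le> 1"
    and \<theta>0: "(\<Sum>i\<in>{1..n}. \<theta>0 i) = 0" "max_norm n \<theta>0 \<le> 1"
    and \<epsilon>: "0 < \<epsilon>" "\<epsilon> < 1" and L: "1 \<le> ln (real n)"
    and \<gamma>: "\<gamma> = c0 * sqrt (real n * p * ln (real n))"
    and dens: "degree_const \<kappa>1 \<kappa>2 c0 * ln (real n) \<le> real n * p * \<epsilon>"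
  defines "b \<equiv> 8 * \<kappa>1 / \<epsilon>"
  defines "M \<equiv> measure_pmf (data_pmf F n p \<theta>0) \<Otimes>\<^sub>M laplace_noise n b"
  shows "1 - 11 / real n ^ 5 \<le> measure M {(X, w) \<in> space M.
     max_norm n (\<lambda>i. estimator F n \<gamma> X w i - \<theta>0 i) \<le> rate_const \<kappa>1 \<kappa>2 c0 *
       (sqrt (ln (real n) / (real n * p)) + ln (real n) / (real n * p * \<epsilon>))}"
proof -
  let ?D = "data_pmf F n p \<theta>0" and ?N = "laplace_noise n b"
  define S where "S = {(X, w) \<in> space M.
     max_norm n (\<lambda>i. estimator F n \<gamma> X w i - \<theta>0 i) \<le> rate_const \<kappa>1 \<kappa>2 c0 *
       (sqrt (ln (real n) / (real n * p)) + ln (real n) / (real n * p * \<epsilon>))}"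
  have b: "0 < b" using \<kappa>1 \<epsilon> by (simp add: b_def)
  have n3: "3 \<le> real n" using n by simp
  have \<gamma>0: "0 < \<gamma>" unfolding \<gamma> using c0 p n3 L by simp
  have \<theta>1: "\<bar>\<theta>0 i\<bar> \<le> 1" if "i \<in> {1..n}" for i
    using \<theta>0(2) that unfolding max_norm_def by (subst (asm) Max_le_iff) auto
  have dle: "112 * ln (real n) \<le> real n * p"
  proof -
    have "112 * ln (real n) \<le> degree_const \<kappa>1 \<kappa>2 c0 * ln (real n)"
      using const_pos(4)[OF \<kappa>1 \<kappa>2 c0] L by (intro mult_right_mono) auto
    moreover have "real n * p * \<epsilon> \<le> real n * p" using p \<epsilon> n3 by simp
    ultimately show ?thesis using dens by linarith
  qed
  have "real n * p \<le> real n" using p n3 by simp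
  then have Ln: "2 * ln (real n) \<le> real n" using dle L by linarith
  interpret Lp: prob_space "laplace b" by (rule prob_space_laplace[OF b])
  interpret P: product_prob_space "\<lambda>_::nat. laplace b" "{1..n}" by standard
  interpret N: prob_space ?N unfolding laplace_noise_def by (rule P.prob_space_axioms)
  interpret DN: pair_prob_space "measure_pmf ?D" ?N by standard
  have DM: "prob_space M" unfolding M_def by (rule DN.prob_space_axioms)
  interpret M: prob_space M by (rule DM)
  have Sm: "S \<in> sets M"
    unfolding S_def M_def using n by (intro estimator_event_measurable[OF \<gamma>0]) auto
  define B where "B = {w \<in> space ?N. \<not> good_noise n b w}"
  have B: "B \<in> sets ?N" "measure ?N B \<le> 5 / real n ^ 5"
    unfolding B_def by (rule good_noise_prob[OF b n Ln])+
  have good: "(X, w) \<in> S"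
    if w: "w \<in> space ?N" "good_noise n b w" and z: "z \<in> set_pmf (outcomes_pmf F n p \<theta>0)"
      and gd: "good_data n p \<gamma> w \<theta>0 (outcome_wins z)" and X: "X = to_data z" for X w z
  proof -
    have Xd: "X \<in> data_sets n" unfolding X by (rule to_data_in_data_sets[OF z])
    have "\<bar>estimator F n \<gamma> X w i - \<theta>0 i\<bar> \<le> rate_const \<kappa>1 \<kappa>2 c0 *
       (sqrt (ln (real n) / (real n * p)) + ln (real n) / (real n * p * \<epsilon>))" if i: "i \<in> {1..n}" for i
      by (rule estimator_error[OF c0 n p \<theta>0(1) \<theta>1 \<epsilon> L \<gamma> dens Xd _ w(2)[unfolded b_def] i])
         (use gd X in auto)
    then have "max_norm n (\<lambda>i. estimator F n \<gamma> X w i - \<theta>0 i) \<le> rate_const \<kappa>1 \<kappa>2 c0 *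
       (sqrt (ln (real n) / (real n * p)) + ln (real n) / (real n * p * \<epsilon>))"
      unfolding max_norm_def using n by (subst Max_le_iff) auto
    then show ?thesis using w(1) by (simp add: S_def M_def space_pair_measure)
  qed
  \<comment> \<open>\<open>good_data\<close> depends on \<open>w\<close> through the leave-one-out
    solutions, and its probability bound holds for each fixed \<open>w\<close>. Integrating over the
    noise then adds the probability of bad noise: 11 = 6 + 5.\<close>
  have cond: "emeasure (measure_pmf ?D) ((\<lambda>X. (X, w)) -` (space M - S)) \<le> ennreal (6 / real n ^ 5) + indicator B w"
    if w: "w \<in> space ?N" for w
  proof (cases "good_noise n b w")
    case True
    have "measure (measure_pmf (outcomes_pmf F n p \<theta>0)) {z. (to_data z, w) \<in> space M - S} \<le> 6 / real n ^ 5"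
    proof (rule measure_pmf_support_bound[OF good_data_prob[OF p n dle, of \<theta>0 \<gamma> w]])
      fix z assume "z \<in> set_pmf (outcomes_pmf F n p \<theta>0)" "z \<in> {z. (to_data z, w) \<in> space M - S}"
      then show "z \<in> {z. \<not> good_data n p \<gamma> w \<theta>0 (outcome_wins z)}"
        using good[OF w True] by blast
    qed
    then have "emeasure (measure_pmf ?D) ((\<lambda>X. (X, w)) -` (space M - S)) \<le> ennreal (6 / real n ^ 5)"
      unfolding data_pmf_eq by (simp add: measure_pmf.emeasure_eq_measure vimage_def ennreal_leI)
    then show ?thesis by (rule order_trans) simp
  next
    case False
    then have "w \<in> B" using w by (simp add: B_def)
    have "emeasure (measure_pmf ?D) ((\<lambda>X. (X, w)) -` (space M - S)) \<le> 1"
      by (rule measure_pmf.emeasure_le_1)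
    also have "1 \<le> ennreal (6 / real n ^ 5) + indicator B w" using \<open>w \<in> B\<close> by (simp add: add_increasing)
    finally show ?thesis .
  qed
  have "emeasure M (space M - S) = (\<integral>\<^sup>+w. emeasure (measure_pmf ?D) ((\<lambda>X. (X, w)) -` (space M - S)) \<partial>?N)"
    using Sm unfolding M_def by (intro DN.emeasure_pair_measure_alt2) auto
  also have "\<dots> \<le> (\<integral>\<^sup>+w. ennreal (6 / real n ^ 5) + indicator B w \<partial>?N)"
    by (intro nn_integral_mono cond)
  also have "\<dots> = ennreal (6 / real n ^ 5) + emeasure ?N B"
    using B(1) by (simp add: nn_integral_add N.emeasure_space_1)
  also have "\<dots> \<le> ennreal (6 / real n ^ 5) + ennreal (5 / real n ^ 5)"
    using B(2) by (intro add_left_mono) (simp add: N.emeasure_eq_measure ennreal_leI)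
  also have "\<dots> = ennreal (11 / real n ^ 5)"
    by (subst ennreal_plus[symmetric]) (auto simp: add_divide_distrib[symmetric])
  finally have "measure M (space M - S) \<le> 11 / real n ^ 5"
    by (simp add: M.emeasure_eq_measure)
  then show ?thesis
    using M.prob_compl[OF Sm] unfolding S_def by linarith
qed

end

theorem theorem2p1:
  fixes \<kappa>1 \<kappa>2 c0 :: real
  assumes "0 < \<kappa>1" and "0 < \<kappa>2" and "0 < c0"
  shows "\<exists>c1>0. \<exists>c2>0. \<exists>C>0. \<exists>K>0.
    \<forall>(F :: real \<Rightarrow> real) (n :: nat) (\<theta>0 :: nat \<Rightarrow> real) (p :: real) (\<epsilon> :: real) (\<gamma> :: real) (lam :: real).
      twice_differentiable F \<and> link_A0 F \<and> link_A1 \<kappa>1 F \<and> link_A2 \<kappa>2 F \<and>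
      2 \<le> n \<and> 0 < p \<and> p \<le> 1 \<and>
      (\<Sum>i\<in>{1..n}. \<theta>0 i) = 0 \<and> max_norm n \<theta>0 \<le> 1 \<and>
      \<gamma> = c0 * sqrt (real n * p * ln (real n)) \<and>
      p \<ge> c1 * (ln (real n) / (real n * \<epsilon>)) \<and>
      lam = 8 * \<kappa>1 / \<epsilon> \<and>
      c2 * ln (real n) powr (- 1 / 2) < \<epsilon> \<and> \<epsilon> < 1
      \<longrightarrow>
      edge_diff_private n (euclid n) \<epsilon> 0 (estimator_mechanism F n \<gamma> lam) \<and>
      measure (measure_pmf (data_pmf F n p \<theta>0) \<Otimes>\<^sub>M laplace_noise n lam)
        {(X, w) \<in> space (measure_pmf (data_pmf F n p \<theta>0) \<Otimes>\<^sub>M laplace_noise n lam).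
           max_norm n (\<lambda>i. estimator F n \<gamma> X w i - \<theta>0 i)
             \<le> C * (sqrt (ln (real n) / (real n * p)) + ln (real n) / (real n * p * \<epsilon>))}
        \<ge> 1 - K / real n ^ 5"
proof -
  note K = const_pos[OF assms]
  \<comment> \<open>As \<open>\<epsilon> < 1\<close>, the 2 in \<open>?c2\<close> forces
    \<open>ln n > 4\<close> and excludes small \<open>n\<close>. The summand
    \<open>8 * \<kappa>2 / c0\<close> provides
    \<open>8 * \<kappa>2 / \<gamma> \<le> \<epsilon>\<close> for the privacy part, because
    \<open>\<gamma>\<close> turns out to be at least \<open>c0 * ln n\<close>.\<close>
  let ?c1 = "degree_const \<kappa>1 \<kappa>2 c0" and ?c2 = "2 + 8 * \<kappa>2 / c0" and ?C = "rate_const \<kappa>1 \<kappa>2 c0"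
  have c1: "0 < ?c1" "1 \<le> ?c1" using K(4) by linarith+
  have c2: "2 \<le> ?c2" "8 * \<kappa>2 / c0 \<le> ?c2" "0 < ?c2" using assms by (simp_all add: add_pos_pos)
  have main: "edge_diff_private n (euclid n) \<epsilon> 0 (estimator_mechanism F n \<gamma> lam) \<and>
      measure (measure_pmf (data_pmf F n p \<theta>0) \<Otimes>\<^sub>M laplace_noise n lam)
        {(X, w) \<in> space (measure_pmf (data_pmf F n p \<theta>0) \<Otimes>\<^sub>M laplace_noise n lam).
           max_norm n (\<lambda>i. estimator F n \<gamma> X w i - \<theta>0 i)
             \<le> ?C * (sqrt (ln (real n) / (real n * p)) + ln (real n) / (real n * p * \<epsilon>))}
        \<ge> 1 - 11 / real n ^ 5"
    if F: "twice_differentiable F" "link_A0 F" "link_A1 \<kappa>1 F" "link_A2 \<kappa>2 F" and n: "2 \<le> n" and p: "0 < p" "p \<le> 1"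
      and \<theta>0: "(\<Sum>i\<in>{1..n}. \<theta>0 i) = 0" "max_norm n \<theta>0 \<le> 1"
      and \<gamma>: "\<gamma> = c0 * sqrt (real n * p * ln (real n))"
      and dens: "p \<ge> ?c1 * (ln (real n) / (real n * \<epsilon>))" and lam: "lam = 8 * \<kappa>1 / \<epsilon>"
      and \<epsilon>: "?c2 * ln (real n) powr (- 1 / 2) < \<epsilon>" "\<epsilon> < 1"
    for F :: "real \<Rightarrow> real" and n :: nat and \<theta>0 :: "nat \<Rightarrow> real" and p \<epsilon> \<gamma> lam :: real
  proof -
    interpret link F \<kappa>1 \<kappa>2 using F assms by unfold_locales
    define l where "l = ln (real n)"
    have l0: "0 < l" using n by (simp add: l_def)
    have pw: "l powr (- 1 / 2) = 1 / sqrt l"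
      using l0 by (simp add: powr_minus powr_half_sqrt inverse_eq_divide)
    have sl: "0 < sqrt l" using l0 by simp
    have e: "?c2 < \<epsilon> * sqrt l" using \<epsilon>(1) sl unfolding l_def[symmetric] pw by (simp add: divide_less_eq)
    \<comment> \<open>Positivity of \<open>\<epsilon>\<close> comes from its lower bound with
      \<open>?c2\<close>, since \<open>ln n\<close> is positive.\<close>
    have \<epsilon>0: "0 < \<epsilon>"
      using e c2(3) sl by (metis less_trans zero_less_mult_pos2)
    have "\<epsilon> * sqrt l < 1 * sqrt l" using \<epsilon>(2) sl by (intro mult_strict_right_mono) auto
    then have s2: "2 < sqrt l" using e c2(1) by linarith
    have "2 * 2 < sqrt l * sqrt l" using s2 l0 by (intro mult_strict_mono) auto
    then have l4: "4 < l" using l0 by simp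
    have "n \<noteq> 2"
    proof
      assume "n = 2"
      then show False using l4 ln_le_minus_one[of "2::real"] by (simp add: l_def)
    qed
    then have n3: "3 \<le> n" using n by simp
    have el: "8 * \<kappa>2 / c0 \<le> \<epsilon> * l"
    proof -
      have "\<epsilon> * sqrt l * 1 \<le> \<epsilon> * sqrt l * sqrt l" using \<epsilon>0 s2 l4 by (intro mult_left_mono) auto
      also have "\<dots> = \<epsilon> * l" using l0 by simp
      finally show ?thesis using e c2(2) by linarith
    qed
    have dens': "?c1 * l \<le> real n * p * \<epsilon>"
      using dens n \<epsilon>0 by (simp add: l_def field_simps)
    have "l \<le> real n * p"
    proof -
      have "1 * l \<le> ?c1 * l" using c1 l0 by (intro mult_right_mono) auto
      moreover have "real n * p * \<epsilon> \<le> real n * p * 1"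
        using p \<epsilon>(2) by (intro mult_left_mono) auto
      ultimately show ?thesis using dens' by linarith
    qed
    \<comment> \<open>The density condition makes \<open>n * p\<close> at least \<open>l\<close>, so
      the geometric mean of \<open>n * p\<close> and \<open>l\<close> is at least \<open>l\<close>
      too.\<close>
    then have "l * l \<le> real n * p * l" using l0 by (intro mult_right_mono) auto
    then have "l \<le> sqrt (real n * p * l)" by (intro real_le_rsqrt) (simp add: power2_eq_square)
    then have \<gamma>l: "c0 * l \<le> \<gamma>" unfolding \<gamma> l_def[symmetric] using assms(3) by simp
    have \<gamma>0: "0 < \<gamma>" using \<gamma>l assms(3) l0 by (meson less_le_trans mult_pos_pos)
    have "8 * \<kappa>2 \<le> \<epsilon> * l * c0" using el assms(3) by (simp add: pos_divide_le_eq)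
    also have "\<dots> = \<epsilon> * (c0 * l)" by simp
    also have "\<dots> \<le> \<epsilon> * \<gamma>" using \<gamma>l \<epsilon>0 by (intro mult_left_mono) auto
    finally have large: "8 * \<kappa>2 / \<gamma> \<le> \<epsilon>" using \<gamma>0 by (simp add: pos_divide_le_eq)
    have "1 \<le> ln (real n)" using l4 by (simp add: l_def)
    from estimator_rate[OF assms(3) n3 p \<theta>0 \<epsilon>0 \<epsilon>(2) this \<gamma> dens'[unfolded l_def]] edge_privacy[OF \<gamma>0 \<epsilon>0 large]
    show ?thesis unfolding lam by blast
  qed
  show ?thesis
    by (rule exI[of _ ?c1], rule conjI[OF c1(1)], rule exI[of _ ?c2], rule conjI[OF c2(3)],
        rule exI[of _ ?C], rule conjI[OF K(3)], rule exI[of _ 11], rule conjI, simp)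
       (intro allI impI, elim conjE, rule main)
qed

end
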